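(* Let $\Lambda$ be a quasi-lacunary and subgeometric sequence. Let $\beta\geq1$ and $\alpha>0$, and let $\mu$ be a positive Borel measure on $[0,1]$. Then the following are equivalent: (i) the measure $\mu$ belongs to $\mathcal M_{x^{\alpha\beta}}$; (ii) for any $p\geq\beta$, there holds $M_{\Lambda,\alpha}^{p/\beta}\hookrightarrow L^p(\mathrm d\mu)$.
   Context: $\Lambda=\{\lambda_k\}_{k\geq 0}$ is an increasing sequence of positive real numbers with $\sum_{k\ge0}1/\lambda_k<\infty$. $M_\Lambda$ is the space of functions $f:[0,1]\to\mathbb C$ of the form $f(t)=\sum_{k=0}^K a_kt^{\lambda_k}$, $a_k\in\mathbb C$, $K\geq 0$. $\Lambda$ is quasi-lacunary if there exist $N\geq1$, $q_0>1$ and a strictly increasing sequence of integers $(n_k)_{k\ge0}$ (with $n_0=-1$) such that $\Lambda$ is the disjoint union of the blocks $E_k=\{\lambda_{n_k+1},\dots,\lambda_{n_{k+1}}\}$, $k\ge 0$, with $\#E_k\leq N$ for all $k$ and $\lambda_{n_{k+1}}/\lambda_{n_k}>q_0$ for all $k$ large enough. It is quasi-lacunary and subgeometric if in addition, for some $q'>1$, $\lambda_{n_{k+1}}/\lambda_{n_k}\leq q'$ for all $k$ large enough. For $\gamma>0$, $\mathcal M_{x^\gamma}$ is the set of positive Borel measures $\mu$ supported on $[0,1]$ for which there is a constant $C>0$ (depending only on $\mu$) such that $\mu([1-\varepsilon,1])\leq C\varepsilon^\gamma$ for all $\varepsilon\in(0,1)$. $\mathrm d\nu_{\alpha-1}=(1-x)^{\alpha-1}\mathrm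 dx$ on $[0,1]$. The embedding $M_{\Lambda,\alpha}^{p/\beta}\hookrightarrow L^p(\mathrm d\mu)$ means that there is a constant $C>0$ such that $\|f\|_{L^p(\mathrm d\mu)}\leq C\|f\|_{L^{p/\beta}(\mathrm d\nu_{\alpha-1})}$ for all $f\in M_\Lambda$.
   Formalization: The positive Borel measure μ on [0,1] is taken to be finite; for infinite measures, e.g. dx/x on (0,1/2], (ii) holds while (i) fails as ε tends to 1. *)

theory Defs
  imports "HOL-Analysis.Analysis"
begin

text \<open>
  Functions on \<open>[0,1]\<close> are total functions on the reals of which only the values on \<open>[0,1]\<close>
  matter. Note that \<open>0 powr x = 0\<close>, in agreement with \<open>t\<^sup>\<lambda>\<close> at \<open>t = 0\<close> for \<open>\<lambda> > 0\<close>.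
\<close>
definition muntz_space :: "(nat \<Rightarrow> real) \<Rightarrow> (real \<Rightarrow> complex) set" where
  "muntz_space \<Lambda> =
    {f. \<exists>K (a :: nat \<Rightarrow> complex). \<forall>t\<in>{0..1}. f t = (\<Sum>k\<le>K. a k * complex_of_real (t powr \<Lambda> k))}"

definition muntz_block :: "(nat \<Rightarrow> real) \<Rightarrow> (nat \<Rightarrow> int) \<Rightarrow> nat \<Rightarrow> real set" where
  "muntz_block \<Lambda> n k = {\<Lambda> j |j. n k < int j \<and> int j \<le> n (Suc k)}"

text \<open>
  The block ends \<open>n\<close> are integers because \<open>n 0 = -1\<close>; all later ones are natural numbers, so
  \<open>nat\<close> truncates only at index \<open>0\<close>, which the eventual conditions on the ratios ignore.
\<close>
definition muntz_ratio :: "(nat \<Rightarrow> real) \<Rightarrow> (nat \<Rightarrow> int) \<Rightarrow> nat \<Rightarrow> real" where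
  "muntz_ratio \<Lambda> n k = \<Lambda> (nat (n (Suc k))) / \<Lambda> (nat (n k))"

definition quasi_lacunary_blocks :: "(nat \<Rightarrow> real) \<Rightarrow> nat \<Rightarrow> real \<Rightarrow> (nat \<Rightarrow> int) \<Rightarrow> bool" where
  "quasi_lacunary_blocks \<Lambda> N q0 n \<longleftrightarrow>
     N \<ge> 1 \<and> q0 > 1 \<and> strict_mono n \<and> n 0 = -1 \<and>
     range \<Lambda> = (\<Union>k. muntz_block \<Lambda> n k) \<and> disjoint_family (muntz_block \<Lambda> n) \<and>
     (\<forall>k. card (muntz_block \<Lambda> n k) \<le> N) \<and>
     (\<forall>\<^sub>F k in sequentially. muntz_ratio \<Lambda> n k > q0)"

text \<open>The upper bound on the ratios refers to the same decomposition into blocks.\<close>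
definition quasi_lacunary_subgeometric :: "(nat \<Rightarrow> real) \<Rightarrow> bool" where
  "quasi_lacunary_subgeometric \<Lambda> \<longleftrightarrow>
     (\<exists>N q0 n. quasi_lacunary_blocks \<Lambda> N q0 n \<and>
        (\<exists>q'>1. \<forall>\<^sub>F k in sequentially. muntz_ratio \<Lambda> n k \<le> q'))"

text \<open>
  Positive Borel measures on the compact interval \<open>[0,1]\<close> are finite by convention. Without this,
  the measure with density \<open>1/x\<close> on \<open>(0,1/2]\<close> gives infinite mass to \<open>(0,1]\<close>, although the
  powers \<open>t\<^sup>\<lambda>\<close> with \<open>\<lambda> > 0\<close> are all integrable.
\<close>
definition borel_measure_unit :: "real measure \<Rightarrow> bool" where
  "borel_measure_unit \<mu> \<longleftrightarrow> finite_measure \<mu> \<and> sets \<mu> = sets (restrict_space borel {0..1})"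

definition carleson_class :: "real \<Rightarrow> real measure set" where
  "carleson_class \<gamma> =
     {\<mu>. borel_measure_unit \<mu> \<and>
       (\<exists>C>0. \<forall>\<epsilon>\<in>{0<..<1}. emeasure \<mu> {1-\<epsilon>..1} \<le> ennreal (C * \<epsilon> powr \<gamma>))}"

text \<open>\<open>nu a\<close> is the measure \<open>(1 - x)\<^sup>a dx\<close> on \<open>[0,1]\<close>.\<close>
definition nu :: "real \<Rightarrow> real measure" where
  "nu a = density (restrict_space lborel {0..1}) (\<lambda>x. ennreal ((1 - x) powr a))"

definition Lp_norm :: "real \<Rightarrow> real measure \<Rightarrow> (real \<Rightarrow> complex) \<Rightarrow> ennreal" where
  "Lp_norm p M f =
     (let I = (\<integral>\<^sup>+ x. ennreal (norm (f x) powr p) \<partial>M)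
      in if I = \<infinity> then \<infinity> else ennreal (enn2real I powr (1 / p)))"

text \<open>\<open>muntz_embeds \<Lambda> r \<nu> p \<mu>\<close>: the space \<open>M\<^sub>\<Lambda>\<close> with the norm of \<open>L\<^sup>r(\<nu>)\<close> embeds into \<open>L\<^sup>p(\<mu>)\<close>.\<close>
definition muntz_embeds ::
    "(nat \<Rightarrow> real) \<Rightarrow> real \<Rightarrow> real measure \<Rightarrow> real \<Rightarrow> real measure \<Rightarrow> bool" where
  "muntz_embeds \<Lambda> r \<nu> p \<mu> \<longleftrightarrow>
     (\<exists>C>0. \<forall>f\<in>muntz_space \<Lambda>. Lp_norm p \<mu> f \<le> ennreal C * Lp_norm r \<nu> f)"

end

theory Submission
  imports Defs "HOL-Real_Asymp.Real_Asymp"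
begin

text \<open>
  Put \<open>t = e\<^sup>-\<^sup>u\<close>, so that an element of the Muntz space becomes an exponential sum
  \<open>F u = (\<Sum>k<n. a k * e\<^sup>-\<^sup>\<lambda>\<^sup>u)\<close> with \<open>\<lambda> = l k\<close>. The quasi-lacunary condition
  says no more than that \<open>l (k + j)\<close> is at least a constant times \<open>q\<^sup>j * l k\<close> for some \<open>q > 1\<close>
  (\<open>geometric_growth\<close>); nothing is lost by forgetting the blocks, and two exponents may
  be arbitrarily close. This condition is invariant under the dilations \<open>u \<mapsto> s * u\<close>, and so are
  the constants in the estimates at a point \<open>x\<close> below.

  That Carleson measures embed rests on a pointwise bound (\<open>norm_exp_sum_le_kernel\<close>)
  of \<open>\<bar>F x\<bar>\<close> by a constant times the integral of \<open>\<bar>F z\<bar> * (z / (z + x))\<^sup>B / z\<close> over \<open>z > 0\<close>,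
  for any \<open>B\<close>. The exponents are divided at \<open>1 / x\<close>, and both halves are removed by
  operators that commute with translations.

  Rapidly decaying exponentials, \<open>\<lambda> * x\<close> large, are removed by the backward differences
  \<open>F u - e\<^sup>-\<^sup>\<lambda>\<^sup>h * F (u - h)\<close>. With steps \<open>h\<close> that decrease geometrically the total displacement is
  at most \<open>x / 2\<close> while the coefficients have an arbitrarily small sum
  (\<open>shift_annihilator_exists\<close>). Slowly decaying exponentials are removed by forward averages,
  that is by powers of the resolvent multipliers \<open>\<rho> / (\<rho> + \<lambda>)\<close>. Each of these costs a constant
  factor, so that the cost is geometric in the number of exponents; but this is affordable for a
  derivative of \<open>F\<close> of sufficiently high order \<open>m\<close>, because the contribution of \<open>\<lambda>\<close>
  carries the factor \<open>\<lambda>\<^sup>m\<close>, which decreases geometrically with a ratio as small as desired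
  (\<open>norm_exp_sum_power_le_tail_integral\<close>). Together this bounds the \<open>m\<close>-th derivative at \<open>x\<close> by an
  integral of \<open>\<bar>F\<bar>\<close> plus a small multiple of the same derivative on \<open>[x / 2, x]\<close>, which
  is absorbed (\<open>norm_exp_sum_power_le_kernel\<close>). Integrating \<open>m\<close> times returns to \<open>F\<close>.

  An elementary convexity argument turns the kernel bound into one for \<open>\<bar>F\<bar>\<^sup>r\<close>, \<open>r = p / \<beta> \<ge> 1\<close>. Summed over
  the dyadic cells \<open>u \<approx> 2\<^sup>-\<^sup>j\<close>, it says that the numbers \<open>2\<^sup>-\<^sup>j\<^sup>\<alpha> * sup \<bar>F\<bar>\<^sup>r\<close> have a sum bounded by
  the integral of \<open>\<bar>f\<bar>\<^sup>r\<close> against \<open>(1 - t)\<^sup>\<alpha>\<^sup>-\<^sup>1 dt\<close> (\<open>exp_sum_dyadic_majorant\<close>). The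
  \<open>\<mu>\<close>-measure of a cell is at most a constant times \<open>2\<^sup>-\<^sup>j\<^sup>\<alpha>\<^sup>\<beta>\<close>, and \<open>\<ell>\<^sup>1 \<subseteq> \<ell>\<^sup>\<beta>\<close> finishes the
  proof (\<open>carleson_embedding\<close>).

  Conversely, the embedding for \<open>p = \<beta>\<close> is tested on \<open>t\<^sup>\<lambda>\<close>, which is bounded below on \<open>[1 - \<epsilon>, 1]\<close>
  when \<open>\<lambda> \<le> 1 / \<epsilon>\<close> and has norm at most a constant times \<open>\<lambda>\<^sup>-\<^sup>\<alpha>\<close>. The subgeometric condition
  provides an exponent \<open>\<lambda>\<close> comparable to \<open>1 / \<epsilon>\<close> for every small \<open>\<epsilon>\<close> (\<open>muntz_embeds_imp_carleson\<close>).
\<close>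

section \<open>Exponential sums as Laplace transforms\<close>

definition exp_sum :: "(nat \<Rightarrow> real) \<Rightarrow> nat \<Rightarrow> (nat \<Rightarrow> complex) \<Rightarrow> real \<Rightarrow> complex" where
  "exp_sum l n a u = (\<Sum>k<n. a k * complex_of_real (exp (- (l k * u))))"

lemma continuous_on_exp_sum [continuous_intros]:
  assumes "continuous_on A f"
  shows "continuous_on A (\<lambda>u. exp_sum l n a (f u))"
  unfolding exp_sum_def by (intro continuous_intros assms)

lemma borel_measurable_exp_sum [measurable]: "exp_sum l n a \<in> borel_measurable borel"
  by (intro borel_measurable_continuous_onI continuous_intros)

lemma exp_sum_cong: "(\<And>k. k < n \<Longrightarrow> a k = b k) \<Longrightarrow> exp_sum l n a u = exp_sum l n b u"
  unfolding exp_sum_def by (intro sum.cong) auto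

lemma exp_sum_add: "exp_sum l n (\<lambda>k. a k + b k) u = exp_sum l n a u + exp_sum l n b u"
  unfolding exp_sum_def by (simp add: algebra_simps sum.distrib)

lemma exp_sum_diff: "exp_sum l n (\<lambda>k. a k - b k) u = exp_sum l n a u - exp_sum l n b u"
  unfolding exp_sum_def by (simp add: algebra_simps sum_subtractf)

lemma exp_sum_cmult: "exp_sum l n (\<lambda>k. c * a k) u = c * exp_sum l n a u"
  unfolding exp_sum_def by (simp add: algebra_simps sum_distrib_left)

lemma exp_sum_sum: "exp_sum l n (\<lambda>k. \<Sum>i\<in>I. a i k) u = (\<Sum>i\<in>I. exp_sum l n (a i) u)"
  unfolding exp_sum_def sum_distrib_right by (rule sum.swap)

lemma has_bochner_integral_exp_minus_Ici:
  fixes c :: real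
  assumes "c > 0"
  shows "has_bochner_integral lborel (\<lambda>w. indicator {0..} w * exp (- (c * w))) (1 / c)"
proof (rule has_bochner_integral_nn_integral)
  have lim: "((\<lambda>w. - exp (- (c * w)) / c) \<longlongrightarrow> - 0 / c) at_top"
    using assms
    by (intro tendsto_divide tendsto_minus tendsto_const filterlim_compose[OF exp_at_bot]
          filterlim_compose[OF filterlim_uminus_at_bot_at_top]
          filterlim_tendsto_pos_mult_at_top[OF tendsto_const]) (auto simp: filterlim_ident)
  have "(\<integral>\<^sup>+w\<in>{0..}. ennreal (exp (- (c * w))) \<partial>lborel)
      = ennreal (- 0 / c - (- exp (- (c * 0)) / c))"
    using assms by (intro nn_integral_FTC_atLeast lim) (auto intro!: derivative_eq_intros)
  then show "(\<integral>\<^sup>+w. ennreal (indicator {0..} w * exp (- (c * w))) \<partial>lborel) = ennreal (1 / c)"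
    by (simp add: ennreal_mult' ennreal_indicator mult.commute)
qed (use assms in auto)

text \<open>
  A multiplier \<open>1 / (r + \<lambda>)\<close> on the coefficients is an average of forward translates, because
  \<open>e\<^sup>-\<^sup>\<lambda>\<^sup>x / (r + \<lambda>)\<close> is the integral of \<open>e\<^sup>-\<^sup>r\<^sup>w * e\<^sup>-\<^sup>\<lambda>\<^sup>(\<^sup>x\<^sup>+\<^sup>w\<^sup>)\<close> over \<open>w \<ge> 0\<close>. The case \<open>r > 0\<close> gives
  resolvents, the case \<open>r = 0\<close> recovers a sum from its derivative.
\<close>
lemma norm_exp_sum_le_laplace:
  assumes l: "\<And>k. k < n \<Longrightarrow> l k > 0" and r: "r \<ge> 0"
  shows "ennreal (norm (exp_sum l n (\<lambda>k. a k / of_real (r + l k)) x))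
    \<le> (\<integral>\<^sup>+w\<in>{0..}. ennreal (exp (- (r * w)) * norm (exp_sum l n a (x + w))) \<partial>lborel)"
proof -
  define g where "g w = (\<Sum>k<n. (a k * of_real (exp (- (l k * x)))) *
      complex_of_real (indicator {0..} w * exp (- ((r + l k) * w))))" for w
  have "has_bochner_integral lborel g
     (\<Sum>k<n. (a k * of_real (exp (- (l k * x)))) * complex_of_real (1 / (r + l k)))"
    unfolding g_def
    by (intro has_bochner_integral_sum has_bochner_integral_mult_right has_bochner_integral_of_real
        has_bochner_integral_exp_minus_Ici add_nonneg_pos r l) auto
  also have "(\<Sum>k<n. (a k * of_real (exp (- (l k * x)))) * complex_of_real (1 / (r + l k)))
     = exp_sum l n (\<lambda>k. a k / of_real (r + l k)) x"
    unfolding exp_sum_def by (intro sum.cong) auto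
  finally have "has_bochner_integral lborel g (exp_sum l n (\<lambda>k. a k / of_real (r + l k)) x)" .
  then have "ennreal (norm (exp_sum l n (\<lambda>k. a k / of_real (r + l k)) x)) \<le> (\<integral>\<^sup>+w. norm (g w) \<partial>lborel)"
    by (metis has_bochner_integral_iff integral_norm_bound_ennreal)
  also have "(\<integral>\<^sup>+w. norm (g w) \<partial>lborel) = (\<integral>\<^sup>+w\<in>{0..}. ennreal (exp (- (r * w)) * norm (exp_sum l n a (x + w))) \<partial>lborel)"
  proof (intro nn_integral_cong)
    fix w :: real
    have "g w = indicator {0..} w *\<^sub>R (of_real (exp (- (r * w))) * exp_sum l n a (x + w))"
      unfolding g_def exp_sum_def
      by (auto simp: indicator_def sum_distrib_left algebra_simps exp_add exp_diff exp_minus intro!: sum.cong)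
         (simp add: field_simps)
    then show "ennreal (norm (g w)) = ennreal (exp (- (r * w)) * norm (exp_sum l n a (x + w))) * indicator {0..} w"
      by (auto simp: indicator_def norm_mult)
  qed
  finally show ?thesis .
qed

section \<open>Resolvents and smooth peaks acting on exponential sums\<close>

text \<open>
  A mean of \<open>\<bar>F\<bar>\<close> to the right of \<open>x\<close> at the scale \<open>1 / c\<close>. The polynomial decay of the weight makes
  the mean almost invariant under averages at smaller scales, which exponential decay would not.
\<close>
definition weighted_mean :: "real \<Rightarrow> (real \<Rightarrow> complex) \<Rightarrow> real \<Rightarrow> ennreal" where
  "weighted_mean c F x = (\<integral>\<^sup>+v\<in>{0..}. ennreal (c / (1 + c * v)\<^sup>2 * norm (F (x + v))) \<partial>lborel)"

lemma nn_integral_exp_quadratic: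
  fixes c r :: real
  assumes "c > 0" "r > 0"
  shows "(\<integral>\<^sup>+w\<in>{0..}. ennreal (r * exp (- (r * w)) * (1 + c * w)\<^sup>2) \<partial>lborel)
    = ennreal (1 + 2 * (c / r) + 2 * (c / r)\<^sup>2)"
proof -
  define G where "G w = - exp (- (r * w)) * ((1 + c * w)\<^sup>2 + 2 * (c / r) * (1 + c * w) + 2 * (c / r)\<^sup>2)" for w
  have lim: "(G \<longlongrightarrow> 0) at_top" unfolding G_def using assms by real_asymp
  have deriv: "(G has_real_derivative r * exp (- (r * w)) * (1 + c * w)\<^sup>2) (at w)" for w
    unfolding G_def using assms
    by (auto simp: field_simps power2_eq_square intro!: derivative_eq_intros)
  have "(\<integral>\<^sup>+w\<in>{0..}. ennreal (r * exp (- (r * w)) * (1 + c * w)\<^sup>2) \<partial>lborel)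
      = ennreal (0 - G 0)"
    using assms by (intro nn_integral_FTC_atLeast lim deriv) auto
  then show ?thesis by (simp add: G_def algebra_simps)
qed

text \<open>
  The weight satisfies \<open>1 + c (v + w) \<le> (1 + c v) (1 + c w)\<close>, so a translation by \<open>w\<close> costs a factor
  \<open>(1 + c w)\<^sup>2\<close>, whose mean under the exponential law of rate \<open>r\<close> is explicit. The form
  \<open>exp (2 * (c / r))\<close> of the constant is what allows iteration: \<open>L\<close> resolvents at rate \<open>L * c\<close> cost
  \<open>e\<^sup>2\<close> for every \<open>L\<close>.
\<close>
lemma weighted_mean_resolvent_le:
  assumes l: "\<And>k. k < n \<Longrightarrow> l k > 0" and c: "0 < c" and r: "0 < r"
  shows "weighted_mean c (exp_sum l n (\<lambda>k. a k * of_real (r / (r + l k)))) x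
     \<le> ennreal (exp (2 * (c / r))) * weighted_mean c (exp_sum l n a) x"
proof -
  let ?F = "exp_sum l n a"
  have 1: "ennreal (norm (exp_sum l n (\<lambda>k. a k * of_real (r / (r + l k))) y))
     \<le> (\<integral>\<^sup>+w\<in>{0..}. ennreal (r * exp (- (r * w)) * norm (?F (y + w))) \<partial>lborel)" for y
    using norm_exp_sum_le_laplace[where l = l and n = n and r = r and x = y and a = "\<lambda>k. of_real r * a k", OF l] r
    by (simp add: exp_sum_cmult norm_mult mult_ac)
  have shift: "(\<integral>\<^sup>+v. ennreal (c / (1 + c * (v + w))\<^sup>2 * norm (?F (x + (v + w)))) * indicator {0..} (v + w) \<partial>lborel)
        = weighted_mean c ?F x" for w
    unfolding weighted_mean_def
    using nn_integral_real_affine[of "\<lambda>v. ennreal (c / (1 + c * v)\<^sup>2 * norm (?F (x + v))) * indicator {0..} v" 1 w]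
    by (simp add: add.commute)
  have "weighted_mean c (exp_sum l n (\<lambda>k. a k * of_real (r / (r + l k)))) x
      \<le> (\<integral>\<^sup>+v. (\<integral>\<^sup>+w. ennreal (c / (1 + c * v)\<^sup>2) * indicator {0..} v *
             (ennreal (r * exp (- (r * w)) * norm (?F (x + v + w))) * indicator {0..} w) \<partial>lborel) \<partial>lborel)"
    unfolding weighted_mean_def
  proof (rule nn_integral_mono, subst nn_integral_cmult)
    fix v :: real
    show "ennreal (c / (1 + c * v)\<^sup>2 * norm (exp_sum l n (\<lambda>k. a k * of_real (r / (r + l k))) (x + v))) * indicator {0..} v
      \<le> ennreal (c / (1 + c * v)\<^sup>2) * indicator {0..} v *
         (\<integral>\<^sup>+w\<in>{0..}. ennreal (r * exp (- (r * w)) * norm (?F (x + v + w))) \<partial>lborel)"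
      using mult_left_mono[OF 1[of "x + v"], of "ennreal (c / (1 + c * v)\<^sup>2)"] c
      by (auto simp: indicator_def ennreal_mult simp del: times_divide_eq_left of_real_divide)
  qed auto
  also have "\<dots> = (\<integral>\<^sup>+w. (\<integral>\<^sup>+v. ennreal (c / (1 + c * v)\<^sup>2) * indicator {0..} v *
             (ennreal (r * exp (- (r * w)) * norm (?F (x + v + w))) * indicator {0..} w) \<partial>lborel) \<partial>lborel)"
    by (rule lborel_pair.Fubini') measurable
  also have "\<dots> \<le> (\<integral>\<^sup>+w. ennreal (r * exp (- (r * w)) * (1 + c * w)\<^sup>2) * indicator {0..} w * weighted_mean c ?F x \<partial>lborel)"
  proof (rule nn_integral_mono)
    fix w :: real
    show "(\<integral>\<^sup>+v. ennreal (c / (1 + c * v)\<^sup>2) * indicator {0..} v *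
             (ennreal (r * exp (- (r * w)) * norm (?F (x + v + w))) * indicator {0..} w) \<partial>lborel)
        \<le> ennreal (r * exp (- (r * w)) * (1 + c * w)\<^sup>2) * indicator {0..} w * weighted_mean c ?F x"
    proof (cases "w \<ge> 0")
      case True
      have "(\<integral>\<^sup>+v. ennreal (c / (1 + c * v)\<^sup>2) * indicator {0..} v *
             (ennreal (r * exp (- (r * w)) * norm (?F (x + v + w))) * indicator {0..} w) \<partial>lborel)
         \<le> (\<integral>\<^sup>+v. ennreal (r * exp (- (r * w)) * (1 + c * w)\<^sup>2) *
             (ennreal (c / (1 + c * (v + w))\<^sup>2 * norm (?F (x + (v + w)))) * indicator {0..} (v + w)) \<partial>lborel)"
      proof (rule nn_integral_mono)
        fix v :: real
        show "ennreal (c / (1 + c * v)\<^sup>2) * indicator {0..} v *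
             (ennreal (r * exp (- (r * w)) * norm (?F (x + v + w))) * indicator {0..} w)
          \<le> ennreal (r * exp (- (r * w)) * (1 + c * w)\<^sup>2) *
             (ennreal (c / (1 + c * (v + w))\<^sup>2 * norm (?F (x + (v + w)))) * indicator {0..} (v + w))"
        proof (cases "v \<ge> 0")
          case v: True
          have "1 + c * (v + w) \<le> (1 + c * v) * (1 + c * w)"
            using c v True by (simp add: algebra_simps)
          then have "(1 + c * (v + w))\<^sup>2 \<le> (1 + c * v)\<^sup>2 * (1 + c * w)\<^sup>2"
            unfolding power_mult_distrib[symmetric] using c v True by (intro power_mono) auto
          moreover have "0 < 1 + c * v" "0 < 1 + c * (v + w)"
            using c v True by (auto intro!: add_pos_nonneg)
          ultimately have "c / (1 + c * v)\<^sup>2 \<le> (1 + c * w)\<^sup>2 * (c / (1 + c * (v + w))\<^sup>2)"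
            using c by (simp add: divide_simps mult_ac)
          then have "c / (1 + c * v)\<^sup>2 * (r * exp (- (r * w)) * norm (?F (x + v + w)))
             \<le> (1 + c * w)\<^sup>2 * (c / (1 + c * (v + w))\<^sup>2) * (r * exp (- (r * w)) * norm (?F (x + v + w)))"
            using r by (intro mult_right_mono) auto
          then show ?thesis
            using c r v True by (simp add: ennreal_mult[symmetric] add.assoc mult_ac)
        qed simp
      qed
      also have "\<dots> = ennreal (r * exp (- (r * w)) * (1 + c * w)\<^sup>2) * weighted_mean c ?F x"
        by (subst nn_integral_cmult) (auto simp: shift simp del: times_divide_eq_left)
      finally show ?thesis using True by simp
    qed simp
  qed
  also have "\<dots> = ennreal (1 + 2 * (c / r) + 2 * (c / r)\<^sup>2) * weighted_mean c ?F x"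
    by (subst nn_integral_multc) (auto simp: nn_integral_exp_quadratic[OF c r])
  also have "\<dots> \<le> ennreal (exp (2 * (c / r))) * weighted_mean c ?F x"
  proof (intro mult_right_mono ennreal_leI)
    show "1 + 2 * (c / r) + 2 * (c / r)\<^sup>2 \<le> exp (2 * (c / r))"
      using exp_lower_Taylor_quadratic[of "2 * (c / r)"] c r by (simp add: power2_eq_square)
  qed auto
  finally show ?thesis .
qed

lemma weighted_mean_diff_le:
  "weighted_mean c (exp_sum l n (\<lambda>k. a k - b k)) x \<le> weighted_mean c (exp_sum l n a) x + weighted_mean c (exp_sum l n b) x" if "c > 0"
proof -
  have "weighted_mean c (exp_sum l n (\<lambda>k. a k - b k)) x \<le> (\<integral>\<^sup>+v. 
      ennreal (c / (1 + c * v)\<^sup>2 * norm (exp_sum l n a (x + v))) * indicator {0..} v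
    + ennreal (c / (1 + c * v)\<^sup>2 * norm (exp_sum l n b (x + v))) * indicator {0..} v \<partial>lborel)"
    unfolding weighted_mean_def
  proof (rule nn_integral_mono)
    fix v :: real
    have "c / (1 + c * v)\<^sup>2 * norm (exp_sum l n (\<lambda>k. a k - b k) (x + v)) \<le>
       c / (1 + c * v)\<^sup>2 * norm (exp_sum l n a (x + v)) + c / (1 + c * v)\<^sup>2 * norm (exp_sum l n b (x + v))"
      unfolding distrib_left[symmetric] exp_sum_diff
      using that by (intro mult_left_mono norm_triangle_ineq4) auto
    then show "ennreal (c / (1 + c * v)\<^sup>2 * norm (exp_sum l n (\<lambda>k. a k - b k) (x + v))) * indicator {0..} v
      \<le> ennreal (c / (1 + c * v)\<^sup>2 * norm (exp_sum l n a (x + v))) * indicator {0..} v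
    + ennreal (c / (1 + c * v)\<^sup>2 * norm (exp_sum l n b (x + v))) * indicator {0..} v"
      using that by (auto simp: indicator_def ennreal_plus[symmetric] intro!: ennreal_leI
            simp del: ennreal_plus times_divide_eq_left)
  qed
  also have "\<dots> = weighted_mean c (exp_sum l n a) x + weighted_mean c (exp_sum l n b) x"
    unfolding weighted_mean_def by (intro nn_integral_add) auto
  finally show ?thesis .
qed

lemma weighted_mean_cmult:
  "weighted_mean c (exp_sum l n (\<lambda>k. of_real t * a k)) x = ennreal \<bar>t\<bar> * weighted_mean c (exp_sum l n a) x"
proof -
  have "weighted_mean c (exp_sum l n (\<lambda>k. of_real t * a k)) x
     = (\<integral>\<^sup>+v. ennreal \<bar>t\<bar> * (ennreal (c / (1 + c * v)\<^sup>2 * norm (exp_sum l n a (x + v))) * indicator {0..} v) \<partial>lborel)"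
    unfolding weighted_mean_def exp_sum_cmult norm_mult norm_of_real
    by (intro nn_integral_cong)
       (simp add: ennreal_mult'[symmetric] mult.assoc[symmetric] mult.left_commute[of _ "\<bar>t\<bar>"] mult.commute[of _ "\<bar>t\<bar>"])
  also have "\<dots> = ennreal \<bar>t\<bar> * weighted_mean c (exp_sum l n a) x"
    unfolding weighted_mean_def by (rule nn_integral_cmult) auto
  finally show ?thesis .
qed

lemma ennreal_mult_mult:
  "0 \<le> s \<Longrightarrow> 0 \<le> t \<Longrightarrow> ennreal s * (ennreal t * z) = ennreal (s * t) * z"
  by (simp add: ennreal_mult mult.assoc)

lemma weighted_mean_cong:
  "(\<And>k. k < n \<Longrightarrow> a k = b k) \<Longrightarrow> weighted_mean c (exp_sum l n a) x = weighted_mean c (exp_sum l n b) x"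
  unfolding weighted_mean_def by (simp add: exp_sum_cong[of n a b])

lemma weighted_mean_resolvent_pow_le:
  assumes l: "\<And>k. k < n \<Longrightarrow> l k > 0" and c: "0 < c" and r: "0 < r"
  shows "weighted_mean c (exp_sum l n (\<lambda>k. a k * of_real ((r / (r + l k)) ^ j))) x
     \<le> ennreal (exp (2 * (c / r)) ^ j) * weighted_mean c (exp_sum l n a) x"
proof (induction j)
  case (Suc j)
  have "weighted_mean c (exp_sum l n (\<lambda>k. a k * of_real ((r / (r + l k)) ^ Suc j))) x
     = weighted_mean c (exp_sum l n (\<lambda>k. (a k * of_real ((r / (r + l k)) ^ j)) * of_real (r / (r + l k)))) x"
    by (intro weighted_mean_cong) (simp add: mult_ac)
  also have "\<dots> \<le> ennreal (exp (2 * (c / r))) * weighted_mean c (exp_sum l n (\<lambda>k. a k * of_real ((r / (r + l k)) ^ j))) x"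
    by (rule weighted_mean_resolvent_le[OF l c r])
  also have "\<dots> \<le> ennreal (exp (2 * (c / r))) * (ennreal (exp (2 * (c / r)) ^ j) * weighted_mean c (exp_sum l n a) x)"
    by (intro mult_left_mono Suc) auto
  finally show ?case by (simp add: ennreal_mult mult.assoc)
qed simp

lemma weighted_mean_resolvent_compl_pow_le:
  assumes l: "\<And>k. k < n \<Longrightarrow> l k > 0" and c: "0 < c" and r: "0 < r"
  shows "weighted_mean c (exp_sum l n (\<lambda>k. a k * of_real ((l k / (r + l k)) ^ j))) x
     \<le> ennreal ((1 + exp (2 * (c / r))) ^ j) * weighted_mean c (exp_sum l n a) x"
proof (induction j)
  case (Suc j)
  let ?b = "\<lambda>k. a k * of_real ((l k / (r + l k)) ^ j)"
  have eq: "l k / (r + l k) = 1 - r / (r + l k)" if "k < n" for k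
    using l[OF that] r by (simp add: field_simps)
  have "weighted_mean c (exp_sum l n (\<lambda>k. a k * of_real ((l k / (r + l k)) ^ Suc j))) x
     = weighted_mean c (exp_sum l n (\<lambda>k. ?b k - ?b k * of_real (r / (r + l k)))) x"
  proof (intro weighted_mean_cong)
    fix k assume "k < n"
    show "a k * of_real ((l k / (r + l k)) ^ Suc j) = ?b k - ?b k * of_real (r / (r + l k))"
    proof -
      have "complex_of_real ((l k / (r + l k)) ^ Suc j) = of_real ((l k / (r + l k)) ^ j) * (1 - of_real (r / (r + l k)))"
        by (simp only: power_Suc2 of_real_mult eq[OF \<open>k < n\<close>] of_real_diff of_real_1)
      then show ?thesis by (simp only: right_diff_distrib mult_1_right mult.assoc)
    qed
  qed
  also have "\<dots> \<le> weighted_mean c (exp_sum l n ?b) x + ennreal (exp (2 * (c / r))) * weighted_mean c (exp_sum l n ?b) x"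
    by (rule order.trans[OF weighted_mean_diff_le[OF c]], intro add_left_mono weighted_mean_resolvent_le l c r)
  also have "\<dots> = ennreal (1 + exp (2 * (c / r))) * weighted_mean c (exp_sum l n ?b) x"
    by (simp add: distrib_right ennreal_plus)
  also have "\<dots> \<le> ennreal (1 + exp (2 * (c / r))) * (ennreal ((1 + exp (2 * (c / r))) ^ j) * weighted_mean c (exp_sum l n a) x)"
    by (intro mult_left_mono Suc) auto
  also have "\<dots> = ennreal ((1 + exp (2 * (c / r))) ^ Suc j) * weighted_mean c (exp_sum l n a) x"
    unfolding power_Suc by (rule ennreal_mult_mult) (auto simp: add_nonneg_nonneg)
  finally show ?case .
qed simp

text \<open>
  The \<open>L\<close>-fold resolvent at rate \<open>L * m\<close>, normalized to take the value \<open>1\<close> at \<open>m\<close>. Multiplication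
  by \<open>1 - peak L m\<close> removes the exponent \<open>m\<close>. The rate \<open>L * m\<close> keeps the cost bounded in \<open>L\<close>,
  while \<open>peak L m t\<close> remains bounded after multiplication by \<open>(t / m)\<^sup>p\<close> for \<open>p \<le> L\<close>.
\<close>
definition peak :: "nat \<Rightarrow> real \<Rightarrow> real \<Rightarrow> real" where
  "peak L m t = (1 + 1 / L) ^ L * (L * m / (L * m + t)) ^ L"

lemma peak_self: "L > 0 \<Longrightarrow> m > 0 \<Longrightarrow> peak L m m = 1"
proof -
  assume "L > 0" "m > 0"
  moreover from this have "real L * m + m > 0" by (simp add: add_pos_pos)
  ultimately have "(1 + 1 / real L) * (real L * m / (real L * m + m)) = 1"
    by (simp add: divide_simps) (simp add: algebra_simps)
  then show "peak L m m = 1"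
    unfolding peak_def power_mult_distrib[symmetric] by (simp only: power_one)
qed

lemma one_plus_inverse_power_le_exp: "(1 + 1 / real L) ^ L \<le> exp 1"
proof (cases "L = 0")
  case False
  have "(1 + 1 / real L) ^ L \<le> exp (1 / real L) ^ L"
    by (intro power_mono exp_ge_add_one_self) auto
  then show ?thesis using False by (simp add: exp_of_nat_mult[symmetric])
qed simp

text \<open>
  The point is that the constant does not depend on \<open>L\<close>, so that \<open>L\<close>, and with it the order of
  differentiation that a peak absorbs, can be chosen after the cost is known.
\<close>
lemma weighted_mean_peak_le:
  assumes l: "\<And>k. k < n \<Longrightarrow> l k > 0" and c: "0 < c" "c \<le> m" and L: "L > 0"
  shows "weighted_mean c (exp_sum l n (\<lambda>k. a k * of_real (1 - peak L m (l k)))) x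
     \<le> ennreal (1 + exp 3) * weighted_mean c (exp_sum l n a) x"
proof -
  define r where "r = real L * m"
  have r: "r > 0" using L c by (simp add: r_def)
  let ?K = "(1 + 1 / real L) ^ L"
  have "?K * exp (2 * (c / r)) ^ L \<le> exp 1 * exp 2"
  proof (intro mult_mono one_plus_inverse_power_le_exp)
    have "real L * (2 * (c / r)) = 2 * (c / m)" using L by (simp add: r_def)
    also have "\<dots> \<le> 2" using c by (simp add: field_simps)
    finally show "exp (2 * (c / r)) ^ L \<le> exp 2" by (simp add: exp_of_nat_mult[symmetric])
  qed auto
  also have "\<dots> = exp (3::real)" by (simp flip: exp_add)
  finally have K: "?K * exp (2 * (c / r)) ^ L \<le> exp 3" .
  have "weighted_mean c (exp_sum l n (\<lambda>k. a k * of_real (1 - peak L m (l k)))) x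
      = weighted_mean c (exp_sum l n (\<lambda>k. a k - of_real ?K * (a k * of_real ((r / (r + l k)) ^ L)))) x"
    by (intro weighted_mean_cong) (simp add: peak_def r_def algebra_simps)
  also have "\<dots> \<le> weighted_mean c (exp_sum l n a) x + ennreal \<bar>?K\<bar> * weighted_mean c (exp_sum l n (\<lambda>k. a k * of_real ((r / (r + l k)) ^ L))) x"
    by (rule order.trans[OF weighted_mean_diff_le[OF c(1)]]) (simp only: weighted_mean_cmult order_refl)
  also have "\<dots> \<le> weighted_mean c (exp_sum l n a) x + ennreal \<bar>?K\<bar> * (ennreal (exp (2 * (c / r)) ^ L) * weighted_mean c (exp_sum l n a) x)"
    by (intro add_left_mono mult_left_mono weighted_mean_resolvent_pow_le l c r) auto
  also have "\<dots> = ennreal (1 + ?K * exp (2 * (c / r)) ^ L) * weighted_mean c (exp_sum l n a) x"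
    by (simp add: ennreal_mult ennreal_plus distrib_right mult.assoc)
  also have "\<dots> \<le> ennreal (1 + exp 3) * weighted_mean c (exp_sum l n a) x"
    using K by (intro mult_right_mono ennreal_leI) auto
  finally show ?thesis .
qed

lemma weighted_mean_peak_prod_le:
  assumes l: "\<And>k. k < n \<Longrightarrow> l k > 0" and c: "0 < c" and L: "L > 0"
    and I: "finite I" "\<And>i. i \<in> I \<Longrightarrow> c \<le> l i"
  shows "weighted_mean c (exp_sum l n (\<lambda>k. a k * of_real (\<Prod>i\<in>I. 1 - peak L (l i) (l k)))) x
     \<le> ennreal ((1 + exp 3) ^ card I) * weighted_mean c (exp_sum l n a) x"
  using I
proof (induction I rule: finite_induct)
  case (insert i I)
  have "weighted_mean c (exp_sum l n (\<lambda>k. a k * of_real (\<Prod>i\<in>insert i I. 1 - peak L (l i) (l k)))) x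
     = weighted_mean c (exp_sum l n (\<lambda>k. a k * of_real (\<Prod>i\<in>I. 1 - peak L (l i) (l k)) * of_real (1 - peak L (l i) (l k)))) x"
    using insert.hyps by (intro weighted_mean_cong) (simp add: mult_ac)
  also have "\<dots> \<le> ennreal (1 + exp 3) * weighted_mean c (exp_sum l n (\<lambda>k. a k * of_real (\<Prod>i\<in>I. 1 - peak L (l i) (l k)))) x"
    using insert.prems by (intro weighted_mean_peak_le l c L) auto
  also have "\<dots> \<le> ennreal (1 + exp 3) * (ennreal ((1 + exp 3) ^ card I) * weighted_mean c (exp_sum l n a) x)"
    using insert by (intro mult_left_mono) auto
  also have "\<dots> = ennreal ((1 + exp 3) ^ card (insert i I)) * weighted_mean c (exp_sum l n a) x"
    using insert.hyps by (simp add: ennreal_mult mult.assoc add_nonneg_nonneg del: ennreal_plus)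
  finally show ?case .
qed simp

text \<open>
  With \<open>\<rho>\<close> the rate of the peak, \<open>\<lambda> / (\<rho> + \<lambda>) = 1 - \<rho> / (\<rho> + \<lambda>)\<close>. Hence \<open>\<lambda>\<^sup>p\<close> times the
  \<open>p + 1\<close> resolvents in the peak is \<open>\<rho>\<^sup>p\<close> times a power of a bounded operator and one remaining resolvent,
  and the latter passes from the mean to the value at a point.
\<close>
lemma norm_exp_sum_peak_le:
  fixes p :: nat
  assumes l: "\<And>k. k < n \<Longrightarrow> l k > 0" and m: "0 < m"
  defines "D \<equiv> exp 1 * real (Suc p) ^ p * (2 * real (Suc p)) * (1 + exp 2) ^ p"
  shows "ennreal (norm (exp_sum l n (\<lambda>k. a k * of_real (l k ^ p * peak (Suc p) m (l k))) x))
     \<le> ennreal (D * m ^ p) * weighted_mean m (exp_sum l n a) x"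
proof -
  define L where "L = Suc p"
  define r where "r = real L * m"
  define K where "K = (1 + 1 / real L) ^ L"
  have r: "r > 0" and L: "L \<ge> 1" using m by (auto simp: r_def L_def)
  have K: "0 \<le> K" "K \<le> exp 1"
    unfolding K_def by (auto intro: one_plus_inverse_power_le_exp)
  define b where "b k = a k * of_real ((l k / (r + l k)) ^ p)" for k
  define b' where "b' k = of_real (K * r ^ Suc p) * b k" for k
  have "exp_sum l n (\<lambda>k. a k * of_real (l k ^ p * peak (Suc p) m (l k))) x
      = exp_sum l n (\<lambda>k. b' k / of_real (r + l k)) x"
  proof (intro exp_sum_cong)
    fix k assume "k < n"
    have "l k ^ p * peak (Suc p) m (l k) = K * r ^ Suc p * (l k / (r + l k)) ^ p / (r + l k)"
      unfolding peak_def K_def r_def L_def by (simp add: power_divide mult_ac)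
    then show "a k * of_real (l k ^ p * peak (Suc p) m (l k)) = b' k / of_real (r + l k)"
      unfolding b'_def b_def by (simp only: of_real_mult of_real_divide) (simp add: mult_ac)
  qed
  also have "ennreal (norm \<dots>) \<le> (\<integral>\<^sup>+w\<in>{0..}. ennreal (exp (- (r * w)) * norm (exp_sum l n b' (x + w))) \<partial>lborel)"
    by (intro norm_exp_sum_le_laplace l) (use r in auto)
  also have "\<dots> \<le> (\<integral>\<^sup>+w. ennreal (K * r ^ Suc p * 2 / m) * (ennreal (m / (1 + m * w)\<^sup>2 * norm (exp_sum l n b (x + w))) * indicator {0..} w) \<partial>lborel)"
  proof (intro nn_integral_mono)
    fix w :: real
    show "ennreal (exp (- (r * w)) * norm (exp_sum l n b' (x + w))) * indicator {0..} w \<le>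
      ennreal (K * r ^ Suc p * 2 / m) * (ennreal (m / (1 + m * w)\<^sup>2 * norm (exp_sum l n b (x + w))) * indicator {0..} w)"
    proof (cases "w \<ge> 0")
      case True
      have "m * w \<le> r * w" unfolding r_def using L m True by (intro mult_right_mono) auto
      then have "1 + m * w + (m * w)\<^sup>2 / 2 \<le> exp (r * w)"
        using exp_lower_Taylor_quadratic[of "m * w"] m True by (meson exp_le_cancel_iff mult_nonneg_nonneg order.trans less_imp_le)
      then have "(1 + m * w)\<^sup>2 \<le> 2 * exp (r * w)" by (simp add: power2_eq_square algebra_simps)
      moreover have "1 + m * w > 0" using m True by (intro add_pos_nonneg) auto
      ultimately have e: "exp (- (r * w)) \<le> 2 / (1 + m * w)\<^sup>2"
        by (simp add: exp_minus field_simps)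
      have "exp (- (r * w)) * norm (exp_sum l n b' (x + w)) = exp (- (r * w)) * (K * r ^ Suc p * norm (exp_sum l n b (x + w)))"
        unfolding b'_def exp_sum_cmult norm_mult norm_of_real using K r by simp
      also have "\<dots> \<le> 2 / (1 + m * w)\<^sup>2 * (K * r ^ Suc p * norm (exp_sum l n b (x + w)))"
        using K r by (intro mult_right_mono e) auto
      also have "\<dots> = (K * r ^ Suc p * 2 / m) * (m / (1 + m * w)\<^sup>2 * norm (exp_sum l n b (x + w)))"
        using m by simp
      finally have "exp (- (r * w)) * norm (exp_sum l n b' (x + w)) \<le> (K * r ^ Suc p * 2 / m) * (m / (1 + m * w)\<^sup>2 * norm (exp_sum l n b (x + w)))" .
      then show ?thesis using True K r m
        by (simp add: ennreal_mult'[symmetric] ennreal_leI del: power_Suc times_divide_eq_left times_divide_eq_right)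
    qed simp
  qed
  also have "\<dots> = ennreal (K * r ^ Suc p * 2 / m) * weighted_mean m (exp_sum l n b) x"
    unfolding weighted_mean_def by (rule nn_integral_cmult) auto
  also have "\<dots> \<le> ennreal (K * r ^ Suc p * 2 / m) * (ennreal ((1 + exp (2 * (m / r))) ^ p) * weighted_mean m (exp_sum l n a) x)"
    unfolding b_def by (intro mult_left_mono weighted_mean_resolvent_compl_pow_le l m r) auto
  also have "\<dots> = ennreal (K * r ^ Suc p * 2 / m * (1 + exp (2 * (m / r))) ^ p) * weighted_mean m (exp_sum l n a) x"
    by (rule ennreal_mult_mult) (use K r m in \<open>auto intro!: mult_nonneg_nonneg divide_nonneg_nonneg add_nonneg_nonneg\<close>)
  also have "\<dots> \<le> ennreal (D * m ^ p) * weighted_mean m (exp_sum l n a) x"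
  proof (intro mult_right_mono ennreal_leI)
    have "m / r \<le> 1" using L m r by (simp add: r_def field_simps)
    then have "2 * (m / r) \<le> 2" by linarith
    then have "exp (2 * (m / r)) \<le> exp 2" by simp
    then have "K * r ^ Suc p * 2 / m * (1 + exp (2 * (m / r))) ^ p \<le> exp 1 * r ^ Suc p * 2 / m * (1 + exp 2) ^ p"
      using K r m by (intro mult_mono divide_right_mono power_mono add_mono) auto
    also have "\<dots> = D * m ^ p"
    proof -
      have gen: "e * (s * m) ^ Suc p * 2 / m * f = e * s ^ p * (2 * s) * f * m ^ p" for e s f :: real
        using m by (simp add: power_mult_distrib)
      show ?thesis unfolding D_def r_def L_def by (rule gen)
    qed
    finally show "K * r ^ Suc p * 2 / m * (1 + exp (2 * (m / r))) ^ p \<le> D * m ^ p" .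
  qed auto
  finally show ?thesis .
qed

definition tail_integral :: "(real \<Rightarrow> complex) \<Rightarrow> real \<Rightarrow> ennreal" where
  "tail_integral F x = (\<integral>\<^sup>+y\<in>{x..}. ennreal (norm (F y) / y\<^sup>2) \<partial>lborel)"

text \<open>
  Up to a factor, one integral dominates the means at all scales \<open>1 / c\<close> that are at least \<open>x / C\<close>.
\<close>
lemma weighted_mean_le_tail_integral:
  assumes [measurable]: "F \<in> borel_measurable borel"
    and c: "0 < c" and x: "0 < x" and C: "c * x \<le> C" "1 \<le> C"
  shows "weighted_mean c F x \<le> ennreal (C\<^sup>2 / c) * tail_integral F x"
proof -
  have "tail_integral F x = (\<integral>\<^sup>+v. ennreal (norm (F (x + v)) / (x + v)\<^sup>2) * indicator {x..} (x + v) \<partial>lborel)"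
    unfolding tail_integral_def
    using nn_integral_real_affine[of "\<lambda>y. ennreal (norm (F y) / y\<^sup>2) * indicator {x..} y" 1 x] by simp
  then have "ennreal (C\<^sup>2 / c) * tail_integral F x
     = (\<integral>\<^sup>+v. ennreal (C\<^sup>2 / c) * (ennreal (norm (F (x + v)) / (x + v)\<^sup>2) * indicator {x..} (x + v)) \<partial>lborel)"
    by (subst nn_integral_cmult) auto
  moreover have frac: "d / b \<le> e / d / a" if "0 < d" "0 < a" "0 < b" "d * d * a \<le> e * b" for a b d e :: real
    using that by (simp add: field_simps)
  have "weighted_mean c F x \<le> (\<integral>\<^sup>+v. ennreal (C\<^sup>2 / c) * (ennreal (norm (F (x + v)) / (x + v)\<^sup>2) * indicator {x..} (x + v)) \<partial>lborel)"
    unfolding weighted_mean_def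
  proof (intro nn_integral_mono)
    fix v :: real
    show "ennreal (c / (1 + c * v)\<^sup>2 * norm (F (x + v))) * indicator {0..} v
      \<le> ennreal (C\<^sup>2 / c) * (ennreal (norm (F (x + v)) / (x + v)\<^sup>2) * indicator {x..} (x + v))"
    proof (cases "v \<ge> 0")
      case True
      have "c * v * 1 \<le> c * v * C" using c True C by (intro mult_left_mono) auto
      then have "c * (x + v) \<le> C * (1 + c * v)"
        using C by (simp add: algebra_simps)
      then have "(c * (x + v))\<^sup>2 \<le> (C * (1 + c * v))\<^sup>2"
        using c x True by (intro power_mono) auto
      then have "c * c * (x + v)\<^sup>2 \<le> C\<^sup>2 * (1 + c * v)\<^sup>2"
        by (simp only: power_mult_distrib power2_eq_square[of c])
      moreover have "1 + c * v > 0" "x + v > 0" using c x True by (auto intro: add_pos_nonneg)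
      ultimately have "c / (1 + c * v)\<^sup>2 \<le> C\<^sup>2 / c / (x + v)\<^sup>2"
        by (intro frac c zero_less_power)
      then have "c / (1 + c * v)\<^sup>2 * norm (F (x + v)) \<le> C\<^sup>2 / c / (x + v)\<^sup>2 * norm (F (x + v))"
        by (rule mult_right_mono) auto
      also have "\<dots> = C\<^sup>2 / c * (norm (F (x + v)) / (x + v)\<^sup>2)" by simp
      finally show ?thesis using True c
        by (simp add: ennreal_mult'[symmetric] ennreal_leI del: times_divide_eq_left times_divide_eq_right)
    qed simp
  qed
  ultimately show ?thesis by simp
qed

section \<open>Sums without rapidly decaying exponentials\<close>

text \<open>
  Quasi-lacunarity in terms of the exponents alone. Unlike a lower bound for the
  ratios of consecutive exponents it permits clusters, and it survives a translation of the exponents.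
\<close>
definition geometric_growth :: "real \<Rightarrow> real \<Rightarrow> (nat \<Rightarrow> real) \<Rightarrow> bool" where
  "geometric_growth c q l \<longleftrightarrow>
     0 < c \<and> 1 < q \<and> mono l \<and> 0 < l 0 \<and> (\<forall>k j. c * q ^ j * l k \<le> l (k + j))"

lemma geometric_growth_pos: "geometric_growth c q l \<Longrightarrow> 0 < l k"
  unfolding geometric_growth_def by (meson less_le_trans monoD zero_le)

text \<open>
  Removing factors one after another: the term of index \<open>i\<close> contains only the factors with
  larger index, in the application those of the larger exponents.
\<close>
lemma one_minus_prod_telescope:
  fixes f :: "nat \<Rightarrow> 'a :: comm_ring_1"
  shows "1 - (\<Prod>i<n. 1 - f i) = (\<Sum>i<n. f i * (\<Prod>j\<in>{i<..<n}. 1 - f j))"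
proof (induction n)
  case (Suc n)
  have "(\<Sum>i<n. f i * (\<Prod>j\<in>{i<..<Suc n}. 1 - f j)) = (1 - f n) * (\<Sum>i<n. f i * (\<Prod>j\<in>{i<..<n}. 1 - f j))"
    unfolding sum_distrib_left
  proof (intro sum.cong refl)
    fix i assume "i \<in> {..<n}"
    then have "{i<..<Suc n} = insert n {i<..<n}" by auto
    then show "f i * (\<Prod>j\<in>{i<..<Suc n}. 1 - f j) = (1 - f n) * (f i * (\<Prod>j\<in>{i<..<n}. 1 - f j))"
      by (simp add: mult_ac)
  qed
  moreover have empty: "{n<..<Suc n} = {}" by auto
  ultimately have "(\<Sum>i<Suc n. f i * (\<Prod>j\<in>{i<..<Suc n}. 1 - f j)) = (1 - f n) * (1 - (\<Prod>i<n. 1 - f i)) + f n"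
    using empty by (simp only: Suc.IH sum.lessThan_Suc) simp
  also have "\<dots> = 1 - (\<Prod>i<n. 1 - f i) * (1 - f n)"
    by (simp add: algebra_simps)
  finally show ?case by simp
qed simp

lemma initial_segment_cutoff:
  fixes l :: "nat \<Rightarrow> real"
  assumes "mono l"
  obtains i where "i \<le> n" "\<And>k. k < n \<Longrightarrow> l k \<le> t \<longleftrightarrow> k < i"
proof -
  have "\<exists>i\<le>n. \<forall>k<n. l k \<le> t \<longleftrightarrow> k < i"
  proof (induction n)
    case (Suc n)
    then obtain i where i: "i \<le> n" "\<forall>k<n. l k \<le> t \<longleftrightarrow> k < i" by blast
    show ?case
    proof (cases "l n \<le> t")
      case True
      then have "l k \<le> t" if "k < Suc n" for k
        using monoD[OF assms, of k n] that by simp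
      then show ?thesis by (intro exI[of _ "Suc n"]) auto
    next
      case False
      then show ?thesis using i by (intro exI[of _ i]) (auto simp: less_Suc_eq)
    qed
  qed auto
  then show ?thesis using that by blast
qed

text \<open>
  The product of all \<open>1 - peak\<close> over the exponents in the sum annihilates it, so the telescoping
  identity represents the sum by the terms that contain one peak. The term of the \<open>j\<close>-th largest
  exponent costs \<open>(1 + e\<^sup>3)\<^sup>j\<close>, but its exponent is at most a multiple of \<open>q\<^sup>-\<^sup>j * C / x\<close> and enters with
  the power \<open>p\<close>; the choice of \<open>p\<close> turns this into a geometric series of ratio \<open>1 / 2\<close>.
\<close>
lemma norm_exp_sum_power_le_tail_integral:
  assumes g: "geometric_growth c q l" and p: "q ^ p \<ge> 2 * (1 + exp 3)" and C: "C \<ge> 1"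
  shows "\<exists>D\<ge>0. \<forall>x>0. \<forall>n (a :: nat \<Rightarrow> complex). (\<forall>k<n. C < l k * x \<longrightarrow> a k = 0) \<longrightarrow>
    ennreal (norm (exp_sum l n (\<lambda>k. of_real (l k ^ Suc p) * a k) x))
      \<le> ennreal (D / x ^ p) * tail_integral (exp_sum l n a) x"
proof -
  define D0 where "D0 = exp 1 * real (Suc (Suc p)) ^ Suc p * (2 * real (Suc (Suc p))) * (1 + exp 2) ^ Suc p"
  define D where "D = D0 * C\<^sup>2 * (2 * (C / c) ^ p)"
  have c: "c > 0" and q: "q > 1" and mono: "mono l" and growth: "\<And>k j. c * q ^ j * l k \<le> l (k + j)"
    using g by (auto simp: geometric_growth_def)
  have pos: "l k > 0" for k using geometric_growth_pos[OF g] .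
  have D0: "D0 \<ge> 0" unfolding D0_def by (intro mult_nonneg_nonneg zero_le_power add_nonneg_nonneg) auto
  show ?thesis
  proof (intro exI[of _ D] conjI allI impI)
    show "0 \<le> D" using D0 C c by (simp add: D_def)
  next
    fix x :: real and n and a :: "nat \<Rightarrow> complex"
    assume x: "x > 0" and supp: "\<forall>k<n. C < l k * x \<longrightarrow> a k = 0"
    obtain i0 where i0: "i0 \<le> n" "\<And>k. k < n \<Longrightarrow> l k \<le> C / x \<longleftrightarrow> k < i0"
      using initial_segment_cutoff[OF mono] by metis
    let ?K = "\<lambda>i k. peak (Suc (Suc p)) (l i) (l k)"
    let ?V = "\<lambda>i k. a k * of_real (\<Prod>j\<in>{i<..<i0}. 1 - ?K j k)"
    have low: "l i * x \<le> C" if "i < i0" for i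
      using i0(2)[of i] i0(1) that x by (simp add: field_simps)
    have "exp_sum l n (\<lambda>k. of_real (l k ^ Suc p) * a k) x
        = exp_sum l n (\<lambda>k. \<Sum>i<i0. ?V i k * of_real (l k ^ Suc p * ?K i k)) x"
    proof (intro exp_sum_cong)
      fix k assume k: "k < n"
      show "of_real (l k ^ Suc p) * a k = (\<Sum>i<i0. ?V i k * of_real (l k ^ Suc p * ?K i k))"
      proof (cases "k < i0")
        case True
        then have zero: "(\<Prod>i<i0. 1 - ?K i k) = 0"
          using pos by (intro prod_zero) (auto simp: peak_self intro!: bexI[of _ k])
        have one: "(\<Sum>i<i0. ?K i k * (\<Prod>j\<in>{i<..<i0}. 1 - ?K j k)) = 1"
          unfolding one_minus_prod_telescope[symmetric] zero by simp
        have "(\<Sum>i<i0. ?V i k * of_real (l k ^ Suc p * ?K i k))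
            = of_real (l k ^ Suc p) * a k * of_real (\<Sum>i<i0. ?K i k * (\<Prod>j\<in>{i<..<i0}. 1 - ?K j k))"
          unfolding of_real_sum sum_distrib_left
          by (intro sum.cong refl) (simp add: mult_ac)
        then show ?thesis unfolding one by simp
      next
        case False
        then have "a k = 0" using i0(2)[OF k] supp k x by (simp add: field_simps not_le)
        then show ?thesis by simp
      qed
    qed
    also have "\<dots> = (\<Sum>i<i0. exp_sum l n (\<lambda>k. ?V i k * of_real (l k ^ Suc p * ?K i k)) x)"
      by (rule exp_sum_sum)
    finally have "ennreal (norm (exp_sum l n (\<lambda>k. of_real (l k ^ Suc p) * a k) x))
        = ennreal (norm (\<Sum>i<i0. exp_sum l n (\<lambda>k. ?V i k * of_real (l k ^ Suc p * ?K i k)) x))"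
      by (rule arg_cong)
    also have "\<dots> \<le> ennreal (\<Sum>i<i0. norm (exp_sum l n (\<lambda>k. ?V i k * of_real (l k ^ Suc p * ?K i k)) x))"
      by (intro ennreal_leI norm_sum)
    also have "\<dots> = (\<Sum>i<i0. ennreal (norm (exp_sum l n (\<lambda>k. ?V i k * of_real (l k ^ Suc p * ?K i k)) x)))"
      by (rule sum_ennreal[symmetric]) (rule norm_ge_zero)
    also have "\<dots> \<le> (\<Sum>i<i0. ennreal (D0 * C\<^sup>2 * (l i ^ p * (1 + exp 3) ^ (i0 - Suc i))) * tail_integral (exp_sum l n a) x)"
    proof (intro sum_mono)
      fix i assume i: "i \<in> {..<i0}"
      have "ennreal (norm (exp_sum l n (\<lambda>k. ?V i k * of_real (l k ^ Suc p * ?K i k)) x))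
         \<le> ennreal (D0 * l i ^ Suc p) * weighted_mean (l i) (exp_sum l n (?V i)) x"
        unfolding D0_def by (intro norm_exp_sum_peak_le pos)
      also have "\<dots> \<le> ennreal (D0 * l i ^ Suc p) * (ennreal ((1 + exp 3) ^ card {i<..<i0}) * weighted_mean (l i) (exp_sum l n a) x)"
        by (intro mult_left_mono weighted_mean_peak_prod_le pos) (auto intro: monoD[OF mono])
      also have "\<dots> \<le> ennreal (D0 * l i ^ Suc p) * (ennreal ((1 + exp 3) ^ card {i<..<i0}) * (ennreal (C\<^sup>2 / l i) * tail_integral (exp_sum l n a) x))"
        by (intro mult_left_mono weighted_mean_le_tail_integral pos x C low) (use i in auto)
      also have "\<dots> = ennreal (D0 * l i ^ Suc p * ((1 + exp 3) ^ card {i<..<i0} * (C\<^sup>2 / l i))) * tail_integral (exp_sum l n a) x"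
        using D0 pos[of i] by (subst (2) ennreal_mult_mult, simp_all add: add_nonneg_nonneg, subst ennreal_mult_mult, simp_all add: add_nonneg_nonneg)
      also have "D0 * l i ^ Suc p * ((1 + exp 3) ^ card {i<..<i0} * (C\<^sup>2 / l i)) = D0 * C\<^sup>2 * (l i ^ p * (1 + exp 3) ^ (i0 - Suc i))"
        using pos[of i] by simp
      finally show "ennreal (norm (exp_sum l n (\<lambda>k. ?V i k * of_real (l k ^ Suc p * ?K i k)) x))
        \<le> ennreal (D0 * C\<^sup>2 * (l i ^ p * (1 + exp 3) ^ (i0 - Suc i))) * tail_integral (exp_sum l n a) x" .
    qed
    also have "\<dots> = ennreal (\<Sum>i<i0. D0 * C\<^sup>2 * (l i ^ p * (1 + exp 3) ^ (i0 - Suc i))) * tail_integral (exp_sum l n a) x"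
      unfolding sum_distrib_right[symmetric] using D0 pos
      by (subst sum_ennreal) (auto intro!: mult_nonneg_nonneg zero_le_power add_nonneg_nonneg simp: less_imp_le)
    also have "\<dots> \<le> ennreal (D / x ^ p) * tail_integral (exp_sum l n a) x"
    proof (intro mult_right_mono ennreal_leI)
      have "(\<Sum>i<i0. l i ^ p * (1 + exp 3) ^ (i0 - Suc i)) \<le> (\<Sum>i<i0. (C / (c * x)) ^ p * (1 / 2) ^ (i0 - Suc i))"
      proof (intro sum_mono)
        fix i assume i: "i \<in> {..<i0}"
        define j where "j = i0 - Suc i"
        have j: "i + j < i0" using i by (auto simp: j_def)
        have "c * q ^ j * l i * x \<le> l (i + j) * x"
          using growth x by (intro mult_right_mono) auto
        also have "\<dots> \<le> C" using low[OF j] .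
        finally have "l i * q ^ j \<le> C / (c * x)" using c x by (simp add: field_simps)
        then have "(l i * q ^ j) ^ p \<le> (C / (c * x)) ^ p"
          using pos[of i] q by (intro power_mono) auto
        moreover have "(1 + exp 3) ^ j \<le> (q ^ p * (1 / 2)) ^ j"
          using p by (intro power_mono) (auto intro: add_nonneg_nonneg)
        then have "l i ^ p * (1 + exp 3) ^ j \<le> l i ^ p * (q ^ p * (1 / 2)) ^ j"
          using pos[of i] by (intro mult_left_mono) auto
        moreover have "l i ^ p * (q ^ p * (1 / 2)) ^ j = (l i * q ^ j) ^ p * (1 / 2) ^ j"
          by (simp only: power_mult_distrib power_mult[symmetric] mult.commute[of p j] mult.assoc)
        moreover have "(l i * q ^ j) ^ p * (1 / 2) ^ j \<le> (C / (c * x)) ^ p * (1 / 2) ^ j"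
          using calculation(1) by (rule mult_right_mono) auto
        ultimately show "l i ^ p * (1 + exp 3) ^ (i0 - Suc i) \<le> (C / (c * x)) ^ p * (1 / 2) ^ (i0 - Suc i)"
          unfolding j_def by linarith
      qed
      also have "\<dots> = (C / (c * x)) ^ p * (\<Sum>j<i0. (1 / 2) ^ j)"
        unfolding sum_distrib_left[symmetric] by (simp add: sum.nat_diff_reindex)
      also have "\<dots> \<le> (C / (c * x)) ^ p * 2"
        using C c x by (intro mult_left_mono) (auto simp: sum_gp_strict)
      finally have "D0 * C\<^sup>2 * (\<Sum>i<i0. l i ^ p * (1 + exp 3) ^ (i0 - Suc i)) \<le> D0 * C\<^sup>2 * ((C / (c * x)) ^ p * 2)"
        using D0 by (intro mult_left_mono) auto
      also have "\<dots> = D / x ^ p" using c x by (simp add: D_def power_divide power_mult_distrib)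
      finally show "(\<Sum>i<i0. D0 * C\<^sup>2 * (l i ^ p * (1 + exp 3) ^ (i0 - Suc i))) \<le> D / x ^ p"
        by (simp add: sum_distrib_left)
    qed auto
    finally show "ennreal (norm (exp_sum l n (\<lambda>k. of_real (l k ^ Suc p) * a k) x))
      \<le> ennreal (D / x ^ p) * tail_integral (exp_sum l n a) x" .
  qed
qed

section \<open>Removing the rapidly decaying exponentials by small shifts\<close>

text \<open>
  The measure with mass \<open>1\<close> at \<open>0\<close> and mass \<open>w S\<close> at \<open>- h S\<close>, which annihilates all
  exponentials of exponent above \<open>C / x\<close>. The index \<open>S\<close> is the set of exponents whose differences
  contribute a translation.
\<close>
definition shift_annihilator ::
    "(nat \<Rightarrow> real) \<Rightarrow> nat \<Rightarrow> real \<Rightarrow> real \<Rightarrow> real \<Rightarrow> nat set set \<Rightarrow> (nat set \<Rightarrow> real) \<Rightarrow> (nat set \<Rightarrow> real) \<Rightarrow> bool" where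
  "shift_annihilator l n C x e P w h \<longleftrightarrow> finite P \<and>
     (\<forall>S\<in>P. 0 \<le> h S \<and> h S \<le> x / 2) \<and> (\<Sum>S\<in>P. \<bar>w S\<bar>) \<le> e \<and>
     (\<forall>k<n. C < l k * x \<longrightarrow> 1 + (\<Sum>S\<in>P. w S * exp (l k * h S)) = 0)"

text \<open>
  The measure is the product of the backward differences that remove one exponent each. The \<open>j\<close>-th exponent
  above \<open>C / x\<close> is at least a multiple of \<open>q\<^sup>j * C / x\<close>. The step of its difference is a multiple of
  \<open>x * q\<^sup>-\<^sup>j\<^sup>/\<^sup>2\<close>: summable in \<open>j\<close>, and still so large that the product of exponent and step is at least
  a multiple of \<open>C * q\<^sup>j\<^sup>/\<^sup>2\<close>. Large \<open>C\<close> therefore makes the coefficients small.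
\<close>
lemma shift_annihilator_exists:
  assumes g: "geometric_growth c q l" and e: "e > 0"
  shows "\<exists>C\<ge>1. \<forall>x>0. \<forall>n. \<exists>P w h. shift_annihilator l n C x e P w h"
proof -
  have c: "c > 0" and q: "q > 1" and mono: "mono l" and growth: "\<And>k j. c * q ^ j * l k \<le> l (k + j)"
    using g by (auto simp: geometric_growth_def)
  have pos: "l k > 0" for k using geometric_growth_pos[OF g] .
  \<comment> \<open>The steps decrease like \<open>s\<^sup>j\<close>, so that exponent times step still grows like \<open>(q * s)\<^sup>j = s\<^sup>-\<^sup>j\<close>.\<close>
  define s where "s = 1 / sqrt q"
  have s: "0 < s" "s < 1" using q by (auto simp: s_def)
  have qs: "q * s = 1 / s" using q by (simp add: s_def field_simps flip: real_sqrt_mult)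
  have geo: "(\<Sum>j<n. s ^ j) \<le> 1 / (1 - s)" for n
    using s by (simp add: sum_gp_strict divide_right_mono)
  \<comment> \<open>The masses of the differences sum to at most \<open>ln (1 + e)\<close>, and those of the expanded product
    to at most \<open>exp (ln (1 + e)) - 1 = e\<close>.\<close>
  define C where "C = max 1 (2 / (c * (1 - s) ^ 2 * ln (1 + e)))"
  have C: "C \<ge> 1" by (simp add: C_def)
  have ln: "ln (1 + e) > 0" using e by simp
  have eta: "2 / (c * C * (1 - s) ^ 2) \<le> ln (1 + e)"
  proof -
    have "2 / (c * (1 - s) ^ 2 * ln (1 + e)) \<le> C" by (simp add: C_def)
    then show ?thesis using ln c s C by (simp add: field_simps)
  qed
  show ?thesis
  proof (intro exI[of _ C] conjI C allI impI)
    fix x :: real and n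
    assume x: "x > 0"
    obtain i0 where i0: "i0 \<le> n" "\<And>k. k < n \<Longrightarrow> l k \<le> C / x \<longleftrightarrow> k < i0"
      using initial_segment_cutoff[OF mono] by metis
    define H where "H = {i0..<n}"
    define t where "t i = x * (1 - s) / 2 * s ^ (i - i0)" for i
    define d where "d i = exp (- (l i * t i))" for i
    have reindex: "(\<Sum>i\<in>H. s ^ (i - i0)) \<le> 1 / (1 - s)"
    proof -
      have "(\<Sum>i\<in>H. s ^ (i - i0)) = (\<Sum>j<n - i0. s ^ j)"
        unfolding H_def by (rule sum.reindex_bij_witness[of _ "\<lambda>j. j + i0" "\<lambda>i. i - i0"]) auto
      then show ?thesis using geo by simp
    qed
    have t: "t i > 0" for i using x s by (simp add: t_def)
    have tsum: "sum t S \<le> x / 2" if "S \<subseteq> H" for S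
    proof -
      have "sum t S \<le> sum t H" using that t by (intro sum_mono2) (auto simp: H_def less_imp_le)
      also have "\<dots> = x * (1 - s) / 2 * (\<Sum>i\<in>H. s ^ (i - i0))"
        unfolding t_def sum_distrib_left ..
      also have "\<dots> \<le> x * (1 - s) / 2 * (1 / (1 - s))"
        using x s by (intro mult_left_mono reindex) auto
      also have "\<dots> = x / 2" using s by (simp add: field_simps)
      finally show ?thesis .
    qed
    have d: "d i \<le> 2 / (c * C * (1 - s)) * s ^ (i - i0)" if "i \<in> H" for i
    proof -
      define j where "j = i - i0"
      have ij: "i = i0 + j" "i0 < n" using that by (auto simp: j_def H_def)
      have "c * q ^ j * (C / x) \<le> c * q ^ j * l i0"
        using i0(2)[of i0] ij c q by (intro mult_left_mono) auto
      also have "\<dots> \<le> l i" using growth ij by simp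
      finally have "c * q ^ j * (C / x) * t i \<le> l i * t i" using t[of i] by (intro mult_right_mono) auto
      moreover have "c * q ^ j * (C / x) * t i = c * C * (1 - s) / 2 * (q * s) ^ j"
        using x by (simp add: t_def j_def power_mult_distrib)
      ultimately have lt: "c * C * (1 - s) / 2 / s ^ j \<le> l i * t i"
        unfolding qs by (simp add: power_divide)
      have p: "0 < c * C * (1 - s) / 2 / s ^ j" using c C s by auto
      have "d i = 1 / exp (l i * t i)" by (simp add: d_def exp_minus field_simps)
      also have "\<dots> \<le> 1 / (c * C * (1 - s) / 2 / s ^ j)"
        using lt exp_ge_add_one_self[of "l i * t i"] by (intro frac_le p) linarith+
      finally show ?thesis by (simp add: j_def)
    qed
    have d_sum: "sum d H \<le> ln (1 + e)"
    proof -
      have "sum d H \<le> 2 / (c * C * (1 - s)) * (\<Sum>i\<in>H. s ^ (i - i0))"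
        unfolding sum_distrib_left by (intro sum_mono d)
      also have "\<dots> \<le> 2 / (c * C * (1 - s)) * (1 / (1 - s))"
        using c C s by (intro mult_left_mono reindex) auto
      also have "\<dots> \<le> ln (1 + e)" using eta by (simp add: power2_eq_square mult.assoc)
      finally show ?thesis .
    qed
    have Pow: "Pow H = insert {} (Pow H - {{}})" by auto
    have finH: "finite H" by (simp add: H_def)
    have split: "(\<Prod>i\<in>H. u i + 1) = 1 + (\<Sum>S\<in>Pow H - {{}}. prod u S)" for u :: "nat \<Rightarrow> real"
      unfolding prod_add[OF finH] by (subst Pow, subst sum.insert) (auto simp: finH)
    show "\<exists>P w h. shift_annihilator l n C x e P w h"
      unfolding shift_annihilator_def
    proof (rule exI[of _ "Pow H - {{}}"], rule exI[of _ "\<lambda>S. \<Prod>i\<in>S. - d i"], rule exI[of _ "sum t"],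
        intro conjI ballI allI impI)
      show "finite (Pow H - {{}})" using finH by simp
    next
      fix S assume S: "S \<in> Pow H - {{}}"
      show "0 \<le> sum t S" using t by (intro sum_nonneg) (auto simp: less_imp_le)
      show "sum t S \<le> x / 2" using tsum S by auto
    next
      have "(\<Sum>S\<in>Pow H - {{}}. \<bar>\<Prod>i\<in>S. - d i\<bar>) = (\<Sum>S\<in>Pow H - {{}}. prod d S)"
        by (intro sum.cong refl) (simp add: abs_prod d_def)
      also have "\<dots> = (\<Prod>i\<in>H. d i + 1) - 1" by (simp add: split)
      also have "\<dots> \<le> (\<Prod>i\<in>H. exp (d i)) - 1"
        by (intro diff_right_mono prod_mono conjI) (auto simp: d_def add.commute[of _ 1] intro: add_nonneg_nonneg)
      also have "\<dots> = exp (sum d H) - 1" by (simp add: exp_sum finH)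
      also have "\<dots> \<le> exp (ln (1 + e)) - 1" using d_sum by simp
      also have "\<dots> = e" using e by simp
      finally show "(\<Sum>S\<in>Pow H - {{}}. \<bar>\<Prod>i\<in>S. - d i\<bar>) \<le> e" .
    next
      fix k assume k: "k < n" "C < l k * x"
      then have "k \<in> H" using i0(2)[OF k(1)] x by (auto simp: H_def field_simps)
      have "1 + (\<Sum>S\<in>Pow H - {{}}. (\<Prod>i\<in>S. - d i) * exp (l k * sum t S))
         = 1 + (\<Sum>S\<in>Pow H - {{}}. \<Prod>i\<in>S. - d i * exp (l k * t i))"
      proof (intro arg_cong[of _ _ "(+) 1"] sum.cong refl)
        fix S assume "S \<in> Pow H - {{}}"
        then have "finite S" using finH finite_subset by blast
        then show "(\<Prod>i\<in>S. - d i) * exp (l k * sum t S) = (\<Prod>i\<in>S. - d i * exp (l k * t i))"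
          by (simp only: prod.distrib sum_distrib_left exp_sum)
      qed
      also have "\<dots> = (\<Prod>i\<in>H. - d i * exp (l k * t i) + 1)" by (rule split[symmetric])
      also have "\<dots> = 0"
        using \<open>k \<in> H\<close> finH by (intro prod_zero bexI[of _ k]) (auto simp: d_def simp flip: exp_add)
      finally show "1 + (\<Sum>S\<in>Pow H - {{}}. (\<Prod>i\<in>S. - d i) * exp (l k * sum t S)) = 0" .
    qed
  qed
qed

lemma exp_sum_shift_combination:
  "exp_sum l n (\<lambda>k. of_real (1 + (\<Sum>S\<in>P. w S * exp (l k * h S))) * a k) y
     = exp_sum l n a y + (\<Sum>S\<in>P. of_real (w S) * exp_sum l n a (y - h S))"
proof -
  have "exp_sum l n (\<lambda>k. of_real (1 + (\<Sum>S\<in>P. w S * exp (l k * h S))) * a k) y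
     = exp_sum l n a y + exp_sum l n (\<lambda>k. \<Sum>S\<in>P. of_real (w S) * (a k * of_real (exp (l k * h S)))) y"
    unfolding exp_sum_add[symmetric]
    by (intro exp_sum_cong) (simp add: distrib_right distrib_left sum_distrib_right mult_ac flip: sum_distrib_left)
  also have "exp_sum l n (\<lambda>k. \<Sum>S\<in>P. of_real (w S) * (a k * of_real (exp (l k * h S)))) y
     = (\<Sum>S\<in>P. of_real (w S) * exp_sum l n a (y - h S))"
    unfolding exp_sum_sum exp_sum_cmult
  proof (intro sum.cong refl arg_cong2[of _ _ _ _ "(*)"])
    fix S
    have "complex_of_real (exp (l k * h S)) * of_real (exp (- (l k * y))) = of_real (exp (- (l k * (y - h S))))" for k
      by (simp add: algebra_simps flip: exp_add of_real_mult)
    then show "exp_sum l n (\<lambda>k. a k * of_real (exp (l k * h S))) y = exp_sum l n a (y - h S)"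
      unfolding exp_sum_def by (simp only: mult.assoc)
  qed
  finally show ?thesis .
qed

lemma norm_exp_sum_bound: "norm (exp_sum l n a y) \<le> (\<Sum>k<n. norm (a k))"
  if "\<And>k. k < n \<Longrightarrow> 0 \<le> l k" "0 \<le> y"
  unfolding exp_sum_def
  by (rule order.trans[OF norm_sum], intro sum_mono)
     (use that in \<open>auto simp: norm_mult intro!: mult_left_le\<close>)

lemma tail_integral_shift_le:
  assumes [measurable]: "F \<in> borel_measurable borel" and "0 < x" "0 \<le> h" "h \<le> x / 2"
  shows "(\<integral>\<^sup>+y\<in>{x..}. ennreal (norm (F (y - h)) / y\<^sup>2) \<partial>lborel) \<le> tail_integral F (x / 2)"
proof -
  have "(\<integral>\<^sup>+y\<in>{x..}. ennreal (norm (F (y - h)) / y\<^sup>2) \<partial>lborel)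
     = (\<integral>\<^sup>+y. ennreal (norm (F y) / (h + y)\<^sup>2) * indicator {x..} (h + y) \<partial>lborel)"
    using nn_integral_real_affine[of "\<lambda>y. ennreal (norm (F (y - h)) / y\<^sup>2) * indicator {x..} y" 1 h] by simp
  also have "\<dots> \<le> tail_integral F (x / 2)"
    unfolding tail_integral_def
  proof (intro nn_integral_mono)
    fix y :: real
    show "ennreal (norm (F y) / (h + y)\<^sup>2) * indicator {x..} (h + y)
      \<le> ennreal (norm (F y) / y\<^sup>2) * indicator {x / 2..} y"
    proof (cases "x \<le> h + y")
      case True
      then have "0 < y" "x / 2 \<le> y" using assms by auto
      then have "norm (F y) / (h + y)\<^sup>2 \<le> norm (F y) / y\<^sup>2"
        using assms by (intro divide_left_mono power_mono) auto
      then show ?thesis using True \<open>x / 2 \<le> y\<close> by (simp add: ennreal_leI)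
    qed simp
  qed
  finally show ?thesis .
qed

text \<open>
  The small shifts remove the large exponents, and the estimate for small exponents applies to what is
  left. The error is the mass of the shifts times the size of the same derivative
  slightly to the left of \<open>x\<close>.
\<close>
lemma norm_exp_sum_power_le_local:
  assumes g: "geometric_growth c q l" and p: "q ^ p \<ge> 2 * (1 + exp 3)" and e: "e > 0"
  shows "\<exists>D\<ge>0. \<forall>x>0. \<forall>n a T.
    (\<forall>y\<in>{x / 2..x}. norm (exp_sum l n (\<lambda>k. of_real (l k ^ Suc p) * a k) y) \<le> T) \<longrightarrow>
    ennreal (norm (exp_sum l n (\<lambda>k. of_real (l k ^ Suc p) * a k) x))
      \<le> ennreal (D / x ^ p) * tail_integral (exp_sum l n a) (x / 2) + ennreal (e * T)"
proof -
  obtain C where C: "C \<ge> 1" and ann: "\<And>x n. x > 0 \<Longrightarrow> \<exists>P w h. shift_annihilator l n C x e P w h"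
    using shift_annihilator_exists[OF g e] by blast
  obtain D where D: "D \<ge> 0" and low: "\<forall>x>0. \<forall>n (a :: nat \<Rightarrow> complex). (\<forall>k<n. C < l k * x \<longrightarrow> a k = 0) \<longrightarrow>
    ennreal (norm (exp_sum l n (\<lambda>k. of_real (l k ^ Suc p) * a k) x))
      \<le> ennreal (D / x ^ p) * tail_integral (exp_sum l n a) x"
    using norm_exp_sum_power_le_tail_integral[OF g p C] by (elim exE conjE)
  show ?thesis
  proof (intro exI[of _ "D * (1 + e)"] conjI allI impI)
    show "0 \<le> D * (1 + e)" using D e by simp
  next
    fix x :: real and n and a :: "nat \<Rightarrow> complex" and T
    assume x: "x > 0" and T: "\<forall>y\<in>{x / 2..x}. norm (exp_sum l n (\<lambda>k. of_real (l k ^ Suc p) * a k) y) \<le> T"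
    let ?G = "exp_sum l n (\<lambda>k. of_real (l k ^ Suc p) * a k)"
    let ?F = "exp_sum l n a"
    have T0: "0 \<le> T" using T[rule_format, of x] x norm_ge_zero[of "?G x"] by (simp del: norm_ge_zero)
    obtain P :: "nat set set" and w h where P: "finite P" "\<And>S. S \<in> P \<Longrightarrow> 0 \<le> h S \<and> h S \<le> x / 2"
        "(\<Sum>S\<in>P. \<bar>w S\<bar>) \<le> e" "\<And>k. k < n \<Longrightarrow> C < l k * x \<Longrightarrow> 1 + (\<Sum>S\<in>P. w S * exp (l k * h S)) = 0"
      using ann[OF x, of n] unfolding shift_annihilator_def by blast
    define b where "b k = of_real (1 + (\<Sum>S\<in>P. w S * exp (l k * h S))) * a k" for k
    let ?H = "exp_sum l n b"
    have "exp_sum l n (\<lambda>k. of_real (l k ^ Suc p) * b k) x = ?G x + (\<Sum>S\<in>P. of_real (w S) * ?G (x - h S))"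
      unfolding exp_sum_shift_combination[symmetric] b_def by (intro exp_sum_cong) (simp only: mult_ac)
    then have "?G x = exp_sum l n (\<lambda>k. of_real (l k ^ Suc p) * b k) x - (\<Sum>S\<in>P. of_real (w S) * ?G (x - h S))"
      by simp
    then have "norm (?G x) = norm (exp_sum l n (\<lambda>k. of_real (l k ^ Suc p) * b k) x - (\<Sum>S\<in>P. of_real (w S) * ?G (x - h S)))"
      by (rule arg_cong)
    also have "\<dots> \<le> norm (exp_sum l n (\<lambda>k. of_real (l k ^ Suc p) * b k) x) + norm (\<Sum>S\<in>P. of_real (w S) * ?G (x - h S))"
      by (rule norm_triangle_ineq4)
    finally have split: "norm (?G x) \<le> norm (exp_sum l n (\<lambda>k. of_real (l k ^ Suc p) * b k) x) + norm (\<Sum>S\<in>P. of_real (w S) * ?G (x - h S))" .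
    have "norm (\<Sum>S\<in>P. of_real (w S) * ?G (x - h S)) \<le> e * T"
    proof -
      have "norm (\<Sum>S\<in>P. of_real (w S) * ?G (x - h S)) \<le> (\<Sum>S\<in>P. norm (of_real (w S) * ?G (x - h S)))"
        by (rule norm_sum)
      also have "\<dots> \<le> (\<Sum>S\<in>P. \<bar>w S\<bar> * T)"
        unfolding norm_mult norm_of_real using P(2) T by (intro sum_mono mult_left_mono) force+
      also have "\<dots> = (\<Sum>S\<in>P. \<bar>w S\<bar>) * T" by (rule sum_distrib_right[symmetric])
      also have "\<dots> \<le> e * T" using P(3) T0 by (rule mult_right_mono)
      finally show ?thesis .
    qed
    then have "norm (?G x) \<le> norm (exp_sum l n (\<lambda>k. of_real (l k ^ Suc p) * b k) x) + e * T"
      using split by linarith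
    then have main: "ennreal (norm (?G x)) \<le> ennreal (norm (exp_sum l n (\<lambda>k. of_real (l k ^ Suc p) * b k) x)) + ennreal (e * T)"
      using e T0 by (subst ennreal_plus[symmetric]) (auto intro: ennreal_leI simp del: ennreal_plus)
    have lowH: "ennreal (norm (exp_sum l n (\<lambda>k. of_real (l k ^ Suc p) * b k) x)) \<le> ennreal (D / x ^ p) * tail_integral ?H x"
      by (rule low[rule_format, OF x]) (simp add: b_def P(4))
    have tailH: "tail_integral ?H x \<le> ennreal (1 + e) * tail_integral ?F (x / 2)"
    proof -
      have "tail_integral ?H x \<le> (\<integral>\<^sup>+y. ennreal (norm (?F (y - 0)) / y\<^sup>2) * indicator {x..} y +
           (\<Sum>S\<in>P. ennreal \<bar>w S\<bar> * (ennreal (norm (?F (y - h S)) / y\<^sup>2) * indicator {x..} y)) \<partial>lborel)"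
        unfolding tail_integral_def
      proof (intro nn_integral_mono)
        fix y :: real
        have "?H y = ?F y + (\<Sum>S\<in>P. of_real (w S) * ?F (y - h S))"
          unfolding b_def by (rule exp_sum_shift_combination)
        also have "norm \<dots> \<le> norm (?F y) + (\<Sum>S\<in>P. \<bar>w S\<bar> * norm (?F (y - h S)))"
          by (intro order.trans[OF norm_triangle_ineq] add_left_mono order.trans[OF norm_sum]) (simp add: norm_mult)
        finally have "norm (?H y) / y\<^sup>2 \<le> (norm (?F y) + (\<Sum>S\<in>P. \<bar>w S\<bar> * norm (?F (y - h S)))) / y\<^sup>2"
          by (rule divide_right_mono) simp
        also have "\<dots> = norm (?F y) / y\<^sup>2 + (\<Sum>S\<in>P. \<bar>w S\<bar> * (norm (?F (y - h S)) / y\<^sup>2))"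
          by (simp add: add_divide_distrib sum_divide_distrib)
        finally have "ennreal (norm (?H y) / y\<^sup>2) \<le> ennreal (norm (?F y) / y\<^sup>2) + (\<Sum>S\<in>P. ennreal (\<bar>w S\<bar> * (norm (?F (y - h S)) / y\<^sup>2)))"
          by (subst sum_ennreal, simp, subst ennreal_plus[symmetric]) (auto intro!: sum_nonneg ennreal_leI simp del: ennreal_plus)
        then show "ennreal (norm (?H y) / y\<^sup>2) * indicator {x..} y \<le> ennreal (norm (?F (y - 0)) / y\<^sup>2) * indicator {x..} y +
           (\<Sum>S\<in>P. ennreal \<bar>w S\<bar> * (ennreal (norm (?F (y - h S)) / y\<^sup>2) * indicator {x..} y))"
          by (cases "x \<le> y") (simp_all add: ennreal_mult'[symmetric] del: times_divide_eq_right)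
      qed
      also have "\<dots> = (\<integral>\<^sup>+y\<in>{x..}. ennreal (norm (?F (y - 0)) / y\<^sup>2) \<partial>lborel) +
           (\<Sum>S\<in>P. ennreal \<bar>w S\<bar> * (\<integral>\<^sup>+y\<in>{x..}. ennreal (norm (?F (y - h S)) / y\<^sup>2) \<partial>lborel))"
        by (subst nn_integral_add, measurable, subst nn_integral_sum, measurable, subst nn_integral_cmult, measurable)
      also have "\<dots> \<le> tail_integral ?F (x / 2) + (\<Sum>S\<in>P. ennreal \<bar>w S\<bar> * tail_integral ?F (x / 2))"
        using x P(2) by (intro add_mono sum_mono mult_left_mono tail_integral_shift_le) auto
      also have "\<dots> = ennreal (1 + (\<Sum>S\<in>P. \<bar>w S\<bar>)) * tail_integral ?F (x / 2)"
      proof -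
        have "ennreal (1 + (\<Sum>S\<in>P. \<bar>w S\<bar>)) = 1 + (\<Sum>S\<in>P. ennreal \<bar>w S\<bar>)"
          by (simp add: sum_nonneg)
        then show ?thesis by (simp only: distrib_right sum_distrib_right mult_1_left)
      qed
      also have "\<dots> \<le> ennreal (1 + e) * tail_integral ?F (x / 2)"
        using P(3) by (intro mult_right_mono ennreal_leI) auto
      finally show ?thesis .
    qed
    have "ennreal (D / x ^ p) * tail_integral ?H x \<le> ennreal (D / x ^ p) * (ennreal (1 + e) * tail_integral ?F (x / 2))"
      by (intro mult_left_mono tailH) simp
    also have "\<dots> = ennreal (D * (1 + e) / x ^ p) * tail_integral ?F (x / 2)"
      using D e x by (subst ennreal_mult_mult) auto
    finally show "ennreal (norm (?G x)) \<le> ennreal (D * (1 + e) / x ^ p) * tail_integral ?F (x / 2) + ennreal (e * T)"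
      using add_right_mono[OF order.trans[OF lowH], THEN order.trans[OF main]] by blast
  qed
qed

text \<open>
  In the variable \<open>t = e\<^sup>-\<^sup>u\<close> this concerns a neighbourhood of \<open>t = 0\<close>. For large \<open>y\<close> all exponents
  are above \<open>C / y\<close>, so the shifts bound the sum at \<open>y\<close> by half of its supremum over \<open>[y / 2, y]\<close>. The
  a priori bound by the coefficients is halved repeatedly until only the bound on \<open>[X / 2, X]\<close> remains.
\<close>
lemma norm_exp_sum_le_near_origin:
  assumes g: "geometric_growth c q l"
  shows "\<exists>X>0. \<forall>n a U. (\<forall>y\<in>{X / 2..X}. norm (exp_sum l n a y) \<le> U) \<longrightarrow> (\<forall>y\<ge>X / 2. norm (exp_sum l n a y) \<le> U)"
proof -
  have pos: "l k > 0" and mono: "mono l" for k using geometric_growth_pos[OF g] g by (auto simp: geometric_growth_def)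
  obtain C where C: "C \<ge> 1" and ann: "\<And>x n. x > 0 \<Longrightarrow> \<exists>P w h. shift_annihilator l n C x (1 / 2) P w h"
    using shift_annihilator_exists[OF g, of "1 / 2"] by auto
  define X where "X = C / l 0"
  have X: "X > 0" using C pos[of 0] by (simp add: X_def)
  show ?thesis
  proof (intro exI[of _ X] conjI X allI impI)
    fix n a U y
    assume U: "\<forall>y\<in>{X / 2..X}. norm (exp_sum l n a y) \<le> U" and y: "X / 2 \<le> y"
    have U0: "0 \<le> U" using U[rule_format, of X] X norm_ge_zero[of "exp_sum l n a X"] by (simp del: norm_ge_zero)
    define Z where "Z = (\<Sum>k<n. norm (a k))"
    have bound: "norm (exp_sum l n a y) \<le> U + Z / 2 ^ i" if "X / 2 \<le> y" for i y
      using that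
    proof (induction i arbitrary: y)
      case 0
      have "norm (exp_sum l n a y) \<le> Z"
        unfolding Z_def using 0 X pos by (intro norm_exp_sum_bound) (auto simp: less_imp_le)
      then show ?case using U0 by simp
    next
      case (Suc i)
      have Z: "Z \<ge> 0" by (simp add: Z_def sum_nonneg)
      show ?case
      proof (cases "y \<le> X")
        case True
        then have "norm (exp_sum l n a y) \<le> U" using U Suc.prems by simp
        moreover have "Z / 2 ^ Suc i \<ge> 0" using Z by simp
        ultimately show ?thesis by linarith
      next
        case False
        then have y: "y > X" "y > 0" using X by auto
        obtain P :: "nat set set" and w h where P: "finite P" "\<And>S. S \<in> P \<Longrightarrow> 0 \<le> h S \<and> h S \<le> y / 2"
            "(\<Sum>S\<in>P. \<bar>w S\<bar>) \<le> 1 / 2" "\<And>k. k < n \<Longrightarrow> C < l k * y \<Longrightarrow> 1 + (\<Sum>S\<in>P. w S * exp (l k * h S)) = 0"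
          using ann[OF y(2), of n] unfolding shift_annihilator_def by blast
        have "C < l k * y" for k
        proof -
          have "C = l 0 * X" using pos[of 0] by (simp add: X_def)
          also have "\<dots> < l 0 * y" using y pos[of 0] by simp
          also have "\<dots> \<le> l k * y" using y monoD[OF mono, of 0 k] by (intro mult_right_mono) auto
          finally show ?thesis .
        qed
        then have "exp_sum l n (\<lambda>k. of_real (1 + (\<Sum>S\<in>P. w S * exp (l k * h S))) * a k) y = exp_sum l n (\<lambda>k. 0) y"
          using P(4) by (intro exp_sum_cong) simp
        then have "exp_sum l n a y = - (\<Sum>S\<in>P. of_real (w S) * exp_sum l n a (y - h S))"
          unfolding exp_sum_shift_combination by (simp add: exp_sum_def eq_neg_iff_add_eq_0)
        then have "norm (exp_sum l n a y) = norm (\<Sum>S\<in>P. of_real (w S) * exp_sum l n a (y - h S))"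
          by simp
        also have "\<dots> \<le> (\<Sum>S\<in>P. norm (of_real (w S) * exp_sum l n a (y - h S)))"
          by (rule norm_sum)
        also have "\<dots> \<le> (\<Sum>S\<in>P. \<bar>w S\<bar> * (U + Z / 2 ^ i))"
          unfolding norm_mult norm_of_real using P(2) y
          by (intro sum_mono mult_left_mono Suc.IH) (force simp: field_simps)+
        also have "\<dots> = (\<Sum>S\<in>P. \<bar>w S\<bar>) * (U + Z / 2 ^ i)" by (rule sum_distrib_right[symmetric])
        also have "\<dots> \<le> 1 / 2 * (U + Z / 2 ^ i)" using P(3) U0 Z by (intro mult_right_mono) auto
        also have "\<dots> \<le> U + Z / 2 ^ Suc i" using U0 by (simp add: field_simps)
        finally show ?thesis .
      qed
    qed
    have "(\<lambda>i. U + Z / 2 ^ i) \<longlonglongrightarrow> U + 0"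
      by (rule tendsto_add[OF tendsto_const LIMSEQ_divide_realpow_zero]) simp
    then have "norm (exp_sum l n a y) \<le> U + 0"
      by (rule LIMSEQ_le_const) (use bound[OF y] in blast)
    then show "norm (exp_sum l n a y) \<le> U" by simp
  qed
qed

section \<open>The pointwise kernel estimate\<close>

text \<open>
  The supremum of \<open>(y / x)\<^sup>B\<close> times the scaled derivative at \<open>y\<close>, over \<open>0 < y \<le> x\<close>, is finite. The local estimate
  at \<open>y\<close> bounds it by the integral plus half of itself: the weight \<open>(y / x)\<^sup>B\<close> loses only a fixed factor
  between \<open>y\<close> and \<open>y / 2\<close>, for which the small constant of the local estimate is prepared.
\<close>
lemma norm_exp_sum_power_le_kernel:
  assumes g: "geometric_growth c q l" and p: "q ^ p \<ge> 2 * (1 + exp 3)"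
  shows "\<exists>D\<ge>0. \<forall>x>0. \<forall>n a.
    ennreal (x ^ Suc p * norm (exp_sum l n (\<lambda>k. of_real (l k ^ Suc p) * a k) x))
      \<le> ennreal D * (\<integral>\<^sup>+z\<in>{0<..}. ennreal (norm (exp_sum l n a z) * (x / z\<^sup>2 * (z / (z + x)) ^ Suc B)) \<partial>lborel)"
proof -
  have pos: "l k > 0" for k using geometric_growth_pos[OF g] .
  define M where "M = Suc p + B"
  \<comment> \<open>Between \<open>y\<close> and \<open>y / 2\<close> the weight \<open>y\<^sup>M\<close> loses at most the factor \<open>2\<^sup>M\<close>; the further factor
    \<open>1 / 2\<close> makes absorption possible.\<close>
  define e where "e = (1 / 2 ^ Suc M :: real)"
  have e: "e > 0" by (simp add: e_def)
  obtain D1 where D1: "D1 \<ge> 0" and loc: "\<forall>x>0. \<forall>n a T.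
    (\<forall>y\<in>{x / 2..x}. norm (exp_sum l n (\<lambda>k. of_real (l k ^ Suc p) * a k) y) \<le> T) \<longrightarrow>
    ennreal (norm (exp_sum l n (\<lambda>k. of_real (l k ^ Suc p) * a k) x))
      \<le> ennreal (D1 / x ^ p) * tail_integral (exp_sum l n a) (x / 2) + ennreal (e * T)"
    using norm_exp_sum_power_le_local[OF g p e] by (elim exE conjE)
  \<comment> \<open>The summand \<open>1\<close> keeps \<open>D\<close> positive, so that an infinite integral makes the claim trivial.\<close>
  define D where "D = 2 * (D1 * 4 ^ Suc B) + 1"
  show ?thesis
  proof (intro exI[of _ D] conjI allI impI)
    show "0 \<le> D" using D1 by (simp add: D_def)
  next
    fix x :: real and n and a :: "nat \<Rightarrow> complex"
    assume x: "x > 0"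
    let ?F = "exp_sum l n a"
    define N where "N y = norm (exp_sum l n (\<lambda>k. of_real (l k ^ Suc p) * a k) y)" for y
    define J where "J = (\<integral>\<^sup>+z\<in>{0<..}. ennreal (norm (?F z) * (x / z\<^sup>2 * (z / (z + x)) ^ Suc B)) \<partial>lborel)"
    define f where "f y = (y / x) ^ B * (y ^ Suc p * N y)" for y
    define Z where "Z = (\<Sum>k<n. norm (of_real (l k ^ Suc p) * a k))"
    have N0: "N y \<ge> 0" for y by (simp add: N_def)
    have f0: "f y \<ge> 0" if "y > 0" for y using that x N0 by (simp add: f_def)
    have tail: "ennreal ((y / x) ^ B * y) * tail_integral ?F (y / 2) \<le> ennreal (4 ^ Suc B) * J" if y: "0 < y" "y \<le> x" for y
    proof -
      have "ennreal ((y / x) ^ B * y) * tail_integral ?F (y / 2)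
         = (\<integral>\<^sup>+z. ennreal ((y / x) ^ B * y) * (ennreal (norm (?F z) / z\<^sup>2) * indicator {y / 2..} z) \<partial>lborel)"
        unfolding tail_integral_def by (rule nn_integral_cmult[symmetric]) measurable
      also have "\<dots> \<le> (\<integral>\<^sup>+z. ennreal (4 ^ Suc B) * (ennreal (norm (?F z) * (x / z\<^sup>2 * (z / (z + x)) ^ Suc B)) * indicator {0<..} z) \<partial>lborel)"
      proof (intro nn_integral_mono)
        fix z :: real
        show "ennreal ((y / x) ^ B * y) * (ennreal (norm (?F z) / z\<^sup>2) * indicator {y / 2..} z)
          \<le> ennreal (4 ^ Suc B) * (ennreal (norm (?F z) * (x / z\<^sup>2 * (z / (z + x)) ^ Suc B)) * indicator {0<..} z)"
        proof (cases "y / 2 \<le> z")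
          case True
          then have z: "z > 0" "y \<le> 2 * z" using y by auto
          have "y * (z + x) \<le> x * (2 * z) + 2 * z * x"
            unfolding distrib_left using z y x by (intro add_mono mult_mono) auto
          then have "y / x \<le> 4 * (z / (z + x))" using z x by (simp add: field_simps)
          then have "(y / x) ^ Suc B \<le> (4 * (z / (z + x))) ^ Suc B"
            using y x by (intro power_mono) auto
          then have "(y / x) ^ Suc B * x * (norm (?F z) / z\<^sup>2) \<le> (4 * (z / (z + x))) ^ Suc B * x * (norm (?F z) / z\<^sup>2)"
            using x by (intro mult_right_mono) auto
          moreover have "(y / x) ^ Suc B * x = (y / x) ^ B * y" using x by simp
          moreover have "(4 * (z / (z + x))) ^ Suc B * x * (norm (?F z) / z\<^sup>2)
              = 4 ^ Suc B * (norm (?F z) * (x / z\<^sup>2 * (z / (z + x)) ^ Suc B))"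
            unfolding power_mult_distrib by (simp add: mult_ac)
          ultimately have "(y / x) ^ B * y * (norm (?F z) / z\<^sup>2) \<le> 4 ^ Suc B * (norm (?F z) * (x / z\<^sup>2 * (z / (z + x)) ^ Suc B))"
            by metis
          then have "ennreal ((y / x) ^ B * y) * ennreal (norm (?F z) / z\<^sup>2) \<le> ennreal (4 ^ Suc B) * ennreal (norm (?F z) * (x / z\<^sup>2 * (z / (z + x)) ^ Suc B))"
            using x y z by (subst (1 2) ennreal_mult'[symmetric]) (auto intro: ennreal_leI simp del: power_Suc)
          then show ?thesis using True z by simp
        qed simp
      qed
      also have "\<dots> = ennreal (4 ^ Suc B) * J"
        unfolding J_def by (rule nn_integral_cmult) measurable
      finally show ?thesis .
    qed
    have "ennreal (f x) \<le> ennreal D * J"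
    proof (cases "J = \<infinity>")
      case True
      then show ?thesis using D1 by (simp add: D_def ennreal_mult_top)
    next
      case False
      then obtain j where j: "J = ennreal j" "j \<ge> 0" by (cases J) auto
      define S where "S = (SUP y\<in>{0<..x}. f y)"
      have bdd: "bdd_above (f ` {0<..x})"
      proof (rule bdd_aboveI2)
        fix y assume y: "y \<in> {0<..x}"
        have "N y \<le> Z" unfolding N_def Z_def using y pos by (intro norm_exp_sum_bound) (auto simp: less_imp_le)
        then have "f y \<le> 1 * (x ^ Suc p * Z)"
          unfolding f_def using y x N0[of y] by (intro mult_mono power_mono power_le_one) auto
        then show "f y \<le> x ^ Suc p * Z" by simp
      qed
      have fS: "f y \<le> S" if "0 < y" "y \<le> x" for y
        unfolding S_def using that by (intro cSUP_upper bdd) auto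
      have S0: "0 \<le> S" using f0[OF x] fS[OF x] by simp
      \<comment> \<open>The hypothesis of the local estimate on \<open>[y / 2, y]\<close> comes from the supremum \<open>S\<close> itself.\<close>
      have "f y \<le> D1 * 4 ^ Suc B * j + S / 2" if y: "0 < y" "y \<le> x" for y
      proof -
        define T where "T = S * x ^ B * (2 / y) ^ M"
        have T0: "T \<ge> 0" using S0 x y by (simp add: T_def)
        have NT: "N w \<le> T" if w: "w \<in> {y / 2..y}" for w
        proof -
          have w0: "w > 0" using w y by auto
          have "f w \<le> S" using w y w0 by (intro fS) auto
          then have "w ^ M * N w / x ^ B \<le> S"
            by (simp add: f_def M_def power_add power_divide mult_ac)
          then have "N w \<le> S * x ^ B * (1 / w) ^ M"
            using x w0 by (simp add: field_simps power_one_over)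
          also have "(1 / w) ^ M \<le> (2 / y) ^ M"
            using w w0 y by (intro power_mono) (auto simp: field_simps)
          finally show ?thesis using S0 x by (simp add: T_def mult_left_mono)
        qed
        have "ennreal (N y) \<le> ennreal (D1 / y ^ p) * tail_integral ?F (y / 2) + ennreal (e * T)"
          using NT unfolding N_def by (intro loc[rule_format, OF y(1)]) auto
        then have "ennreal ((y / x) ^ B * y ^ Suc p) * ennreal (N y)
           \<le> ennreal ((y / x) ^ B * y ^ Suc p) * (ennreal (D1 / y ^ p) * tail_integral ?F (y / 2) + ennreal (e * T))"
          by (rule mult_left_mono) simp
        also have "ennreal ((y / x) ^ B * y ^ Suc p) * ennreal (N y) = ennreal (f y)"
          unfolding f_def using y x by (subst ennreal_mult'[symmetric]) (auto simp: mult_ac)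
        also have "ennreal ((y / x) ^ B * y ^ Suc p) * (ennreal (D1 / y ^ p) * tail_integral ?F (y / 2) + ennreal (e * T))
           = ennreal ((y / x) ^ B * y ^ Suc p * (D1 / y ^ p)) * tail_integral ?F (y / 2) + ennreal ((y / x) ^ B * y ^ Suc p * (e * T))"
          unfolding distrib_left using x y D1 e T0
          by (subst ennreal_mult_mult, simp, simp, subst ennreal_mult'[symmetric]) auto
        also have "(y / x) ^ B * y ^ Suc p * (e * T) = S / 2"
        proof -
          have "(y / x) ^ B * y ^ Suc p * (x ^ B * (2 / y) ^ M) = 2 ^ M"
            using x y by (simp add: M_def power_add power_divide field_simps)
          then have "(y / x) ^ B * y ^ Suc p * (e * T) = e * S * 2 ^ M"
            unfolding T_def by (metis (no_types, opaque_lifting) mult.assoc mult.left_commute)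
          then show ?thesis by (simp add: e_def)
        qed
        also have "(y / x) ^ B * y ^ Suc p * (D1 / y ^ p) = D1 * ((y / x) ^ B * y)"
          using y by simp
        also have "ennreal (D1 * ((y / x) ^ B * y)) * tail_integral ?F (y / 2) = ennreal D1 * (ennreal ((y / x) ^ B * y) * tail_integral ?F (y / 2))"
          using x y D1 by (intro ennreal_mult_mult[symmetric]) auto
        finally have "ennreal (f y) \<le> ennreal D1 * (ennreal ((y / x) ^ B * y) * tail_integral ?F (y / 2)) + ennreal (S / 2)" .
        also have "\<dots> \<le> ennreal D1 * (ennreal (4 ^ Suc B) * J) + ennreal (S / 2)"
          by (intro add_right_mono mult_left_mono tail y) simp
        also have "\<dots> = ennreal (D1 * 4 ^ Suc B * j + S / 2)"
          unfolding j(1) using D1 j(2) S0 by (simp add: ennreal_mult'[symmetric] mult.assoc flip: ennreal_plus del: power_Suc)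
        finally show ?thesis using D1 j(2) S0 by (subst (asm) ennreal_le_iff) auto
      qed
      then have "S \<le> D1 * 4 ^ Suc B * j + S / 2"
        unfolding S_def using x by (intro cSUP_least) auto
      then have "f x \<le> 2 * (D1 * 4 ^ Suc B) * j" using fS[OF x] by simp
      also have "\<dots> \<le> D * j" unfolding D_def using j(2) by (intro mult_right_mono) auto
      finally have "ennreal (f x) \<le> ennreal (D * j)" by (rule ennreal_leI)
      also have "\<dots> = ennreal D * J" using j D1 by (simp add: D_def ennreal_mult' j(1))
      finally show ?thesis .
    qed
    then show "ennreal (x ^ Suc p * norm (exp_sum l n (\<lambda>k. of_real (l k ^ Suc p) * a k) x))
      \<le> ennreal D * (\<integral>\<^sup>+z\<in>{0<..}. ennreal (norm (exp_sum l n a z) * (x / z\<^sup>2 * (z / (z + x)) ^ Suc B)) \<partial>lborel)"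
      using x by (simp add: f_def N_def J_def)
  qed
qed

lemma norm_exp_sum_le_integral_deriv:
  assumes "\<And>k. k < n \<Longrightarrow> l k > 0"
  shows "ennreal (norm (exp_sum l n a x)) \<le> (\<integral>\<^sup>+y\<in>{x..}. ennreal (norm (exp_sum l n (\<lambda>k. of_real (l k) * a k) y)) \<partial>lborel)"
proof -
  let ?G = "exp_sum l n (\<lambda>k. of_real (l k) * a k)"
  have "exp_sum l n a x = exp_sum l n (\<lambda>k. (of_real (l k) * a k) / of_real (0 + l k)) x"
    using assms by (intro exp_sum_cong) force
  then have "ennreal (norm (exp_sum l n a x)) = ennreal (norm (exp_sum l n (\<lambda>k. (of_real (l k) * a k) / of_real (0 + l k)) x))"
    by simp
  also have "\<dots> \<le> (\<integral>\<^sup>+w\<in>{0..}. ennreal (exp (- (0 * w)) * norm (?G (x + w))) \<partial>lborel)"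
    by (intro norm_exp_sum_le_laplace assms) auto
  also have "\<dots> = (\<integral>\<^sup>+w. ennreal (norm (?G (x + 1 * w))) * indicator {x..} (x + 1 * w) \<partial>lborel)"
    by (intro nn_integral_cong) (auto simp: indicator_def)
  also have "\<dots> = (\<integral>\<^sup>+y\<in>{x..}. ennreal (norm (?G y)) \<partial>lborel)"
    by (subst nn_integral_real_affine[of "\<lambda>y. ennreal (norm (?G y)) * indicator {x..} y" 1 x]) auto
  finally show ?thesis .
qed

text \<open>
  Each further integration replaces \<open>y\<^sup>p\<close> by its integral over \<open>[x, w]\<close>, which is at most \<open>w\<^sup>p\<^sup>+\<^sup>1\<close>.
\<close>
lemma norm_exp_sum_le_integral_power:
  assumes l: "\<And>k. k < n \<Longrightarrow> l k > 0" and x: "x > 0"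
  shows "ennreal (norm (exp_sum l n a x)) \<le>
    (\<integral>\<^sup>+y\<in>{x..}. ennreal (y ^ p * norm (exp_sum l n (\<lambda>k. of_real (l k ^ Suc p) * a k) y)) \<partial>lborel)"
proof (induction p)
  case 0
  then show ?case using norm_exp_sum_le_integral_deriv[OF l] by simp
next
  case (Suc p)
  let ?G = "exp_sum l n (\<lambda>k. of_real (l k ^ Suc p) * a k)" and ?H = "exp_sum l n (\<lambda>k. of_real (l k ^ Suc (Suc p)) * a k)"
  note Suc
  also have "(\<integral>\<^sup>+y\<in>{x..}. ennreal (y ^ p * norm (?G y)) \<partial>lborel)
     \<le> (\<integral>\<^sup>+y. (\<integral>\<^sup>+w. ennreal (y ^ p) * indicator {x..} y * (ennreal (norm (?H w)) * indicator {y..} w) \<partial>lborel) \<partial>lborel)"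
  proof (rule nn_integral_mono, subst nn_integral_cmult)
    fix y :: real
    have "exp_sum l n (\<lambda>k. of_real (l k) * (of_real (l k ^ Suc p) * a k)) w = ?H w" for w
      by (intro exp_sum_cong) simp
    then have "ennreal (norm (?G y)) \<le> (\<integral>\<^sup>+w\<in>{y..}. ennreal (norm (?H w)) \<partial>lborel)"
      using norm_exp_sum_le_integral_deriv[where n = n and l = l and a = "\<lambda>k. of_real (l k ^ Suc p) * a k" and x = y, OF l] by simp
    then have "ennreal (y ^ p) * indicator {x..} y * ennreal (norm (?G y)) \<le> ennreal (y ^ p) * indicator {x..} y * (\<integral>\<^sup>+w\<in>{y..}. ennreal (norm (?H w)) \<partial>lborel)"
      by (intro mult_left_mono) auto
    then show "ennreal (y ^ p * norm (?G y)) * indicator {x..} y \<le> ennreal (y ^ p) * indicator {x..} y * (\<integral>\<^sup>+w\<in>{y..}. ennreal (norm (?H w)) \<partial>lborel)"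
      using x by (cases "x \<le> y") (auto simp: ennreal_mult')
  qed measurable
  also have "\<dots> = (\<integral>\<^sup>+w. (\<integral>\<^sup>+y. ennreal (y ^ p) * indicator {x..} y * (ennreal (norm (?H w)) * indicator {y..} w) \<partial>lborel) \<partial>lborel)"
  proof (rule lborel_pair.Fubini')
    have "(\<lambda>(w, y). ennreal (y ^ p) * indicator {x..} y * (ennreal (norm (?H w)) * of_bool (y \<le> w))) \<in> borel_measurable (lborel \<Otimes>\<^sub>M lborel)"
      by measurable
    then show "(\<lambda>(w, y). ennreal (y ^ p) * indicator {x..} y * (ennreal (norm (?H w)) * indicator {y..} w)) \<in> borel_measurable (lborel \<Otimes>\<^sub>M lborel)"
      by (simp add: indicator_def)
  qed
  also have "\<dots> \<le> (\<integral>\<^sup>+w\<in>{x..}. ennreal (w ^ Suc p * norm (?H w)) \<partial>lborel)"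
  proof (rule nn_integral_mono)
    fix w :: real
    show "(\<integral>\<^sup>+y. ennreal (y ^ p) * indicator {x..} y * (ennreal (norm (?H w)) * indicator {y..} w) \<partial>lborel)
       \<le> ennreal (w ^ Suc p * norm (?H w)) * indicator {x..} w"
    proof (cases "x \<le> w")
      case True
      have "(\<integral>\<^sup>+y. ennreal (y ^ p) * indicator {x..} y * (ennreal (norm (?H w)) * indicator {y..} w) \<partial>lborel)
         \<le> (\<integral>\<^sup>+y\<in>{x..w}. ennreal (w ^ p * norm (?H w)) \<partial>lborel)"
      proof (rule nn_integral_mono)
        fix y :: real
        have "ennreal (y ^ p * norm (?H w)) \<le> ennreal (w ^ p * norm (?H w))" if "x \<le> y" "y \<le> w"
          using that x by (intro ennreal_leI mult_right_mono power_mono) auto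
        then show "ennreal (y ^ p) * indicator {x..} y * (ennreal (norm (?H w)) * indicator {y..} w) \<le> ennreal (w ^ p * norm (?H w)) * indicator {x..w} y"
          using x by (cases "x \<le> y"; cases "y \<le> w") (auto simp: ennreal_mult')
      qed
      also have "\<dots> = ennreal (w ^ p * norm (?H w)) * ennreal (w - x)"
        using True by (subst nn_integral_cmult_indicator) auto
      also have "\<dots> = ennreal (w ^ p * norm (?H w) * (w - x))"
        using True x by (intro ennreal_mult[symmetric]) auto
      also have "\<dots> \<le> ennreal (w ^ p * norm (?H w) * w)"
        using True x by (intro ennreal_leI mult_left_mono) auto
      finally show ?thesis using True by (simp add: mult_ac)
    next
      case False
      then have "(\<lambda>y. ennreal (y ^ p) * indicator {x..} y * (ennreal (norm (?H w)) * indicator {y..} w)) = (\<lambda>y. 0)"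
        by (auto simp: indicator_def fun_eq_iff)
      then show ?thesis by simp
    qed
  qed
  finally show ?case .
qed

lemma nn_integral_inverse_square_Ici:
  fixes z x :: real
  assumes "z + x > 0"
  shows "(\<integral>\<^sup>+y\<in>{x..}. ennreal (1 / (z + y)\<^sup>2) \<partial>lborel) = ennreal (1 / (z + x))"
proof -
  have lim: "((\<lambda>y. - 1 / (z + y)) \<longlongrightarrow> 0) at_top" by real_asymp
  have "(\<integral>\<^sup>+y\<in>{x..}. ennreal (1 / (z + y)\<^sup>2) \<partial>lborel) = ennreal (0 - (- 1 / (z + x)))"
    using assms
    by (intro nn_integral_FTC_atLeast lim)
       (auto intro!: derivative_eq_intros simp: power2_eq_square)
  then show ?thesis by simp
qed

text \<open>
  The constant depends on the growth of the exponents and on \<open>B\<close>, but neither on the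
  coefficients nor on \<open>x\<close>. Near \<open>z = 0\<close> the kernel vanishes to any prescribed order; for large \<open>z\<close>
  it decreases only like \<open>1 / z\<close>.
\<close>
lemma norm_exp_sum_le_kernel:
  assumes g: "geometric_growth c q l"
  shows "\<exists>D\<ge>0. \<forall>x>0. \<forall>n a. ennreal (norm (exp_sum l n a x))
      \<le> ennreal D * (\<integral>\<^sup>+z\<in>{0<..}. ennreal (norm (exp_sum l n a z) * ((z / (z + x)) ^ Suc B / z)) \<partial>lborel)"
proof -
  have pos: "l k > 0" for k using geometric_growth_pos[OF g] .
  have "q > 1" using g by (simp add: geometric_growth_def)
  then obtain p where p: "q ^ p \<ge> 2 * (1 + exp 3)"
    using real_arch_pow[of q "2 * (1 + exp 3)"] by (meson less_imp_le)
  obtain D where D: "D \<ge> 0" and ker: "\<forall>x>0. \<forall>n a.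
    ennreal (x ^ Suc p * norm (exp_sum l n (\<lambda>k. of_real (l k ^ Suc p) * a k) x))
      \<le> ennreal D * (\<integral>\<^sup>+z\<in>{0<..}. ennreal (norm (exp_sum l n a z) * (x / z\<^sup>2 * (z / (z + x)) ^ Suc (Suc B))) \<partial>lborel)"
    using norm_exp_sum_power_le_kernel[OF g p, of "Suc B"] by (elim exE conjE)
  show ?thesis
  proof (intro exI[of _ D] conjI D allI impI)
    fix x :: real and n and a :: "nat \<Rightarrow> complex"
    assume x: "x > 0"
    let ?F = "exp_sum l n a" and ?G = "exp_sum l n (\<lambda>k. of_real (l k ^ Suc p) * a k)"
    let ?k = "\<lambda>y z. norm (?F z) * (1 / z\<^sup>2 * (z / (z + y)) ^ Suc (Suc B))"
    have "ennreal (norm (?F x)) \<le> (\<integral>\<^sup>+y\<in>{x..}. ennreal (y ^ p * norm (?G y)) \<partial>lborel)"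
      by (intro norm_exp_sum_le_integral_power pos x)
    also have "\<dots> \<le> (\<integral>\<^sup>+y. ennreal D * (\<integral>\<^sup>+z. ennreal (?k y z) * indicator {0<..} z * indicator {x..} y \<partial>lborel) \<partial>lborel)"
    proof (rule nn_integral_mono)
      fix y :: real
      show "ennreal (y ^ p * norm (?G y)) * indicator {x..} y \<le> ennreal D * (\<integral>\<^sup>+z. ennreal (?k y z) * indicator {0<..} z * indicator {x..} y \<partial>lborel)"
      proof (cases "x \<le> y")
        case True
        then have y: "y > 0" using x by simp
        have "ennreal (1 / y) * ennreal (y ^ Suc p * norm (?G y)) \<le> ennreal (1 / y) *
            (ennreal D * (\<integral>\<^sup>+z\<in>{0<..}. ennreal (norm (?F z) * (y / z\<^sup>2 * (z / (z + y)) ^ Suc (Suc B))) \<partial>lborel))"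
          by (intro mult_left_mono ker[rule_format] y) simp
        also have "\<dots> = ennreal D * (\<integral>\<^sup>+z. ennreal (1 / y) * (ennreal (norm (?F z) * (y / z\<^sup>2 * (z / (z + y)) ^ Suc (Suc B))) * indicator {0<..} z) \<partial>lborel)"
          by (subst nn_integral_cmult) (measurable, simp only: mult.left_commute)
        also have "\<dots> = ennreal D * (\<integral>\<^sup>+z\<in>{0<..}. ennreal (?k y z) \<partial>lborel)"
        proof (rule arg_cong[where f = "\<lambda>u. ennreal D * u"], rule nn_integral_cong)
          fix z :: real
          have "1 / y * (norm (?F z) * (y / z\<^sup>2 * (z / (z + y)) ^ Suc (Suc B))) = ?k y z"
            using y by simp
          then show "ennreal (1 / y) * (ennreal (norm (?F z) * (y / z\<^sup>2 * (z / (z + y)) ^ Suc (Suc B))) * indicator {0<..} z) = ennreal (?k y z) * indicator {0<..} z"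
            unfolding mult.assoc[symmetric] using y by (subst ennreal_mult'[symmetric]) auto
        qed
        also have "ennreal (1 / y) * ennreal (y ^ Suc p * norm (?G y)) = ennreal (y ^ p * norm (?G y))"
          using y by (subst ennreal_mult'[symmetric]) auto
        finally show ?thesis using True by simp
      qed simp
    qed
    also have "\<dots> = ennreal D * (\<integral>\<^sup>+y. (\<integral>\<^sup>+z. ennreal (?k y z) * indicator {0<..} z * indicator {x..} y \<partial>lborel) \<partial>lborel)"
      by (rule nn_integral_cmult) measurable
    also have "(\<integral>\<^sup>+y. (\<integral>\<^sup>+z. ennreal (?k y z) * indicator {0<..} z * indicator {x..} y \<partial>lborel) \<partial>lborel)
        = (\<integral>\<^sup>+z. (\<integral>\<^sup>+y\<in>{x..}. ennreal (?k y z) * indicator {0<..} z \<partial>lborel) \<partial>lborel)"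
      by (rule lborel_pair.Fubini') measurable
    also have "\<dots> \<le> (\<integral>\<^sup>+z\<in>{0<..}. ennreal (norm (?F z) * ((z / (z + x)) ^ Suc B / z)) \<partial>lborel)"
    proof (rule nn_integral_mono)
      fix z :: real
      show "(\<integral>\<^sup>+y\<in>{x..}. ennreal (?k y z) * indicator {0<..} z \<partial>lborel)
        \<le> ennreal (norm (?F z) * ((z / (z + x)) ^ Suc B / z)) * indicator {0<..} z"
      proof (cases "z > 0")
        case True
        have "(\<integral>\<^sup>+y\<in>{x..}. ennreal (?k y z) * indicator {0<..} z \<partial>lborel)
          \<le> (\<integral>\<^sup>+y. ennreal (norm (?F z) * (z / (z + x)) ^ B) * (ennreal (1 / (z + y)\<^sup>2) * indicator {x..} y) \<partial>lborel)"
        proof (rule nn_integral_mono)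
          fix y :: real
          show "ennreal (?k y z) * indicator {0<..} z * indicator {x..} y
             \<le> ennreal (norm (?F z) * (z / (z + x)) ^ B) * (ennreal (1 / (z + y)\<^sup>2) * indicator {x..} y)"
          proof (cases "x \<le> y")
            case y: True
            have "?k y z = norm (?F z) * (z / (z + y)) ^ B * (1 / (z + y)\<^sup>2)"
              using True y x by (simp add: power2_eq_square)
            also have "\<dots> \<le> norm (?F z) * (z / (z + x)) ^ B * (1 / (z + y)\<^sup>2)"
              using True y x by (intro mult_right_mono mult_left_mono power_mono divide_left_mono) auto
            finally have "ennreal (?k y z) \<le> ennreal (norm (?F z) * (z / (z + x)) ^ B) * ennreal (1 / (z + y)\<^sup>2)"
              using True x by (subst ennreal_mult'[symmetric]) (auto intro: ennreal_leI)
            then show ?thesis using True y by simp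
          qed simp
        qed
        also have "\<dots> = ennreal (norm (?F z) * (z / (z + x)) ^ B) * ennreal (1 / (z + x))"
          using True x by (subst nn_integral_cmult, measurable, subst nn_integral_inverse_square_Ici) auto
        also have "\<dots> = ennreal (norm (?F z) * ((z / (z + x)) ^ Suc B / z))"
          using True x by (subst ennreal_mult'[symmetric]) auto
        finally show ?thesis using True by simp
      qed simp
    qed
    finally show "ennreal (norm (?F x)) \<le> ennreal D * (\<integral>\<^sup>+z\<in>{0<..}. ennreal (norm (?F z) * ((z / (z + x)) ^ Suc B / z)) \<partial>lborel)"
      by (simp add: mult_left_mono)
  qed
qed

section \<open>Powers of the kernel estimate\<close>

text \<open>
  Young's inequality in the form \<open>s \<le> c\<^sup>1\<^sup>-\<^sup>r * s\<^sup>r + c\<close>. The choice \<open>c = u / (2 * D * A)\<close> makes the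
  contribution of the constant \<open>c\<close> equal to \<open>u / 2\<close>.
\<close>
lemma power_of_kernel_bound:
  fixes \<phi> \<omega> :: "'a \<Rightarrow> real"
  assumes [measurable]: "\<phi> \<in> borel_measurable M" "\<omega> \<in> borel_measurable M"
    and nonneg: "\<And>z. \<phi> z \<ge> 0" "\<And>z. \<omega> z \<ge> 0" "u \<ge> 0" "D \<ge> 0"
    and A: "A > 0" "(\<integral>\<^sup>+z. ennreal (\<omega> z) \<partial>M) \<le> ennreal A"
    and r: "r \<ge> 1"
    and le: "ennreal u \<le> ennreal D * (\<integral>\<^sup>+z. ennreal (\<phi> z * \<omega> z) \<partial>M)"
  shows "ennreal (u powr r) \<le> ennreal (2 * D * (2 * D * A) powr (r - 1)) * (\<integral>\<^sup>+z. ennreal (\<phi> z powr r * \<omega> z) \<partial>M)"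
proof (cases "u = 0 \<or> D = 0")
  case True
  then have "u = 0" using le nonneg by auto
  then show ?thesis by simp
next
  case False
  then have u: "u > 0" and D: "D > 0" using nonneg by auto
  define c where "c = u / (2 * D * A)"
  have c: "c > 0" using u D A by (simp add: c_def)
  define I where "I = (\<integral>\<^sup>+z. ennreal (\<phi> z powr r * \<omega> z) \<partial>M)"
  have young: "s \<le> c powr (1 - r) * s powr r + c" if "s \<ge> 0" for s
  proof (cases "s \<le> c")
    case True
    moreover have "0 \<le> c powr (1 - r) * s powr r" by simp
    ultimately show ?thesis by linarith
  next
    case False
    then have s: "s > c" "s > 0" using c by auto
    have "1 \<le> (s / c) powr (r - 1)" using s c r by (intro ge_one_powr_ge_zero) auto
    then have "s * 1 \<le> s * (s / c) powr (r - 1)" using s by (intro mult_left_mono) auto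
    also have "\<dots> = c powr (1 - r) * s powr r"
      using s c by (simp add: powr_divide powr_diff field_simps)
    finally show ?thesis using c by linarith
  qed
  show ?thesis
  proof (cases "I = \<infinity>")
    case True
    then show ?thesis using D A by (simp add: I_def[symmetric] ennreal_mult_top)
  next
    case False
    then obtain i where i: "I = ennreal i" "i \<ge> 0" by (cases I) auto
    have "(\<integral>\<^sup>+z. ennreal (\<phi> z * \<omega> z) \<partial>M)
        \<le> (\<integral>\<^sup>+z. ennreal (c powr (1 - r)) * ennreal (\<phi> z powr r * \<omega> z) + ennreal c * ennreal (\<omega> z) \<partial>M)"
    proof (rule nn_integral_mono)
      fix z
      have "\<phi> z * \<omega> z \<le> (c powr (1 - r) * \<phi> z powr r + c) * \<omega> z"
        by (intro mult_right_mono young nonneg)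
      then show "ennreal (\<phi> z * \<omega> z) \<le> ennreal (c powr (1 - r)) * ennreal (\<phi> z powr r * \<omega> z) + ennreal c * ennreal (\<omega> z)"
        using c nonneg by (simp add: ennreal_mult'[symmetric] distrib_right mult.assoc ennreal_leI flip: ennreal_plus)
    qed
    also have "\<dots> = ennreal (c powr (1 - r)) * I + ennreal c * (\<integral>\<^sup>+z. ennreal (\<omega> z) \<partial>M)"
      unfolding I_def by (subst nn_integral_add, measurable, subst (1 2) nn_integral_cmult) auto
    also have "\<dots> \<le> ennreal (c powr (1 - r)) * ennreal i + ennreal c * ennreal A"
      unfolding i(1) by (intro add_left_mono mult_left_mono A) simp
    also have "\<dots> = ennreal (c powr (1 - r) * i + c * A)"
      using c i A by (simp add: ennreal_mult'[symmetric] flip: ennreal_plus)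
    finally have "ennreal D * (\<integral>\<^sup>+z. ennreal (\<phi> z * \<omega> z) \<partial>M) \<le> ennreal D * ennreal (c powr (1 - r) * i + c * A)"
      by (rule mult_left_mono) simp
    with le have "ennreal u \<le> ennreal (D * (c powr (1 - r) * i + c * A))"
      using D by (simp add: ennreal_mult')
    then have "u \<le> D * (c powr (1 - r) * i + c * A)"
      using c i A D by (subst (asm) ennreal_le_iff) auto
    also have "\<dots> = D * c powr (1 - r) * i + u / 2"
      using A D by (simp add: c_def field_simps)
    finally have "u \<le> 2 * (D * c powr (1 - r) * i)" by linarith
    also have "\<dots> = 2 * D * i * c powr (1 - r)" by simp
    finally have "u \<le> 2 * D * i * c powr (1 - r)" .
    then have "u * c powr (r - 1) \<le> 2 * D * i * c powr (1 - r) * c powr (r - 1)"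
      by (rule mult_right_mono) simp
    also have "\<dots> = 2 * D * i" using c by (simp add: mult.assoc flip: powr_add)
    finally have "u * c powr (r - 1) * (2 * D * A) powr (r - 1) \<le> 2 * D * i * (2 * D * A) powr (r - 1)"
      by (rule mult_right_mono) simp
    moreover have "u * c powr (r - 1) * (2 * D * A) powr (r - 1) = u powr r"
      using u D A by (simp add: c_def mult.assoc powr_mult[symmetric] powr_mult_base)
    ultimately have "u powr r \<le> 2 * D * (2 * D * A) powr (r - 1) * i" by (simp add: mult_ac)
    then show ?thesis
      using D i by (simp add: I_def[symmetric] i(1) ennreal_mult'[symmetric] ennreal_leI)
  qed
qed

definition scale_kernel :: "real \<Rightarrow> nat \<Rightarrow> real \<Rightarrow> real \<Rightarrow> real" where
  "scale_kernel a B x z = ((z + x) / x) powr a * (z / (z + x)) ^ B / z"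

lemma nn_integral_powr_tail:
  fixes x d :: real
  assumes "x > 0" "d > 0"
  shows "(\<integral>\<^sup>+z\<in>{0..}. ennreal (1 / (z + x) * (x / (z + x)) powr d) \<partial>lborel) = ennreal (1 / d)"
proof -
  have lim: "((\<lambda>z. - (1 / d) * (x / (z + x)) powr d) \<longlongrightarrow> - (1 / d) * 0) at_top"
    using assms by (intro tendsto_mult tendsto_const) real_asymp
  have deriv: "((\<lambda>z. - (1 / d) * (x / (z + x)) powr d) has_real_derivative (1 / (z + x) * (x / (z + x)) powr d)) (at z)"
    if "0 \<le> z" for z
  proof -
    have z: "z + x > 0" using that assms by simp
    have "((\<lambda>z. - (1 / d) * (x / (z + x)) powr d) has_real_derivative
       - (1 / d) * (d * (x / (z + x)) powr (d - 1) * (- x / (z + x)\<^sup>2))) (at z)"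
      using z assms by (auto intro!: derivative_eq_intros simp: power2_eq_square)
    also have "- (1 / d) * (d * (x / (z + x)) powr (d - 1) * (- x / (z + x)\<^sup>2)) = 1 / (z + x) * (x / (z + x)) powr d"
    proof -
      have gen: "- (1 / d) * (d * (P * (s / x)) * (- x / s\<^sup>2)) = 1 / s * P" if "s \<noteq> 0" for P s :: real
        using assms that by (simp add: power2_eq_square)
      have "(x / (z + x)) powr (d - 1) = (x / (z + x)) powr d * ((z + x) / x)"
        using z assms by (simp add: powr_diff)
      then show ?thesis using gen[of "z + x"] z by simp
    qed
    finally show ?thesis .
  qed
  have "(\<integral>\<^sup>+z\<in>{0..}. ennreal (1 / (z + x) * (x / (z + x)) powr d) \<partial>lborel) = ennreal (- (1 / d) * 0 - (- (1 / d) * (x / (0 + x)) powr d))"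
    using assms by (intro nn_integral_FTC_atLeast lim deriv) auto
  then show ?thesis using assms by simp
qed

text \<open>
  The kernel of the linear estimate is not integrable at infinity. A factor
  \<open>(x / (z + x))\<^sup>d\<close> is moved from the function to the kernel before taking the power;
  this gives the factor \<open>((z + x) / x) powr a0\<close> of the new kernel.
\<close>
lemma norm_exp_sum_powr_le_scale_kernel:
  assumes g: "geometric_growth c q l" and r: "r \<ge> 1" and a0: "a0 > 0"
  shows "\<exists>D\<ge>0. \<forall>x>0. \<forall>n a. ennreal (norm (exp_sum l n a x) powr r)
      \<le> ennreal D * (\<integral>\<^sup>+z\<in>{0<..}. ennreal (norm (exp_sum l n a z) powr r * scale_kernel a0 (Suc B) x z) \<partial>lborel)"
proof -
  obtain D where D: "D \<ge> 0" and ker: "\<forall>x>0. \<forall>n a. ennreal (norm (exp_sum l n a x))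
      \<le> ennreal D * (\<integral>\<^sup>+z\<in>{0<..}. ennreal (norm (exp_sum l n a z) * ((z / (z + x)) ^ Suc B / z)) \<partial>lborel)"
    using norm_exp_sum_le_kernel[OF g, of B] by (elim exE conjE)
  \<comment> \<open>The power \<open>r\<close> turns \<open>d\<close> into \<open>d * r\<close>, of which the kernel takes back \<open>d\<close>.\<close>
  define d where "d = a0 / r"
  have d: "d > 0" "d * (r - 1) \<le> a0" using r a0 by (auto simp: d_def field_simps)
  define E where "E = 2 * D * (2 * D * (1 / d)) powr (r - 1)"
  show ?thesis
  proof (intro exI[of _ E] conjI allI impI)
    show "0 \<le> E" using D by (simp add: E_def)
  next
    fix x :: real and n and a :: "nat \<Rightarrow> complex"
    assume x: "x > 0"
    let ?F = "exp_sum l n a"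
    define w where "w z = (z / (z + x)) ^ Suc B / z * (x / (z + x)) powr d * indicator {0<..} z" for z
    define f where "f z = norm (?F z) * ((z + x) / x) powr d" for z
    have [measurable]: "w \<in> borel_measurable lborel" "f \<in> borel_measurable lborel"
      unfolding w_def f_def by measurable
    have w0: "w z \<ge> 0" for z using x by (cases "z > 0") (auto simp: w_def)
    have f0: "f z \<ge> 0" for z by (simp add: f_def)
    have fw: "ennreal (f z * w z) = ennreal (norm (?F z) * ((z / (z + x)) ^ Suc B / z)) * indicator {0<..} z" for z
    proof (cases "z > 0")
      case True
      have "((z + x) / x) powr d * (x / (z + x)) powr d = 1"
        using True x by (subst powr_mult[symmetric]) auto
      then have "f z * w z = norm (?F z) * ((z / (z + x)) ^ Suc B / z)"
        using True unfolding f_def w_def by (simp add: mult_ac del: power_Suc)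
      then show ?thesis using True by simp
    qed (simp add: w_def)
    have "ennreal (norm (?F x) powr r) \<le> ennreal E * (\<integral>\<^sup>+z. ennreal (f z powr r * w z) \<partial>lborel)"
      unfolding E_def
    proof (rule power_of_kernel_bound)
      show "(\<integral>\<^sup>+z. ennreal (w z) \<partial>lborel) \<le> ennreal (1 / d)"
        unfolding nn_integral_powr_tail[OF x d(1), symmetric]
      proof (rule nn_integral_mono)
        fix z :: real
        show "ennreal (w z) \<le> ennreal (1 / (z + x) * (x / (z + x)) powr d) * indicator {0..} z"
        proof (cases "z > 0")
          case True
          have "(z / (z + x)) ^ Suc B / z = (z / (z + x)) ^ B * (1 / (z + x))" using True by simp
          also have "\<dots> \<le> 1 * (1 / (z + x))" using True x by (intro mult_right_mono power_le_one) auto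
          finally have "(z / (z + x)) ^ Suc B / z * (x / (z + x)) powr d \<le> 1 / (z + x) * (x / (z + x)) powr d"
            by (intro mult_right_mono) auto
          moreover have "indicator {0<..} z = (1 :: real)" using True by simp
          ultimately have "w z \<le> 1 / (z + x) * (x / (z + x)) powr d"
            by (simp only: w_def mult_1_right)
          then show ?thesis using True by (simp add: ennreal_leI)
        qed (simp add: w_def)
      qed
      show "ennreal (norm (?F x)) \<le> ennreal D * (\<integral>\<^sup>+z. ennreal (f z * w z) \<partial>lborel)"
        unfolding fw by (rule ker[rule_format, OF x])
    qed (use w0 f0 D d r in auto)
    also have "\<dots> \<le> ennreal E * (\<integral>\<^sup>+z\<in>{0<..}. ennreal (norm (?F z) powr r * scale_kernel a0 (Suc B) x z) \<partial>lborel)"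
    proof (intro mult_left_mono nn_integral_mono)
      fix z :: real
      show "ennreal (f z powr r * w z) \<le> ennreal (norm (?F z) powr r * scale_kernel a0 (Suc B) x z) * indicator {0<..} z"
      proof (cases "z > 0")
        case True
        define s where "s = (z + x) / x"
        have s: "s \<ge> 1" using True x by (simp add: s_def)
        have inv: "x / (z + x) = 1 / s" by (simp add: s_def)
        have "f z powr r * w z = norm (?F z) powr r * (s powr (d * r) * (1 / s) powr d) * ((z / (z + x)) ^ Suc B / z)"
          using True s unfolding f_def w_def inv s_def[symmetric]
          by (simp add: powr_mult powr_powr del: power_Suc)
        also have "s powr (d * r) * (1 / s) powr d = s powr (d * (r - 1))"
          using s by (simp add: powr_divide powr_diff right_diff_distrib)
        also have "norm (?F z) powr r * s powr (d * (r - 1)) * ((z / (z + x)) ^ Suc B / z)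
            \<le> norm (?F z) powr r * s powr a0 * ((z / (z + x)) ^ Suc B / z)"
          using True x s d by (intro mult_right_mono mult_left_mono powr_mono) auto
        also have "\<dots> = norm (?F z) powr r * scale_kernel a0 (Suc B) x z"
          by (simp add: scale_kernel_def s_def del: power_Suc)
        finally show ?thesis using True by (simp add: ennreal_leI)
      qed (simp add: w_def)
    qed simp
    finally show "ennreal (norm (?F x) powr r) \<le> ennreal E *
       (\<integral>\<^sup>+z\<in>{0<..}. ennreal (norm (?F z) powr r * scale_kernel a0 (Suc B) x z) \<partial>lborel)" .
  qed
qed

lemma scale_kernel_nonneg: "x > 0 \<Longrightarrow> z > 0 \<Longrightarrow> scale_kernel a B x z \<ge> 0"
  by (simp add: scale_kernel_def)

text \<open>
  In terms of \<open>x / z\<close> the bound decays at both \<open>0\<close> and infinity, whence the geometric decay of the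
  contributions of distant dyadic scales.
\<close>
lemma scale_kernel_scaled_le:
  assumes x: "x > 0" and z: "z > 0" and a: "a > 0" and B: "real B \<ge> 4 * a"
  shows "x powr (2 * a) * scale_kernel a B x z \<le> z powr (2 * a - 1) * ((x / z) powr a * (1 + x / z) powr (- (3 * a)))"
proof -
  define t where "t = x / z"
  have t: "t > 0" "x = z * t" using x z by (auto simp: t_def)
  have "(z / (z + x)) ^ B = (z / (z + x)) powr real B"
    using x z by (subst powr_realpow) auto
  also have "\<dots> \<le> (z / (z + x)) powr (4 * a)"
    using x z B by (intro powr_mono') auto
  finally have "x powr (2 * a) * scale_kernel a B x z \<le> x powr (2 * a) * (((z + x) / x) powr a * (z / (z + x)) powr (4 * a) / z)"
    unfolding scale_kernel_def using x z by (intro mult_left_mono divide_right_mono) auto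
  also have "\<dots> = (z * t) powr (2 * a) * (((1 + t) / t) powr a * (1 / (1 + t)) powr (4 * a) / z)"
  proof -
    have "z + x = z * (1 + t)" using t by (simp add: algebra_simps)
    then have "(z + x) / x = (1 + t) / t" "z / (z + x) = 1 / (1 + t)" using z t by auto
    then show ?thesis using t by simp
  qed
  also have "\<dots> = z powr (2 * a - 1) * (t powr a * (1 + t) powr (- (3 * a)))"
  proof -
    have "1 / z = exp (- ln z)" using z by (simp add: exp_minus field_simps)
    then have "(z * t) powr (2 * a) * (((1 + t) / t) powr a * (1 / (1 + t)) powr (4 * a) / z)
      = exp (2 * a * (ln z + ln t)) * (exp (a * (ln (1 + t) - ln t)) * exp (4 * a * - ln (1 + t)) * exp (- ln z))"
      using z t by (simp add: powr_def ln_mult ln_div field_simps)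
    also have "\<dots> = exp ((2 * a - 1) * ln z) * (exp (a * ln t) * exp (- (3 * a) * ln (1 + t)))"
      by (simp add: algebra_simps flip: exp_add)
    finally show ?thesis using z t by (simp add: powr_def)
  qed
  finally show ?thesis by (simp add: t_def)
qed

lemma scale_kernel_scaled_le_powr:
  assumes x: "x > 0" and z: "z > 0" and a: "a > 0" and B: "real B \<ge> 4 * a"
  shows "x powr (2 * a) * scale_kernel a B x z \<le> z powr (2 * a - 1)"
proof -
  have t: "x / z > 0" using x z by simp
  have "(x / z) powr a * (1 + x / z) powr (- (3 * a)) \<le> (1 + x / z) powr a * (1 + x / z) powr (- (3 * a))"
    using t a by (intro mult_right_mono powr_mono2) auto
  also have "\<dots> = (1 + x / z) powr (- 2 * a)"
    using t by (simp flip: powr_add)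
  also have "\<dots> \<le> (1 + x / z) powr 0" using t a by (intro powr_mono) auto
  finally have "(x / z) powr a * (1 + x / z) powr (- (3 * a)) \<le> 1" using t by simp
  then have "z powr (2 * a - 1) * ((x / z) powr a * (1 + x / z) powr (- (3 * a))) \<le> z powr (2 * a - 1) * 1"
    by (intro mult_left_mono) auto
  then show ?thesis using scale_kernel_scaled_le[OF assms] by simp
qed

text \<open>
  With \<open>s j = (2\<^sup>-\<^sup>j / z)\<^sup>a\<close> the terms are dominated by the differences of the bounded monotone sequence
  \<open>s j / (1 + s j)\<close>, so that the sum telescopes, uniformly in \<open>z\<close>.
\<close>
lemma scale_kernel_dyadic_sum_le:
  assumes z: "z > 0" and a: "a > 0" and B: "real B \<ge> 4 * a"
  shows "(\<Sum>j. ennreal ((1 / 2 ^ j) powr (2 * a) * scale_kernel a B (1 / 2 ^ j) z))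
     \<le> ennreal (4 / (1 - (1 / 2) powr a) * z powr (2 * a - 1))"
proof -
  define k where "k = (1 / 2 :: real) powr a"
  have k: "0 < k" "k < 1" using powr_less_mono2[of a "1 / 2" 1] a by (auto simp: k_def)
  define s where "s j = (1 / 2 ^ j / z) powr a" for j :: nat
  define h where "h j = s j / (1 + s j)" for j :: nat
  have s: "s j > 0" for j using z by (simp add: s_def)
  have s_Suc: "s (Suc j) = k * s j" for j
    using z unfolding s_def k_def by (subst powr_mult[symmetric]) (simp add: mult.assoc)
  have term_le: "(1 / 2 ^ j) powr (2 * a) * scale_kernel a B (1 / 2 ^ j) z
      \<le> 4 / (1 - k) * z powr (2 * a - 1) * (h j - h (Suc j))" for j
  proof -
    define t where "t = 1 / 2 ^ j / z"
    have t: "t > 0" using z by (simp add: t_def)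
    have st: "s j = t powr a" by (simp add: s_def t_def)
    have "1 \<le> (1 + t) powr a" using t a by (intro ge_one_powr_ge_zero) auto
    moreover have "t powr a \<le> (1 + t) powr a" using t a by (intro powr_mono2) auto
    ultimately have "1 + s j \<le> 2 * (1 + t) powr a" unfolding st by simp
    then have "(1 + s j) * (1 + s j) \<le> (2 * (1 + t) powr a) * (2 * (1 + t) powr a)"
      using s[of j] by (intro mult_mono) auto
    also have "\<dots> = 4 * (1 + t) powr (2 * a)" using t by (simp flip: powr_add)
    also have "\<dots> \<le> 4 * (1 + t) powr (3 * a)" using t a by (intro mult_left_mono powr_mono) auto
    finally have sq: "(1 + s j) * (1 + s j) \<le> 4 * (1 + t) powr (3 * a)" .
    have "(1 + s j) * (1 + k * s j) \<le> (1 + s j) * (1 + s j)"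
      using s[of j] k by (intro mult_left_mono) auto
    with sq have le: "(1 + s j) * (1 + k * s j) \<le> 4 * (1 + t) powr (3 * a)" by linarith
    have "h j - h (Suc j) = (1 - k) * s j / ((1 + s j) * (1 + k * s j))"
    proof -
      have "1 + s j > 0" "1 + k * s j > 0" using s[of j] k by (auto intro: add_pos_pos)
      then show ?thesis unfolding h_def s_Suc by (simp add: field_simps)
    qed
    moreover have "(1 - k) * s j / ((1 + s j) * (1 + k * s j)) \<ge> (1 - k) * s j / (4 * (1 + t) powr (3 * a))"
      using le s[of j] k t by (intro divide_left_mono mult_pos_pos add_pos_pos) auto
    ultimately have "(1 - k) * s j / (4 * (1 + t) powr (3 * a)) \<le> h j - h (Suc j)" by simp
    then have "4 / (1 - k) * ((1 - k) * s j / (4 * (1 + t) powr (3 * a))) \<le> 4 / (1 - k) * (h j - h (Suc j))"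
      using k by (intro mult_left_mono) auto
    moreover have "4 / (1 - k) * ((1 - k) * s j / (4 * (1 + t) powr (3 * a))) = t powr a * (1 + t) powr (- (3 * a))"
    proof -
      have gen: "4 / m * (m * S / (4 * P)) = S * inverse P" if "m \<noteq> 0" for m S P :: real
        using that by (cases "P = 0") (simp_all add: field_simps)
      show ?thesis unfolding st powr_minus by (rule gen) (use k in simp)
    qed
    ultimately have "t powr a * (1 + t) powr (- (3 * a)) \<le> 4 / (1 - k) * (h j - h (Suc j))" by simp
    then have "z powr (2 * a - 1) * (t powr a * (1 + t) powr (- (3 * a))) \<le> z powr (2 * a - 1) * (4 / (1 - k) * (h j - h (Suc j)))"
      by (intro mult_left_mono) auto
    also have "\<dots> = 4 / (1 - k) * z powr (2 * a - 1) * (h j - h (Suc j))" by (simp only: mult_ac)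
    finally have "z powr (2 * a - 1) * (t powr a * (1 + t) powr (- (3 * a))) \<le> 4 / (1 - k) * z powr (2 * a - 1) * (h j - h (Suc j))" .
    moreover have "(1 / 2 ^ j) powr (2 * a) * scale_kernel a B (1 / 2 ^ j) z \<le> z powr (2 * a - 1) * (t powr a * (1 + t) powr (- (3 * a)))"
      unfolding t_def by (rule scale_kernel_scaled_le[OF _ z a B]) simp
    ultimately show ?thesis by (rule order.trans[rotated])
  qed
  show ?thesis
    unfolding k_def[symmetric]
  proof (rule suminf_le_const)
    fix n
    have "(\<Sum>j<n. (1 / 2 ^ j) powr (2 * a) * scale_kernel a B (1 / 2 ^ j) z)
       \<le> (\<Sum>j<n. 4 / (1 - k) * z powr (2 * a - 1) * (h j - h (Suc j)))"
      by (intro sum_mono term_le)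
    also have "\<dots> = 4 / (1 - k) * z powr (2 * a - 1) * (h 0 - h n)"
      unfolding sum_distrib_left[symmetric] by (simp only: sum_lessThan_telescope')
    also have "\<dots> \<le> 4 / (1 - k) * z powr (2 * a - 1) * 1"
    proof (intro mult_left_mono)
      have "h 0 \<le> 1" "h n \<ge> 0" using s[of 0] s[of n] by (auto simp: h_def)
      then show "h 0 - h n \<le> 1" by simp
    qed (use k in auto)
    finally have partial: "(\<Sum>j<n. (1 / 2 ^ j) powr (2 * a) * scale_kernel a B (1 / 2 ^ j) z) \<le> 4 / (1 - k) * z powr (2 * a - 1)"
      by simp
    have "(\<Sum>j<n. ennreal ((1 / 2 ^ j) powr (2 * a) * scale_kernel a B (1 / 2 ^ j) z))
       = ennreal (\<Sum>j<n. (1 / 2 ^ j) powr (2 * a) * scale_kernel a B (1 / 2 ^ j) z)"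
      using z by (intro sum_ennreal mult_nonneg_nonneg scale_kernel_nonneg) auto
    then show "(\<Sum>j<n. ennreal ((1 / 2 ^ j) powr (2 * a) * scale_kernel a B (1 / 2 ^ j) z)) \<le> ennreal (4 / (1 - k) * z powr (2 * a - 1))"
      using ennreal_leI[OF partial] by (simp only:)
  qed simp
qed

lemma scale_kernel_comparable:
  assumes x: "X / 2 \<le> x" "x \<le> X" "X > 0" and z: "z > 0" and a: "a > 0"
  shows "scale_kernel a B x z \<le> 2 powr a * 2 ^ B * scale_kernel a B X z"
proof -
  have x0: "x > 0" using x by simp
  have "(z + x) / x \<le> 2 * ((z + X) / X)"
  proof -
    have "(z + x) / x \<le> (z + X) / (X / 2)" using x x0 z by (intro frac_le) auto
    then show ?thesis by (simp add: mult.commute)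
  qed
  then have "((z + x) / x) powr a \<le> (2 * ((z + X) / X)) powr a"
    using x0 z a by (intro powr_mono2) auto
  also have "\<dots> = 2 powr a * ((z + X) / X) powr a" by (rule powr_mult)
  finally have 1: "((z + x) / x) powr a \<le> 2 powr a * ((z + X) / X) powr a" .
  have "z / (z + x) \<le> z / ((z + X) / 2)" using x z x0 by (intro divide_left_mono) auto
  then have "(z / (z + x)) ^ B \<le> (2 * (z / (z + X))) ^ B"
    using z x0 by (intro power_mono) (auto simp: mult.commute)
  then have 2: "(z / (z + x)) ^ B \<le> 2 ^ B * (z / (z + X)) ^ B" unfolding power_mult_distrib .
  have "scale_kernel a B x z \<le> (2 powr a * ((z + X) / X) powr a) * (2 ^ B * (z / (z + X)) ^ B) / z"
    unfolding scale_kernel_def using z x0 by (intro divide_right_mono mult_mono 1 2) auto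
  then show ?thesis unfolding scale_kernel_def by (simp add: mult_ac)
qed

lemma nn_integral_exp_substitution:
  fixes h :: "real \<Rightarrow> real"
  assumes [measurable]: "h \<in> borel_measurable borel"
  shows "(\<integral>\<^sup>+z\<in>{0..}. ennreal (h (exp (- z)) * exp (- z)) \<partial>lborel)
     \<le> (\<integral>\<^sup>+t\<in>{0..1}. ennreal (h t) \<partial>lborel)"
proof -
  let ?k = "\<lambda>w. ennreal (h (exp w) * exp w)"
  have "(\<integral>\<^sup>+z\<in>{0..}. ennreal (h (exp (- z)) * exp (- z)) \<partial>lborel)
     = (\<integral>\<^sup>+w\<in>{..0}. ?k w \<partial>lborel)"
    using nn_integral_real_affine[of "\<lambda>z. ennreal (h (exp (- z)) * exp (- z)) * indicator {0..} z" "- 1" 0]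
    by (simp add: indicator_def)
  also have "\<dots> = (\<integral>\<^sup>+w. (SUP N. ?k w * indicator {- real N..0} w) \<partial>lborel)"
  proof (intro nn_integral_cong)
    fix w :: real
    show "?k w * indicator {..0} w = (SUP N. ?k w * indicator {- real N..0} w)"
    proof (rule antisym)
      obtain N where "- w \<le> real N" using real_arch_simple by blast
      then have "?k w * indicator {..0} w \<le> ?k w * indicator {- real N..0} w"
        by (auto simp: indicator_def)
      then show "?k w * indicator {..0} w \<le> (SUP N. ?k w * indicator {- real N..0} w)"
        by (rule order.trans) (rule SUP_upper, simp)
      show "(SUP N. ?k w * indicator {- real N..0} w) \<le> ?k w * indicator {..0} w"
        by (rule SUP_least) (auto simp: indicator_def)
    qed
  qed
  also have "\<dots> = (SUP N. \<integral>\<^sup>+w\<in>{- real N..0}. ?k w \<partial>lborel)"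
    by (rule nn_integral_monotone_convergence_SUP)
       (auto simp: incseq_def le_fun_def indicator_def)
  also have "\<dots> \<le> (\<integral>\<^sup>+t\<in>{0..1}. ennreal (h t) \<partial>lborel)"
  proof (rule SUP_least)
    fix N :: nat
    have "(\<integral>\<^sup>+t. ennreal (h t * indicator {exp (- real N)..exp 0} t) \<partial>lborel)
      = (\<integral>\<^sup>+w. ennreal (h (exp w) * exp w * indicator {- real N..0} w) \<partial>lborel)"
      by (rule nn_integral_substitution)
         (auto intro!: derivative_eq_intros continuous_intros measurable_compose[OF _ borel_measurable_indicator] simp: set_borel_measurable_def)
    moreover have "(\<integral>\<^sup>+t. ennreal (h t * indicator {exp (- real N)..exp 0} t) \<partial>lborel)
        \<le> (\<integral>\<^sup>+t\<in>{0..1}. ennreal (h t) \<partial>lborel)"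
      by (intro nn_integral_mono) (auto simp: indicator_def order_trans[OF exp_ge_zero])
    moreover have "(\<integral>\<^sup>+w. ennreal (h (exp w) * exp w * indicator {- real N..0} w) \<partial>lborel) = (\<integral>\<^sup>+w\<in>{- real N..0}. ?k w \<partial>lborel)"
      by (intro nn_integral_cong) (auto simp: indicator_def)
    ultimately show "(\<integral>\<^sup>+w\<in>{- real N..0}. ?k w \<partial>lborel) \<le> (\<integral>\<^sup>+t\<in>{0..1}. ennreal (h t) \<partial>lborel)"
      by simp
  qed
  finally show ?thesis .
qed

text \<open>
  The right-hand side is the weight \<open>(1 - t) powr (\<alpha> - 1)\<close> in the variable \<open>t = e\<^sup>-\<^sup>z\<close>. It decays like \<open>e\<^sup>-\<^sup>z\<close>, and
  adding \<open>\<alpha> + 1\<close> to all exponents supplies enough decay on the left.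
\<close>
lemma powr_exp_weight_le:
  fixes z :: real
  assumes z: "z > 0" and \<alpha>: "\<alpha> > 0" and r: "r \<ge> 1"
  shows "exp (- ((\<alpha> + 1) * r * z)) * z powr (\<alpha> - 1) \<le> (1 - exp (- z)) powr (\<alpha> - 1) * exp (- z)"
proof -
  have e: "1 - exp (- z) > 0" using z by simp
  have e1: "1 - exp (- z) \<le> z" using exp_ge_add_one_self[of "- z"] by simp
  have rz: "(\<alpha> + 1) * z \<le> (\<alpha> + 1) * r * z"
    using z r \<alpha> by (intro mult_right_mono) auto
  show ?thesis
  proof (cases "\<alpha> \<ge> 1")
    case True
    have "exp (- z) * exp z = 1" by (simp flip: exp_add)
    then have "z \<le> exp z * (1 - exp (- z))"
      using exp_ge_add_one_self[of z] by (simp add: algebra_simps)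
    then have "z powr (\<alpha> - 1) \<le> (exp z * (1 - exp (- z))) powr (\<alpha> - 1)"
      using z True by (intro powr_mono2) auto
    also have "\<dots> = exp (z * (\<alpha> - 1)) * (1 - exp (- z)) powr (\<alpha> - 1)"
      using e by (subst powr_mult) (auto simp: powr_def)
    finally have "exp (- ((\<alpha> + 1) * r * z)) * z powr (\<alpha> - 1) \<le> exp (- ((\<alpha> + 1) * r * z)) * (exp (z * (\<alpha> - 1)) * (1 - exp (- z)) powr (\<alpha> - 1))"
      by (intro mult_left_mono) auto
    also have "\<dots> = exp (- ((\<alpha> + 1) * r * z) + z * (\<alpha> - 1)) * (1 - exp (- z)) powr (\<alpha> - 1)"
      by (simp only: exp_add mult.assoc)
    also have "\<dots> \<le> exp (- z) * (1 - exp (- z)) powr (\<alpha> - 1)"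
      using rz z by (intro mult_right_mono) (auto simp: algebra_simps)
    finally show ?thesis by (simp add: mult.commute)
  next
    case False
    have "z powr (\<alpha> - 1) \<le> (1 - exp (- z)) powr (\<alpha> - 1)"
      using False e e1 by (intro powr_mono2') auto
    moreover have "z \<le> (\<alpha> + 1) * r * z"
    proof -
      have "z \<le> (\<alpha> + 1) * z" using \<alpha> z by (simp add: algebra_simps)
      with rz show ?thesis by linarith
    qed
    then have "exp (- ((\<alpha> + 1) * r * z)) \<le> exp (- z)" by simp
    ultimately have "exp (- ((\<alpha> + 1) * r * z)) * z powr (\<alpha> - 1) \<le> exp (- z) * (1 - exp (- z)) powr (\<alpha> - 1)"
      by (intro mult_mono) auto
    then show ?thesis by (simp add: mult.commute)
  qed
qed

section \<open>Dyadic majorants\<close>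

lemma exp_sum_add_exponent: "exp_sum (\<lambda>k. l k + b) n a u = of_real (exp (- (b * u))) * exp_sum l n a u"
  unfolding exp_sum_def sum_distrib_left
proof (intro sum.cong refl)
  fix k
  have "exp (- ((l k + b) * u)) = exp (- (b * u)) * exp (- (l k * u))"
    by (simp add: algebra_simps flip: exp_add)
  then show "a k * of_real (exp (- ((l k + b) * u))) = of_real (exp (- (b * u))) * (a k * of_real (exp (- (l k * u))))"
    by (simp only: of_real_mult mult_ac)
qed

lemma geometric_growth_add:
  assumes g: "geometric_growth c q l" and b: "b \<ge> 0"
  shows "geometric_growth (c * (l 0 / (l 0 + b))) q (\<lambda>k. l k + b)"
proof -
  have c: "c > 0" and q: "q > 1" and mono: "mono l" and l0: "l 0 > 0"
    and growth: "\<And>k j. c * q ^ j * l k \<le> l (k + j)"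
    using g by (auto simp: geometric_growth_def)
  have "c * (l 0 / (l 0 + b)) * q ^ j * (l k + b) \<le> l (k + j) + b" for k j
  proof -
    have lk: "l 0 \<le> l k" using monoD[OF mono] by simp
    have "l 0 * (l k + b) \<le> l k * (l 0 + b)"
      using mult_right_mono[OF lk b] by (simp add: algebra_simps)
    then have "l 0 / (l 0 + b) * (l k + b) \<le> l k" using l0 b by (simp add: field_simps)
    then have "c * q ^ j * (l 0 / (l 0 + b) * (l k + b)) \<le> c * q ^ j * l k"
      using c q by (intro mult_left_mono) auto
    also have "\<dots> \<le> l (k + j) + b" using growth[of j k] b by simp
    finally show ?thesis by (simp only: mult_ac)
  qed
  moreover have "mono (\<lambda>k. l k + b)" using mono by (auto simp: mono_def)
  ultimately show ?thesis
    using c q l0 b unfolding geometric_growth_def by auto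
qed

text \<open>
  The inclusion of \<open>\<ell>\<^sup>1\<close> in \<open>\<ell>\<^sup>b\<close>.
\<close>
lemma suminf_powr_le:
  fixes s :: "nat \<Rightarrow> real"
  assumes s: "\<And>j. s j \<ge> 0" and T: "T \<ge> 0" and le: "(\<Sum>j. ennreal (s j)) \<le> ennreal T" and b: "b \<ge> 1"
  shows "(\<Sum>j. ennreal (s j powr b)) \<le> ennreal (T powr b)"
proof -
  have sT: "s j \<le> T" for j
  proof -
    have "ennreal (s j) = (\<Sum>i\<in>{j}. ennreal (s i))" by simp
    also have "\<dots> \<le> (\<Sum>i. ennreal (s i))" by (intro sum_le_suminf) auto
    finally have "ennreal (s j) \<le> ennreal T" using le by (rule order.trans)
    then show ?thesis using T by simp
  qed
  have "(\<Sum>j. ennreal (s j powr b)) \<le> (\<Sum>j. ennreal (T powr (b - 1)) * ennreal (s j))"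
  proof (intro suminf_le summableI)
    fix j
    show "ennreal (s j powr b) \<le> ennreal (T powr (b - 1)) * ennreal (s j)"
    proof (cases "s j = 0")
      case False
      then have "s j powr b = s j powr (b - 1) * s j" using s[of j] by (simp add: powr_diff)
      also have "\<dots> \<le> T powr (b - 1) * s j" using s[of j] sT[of j] b by (intro mult_right_mono powr_mono2) auto
      finally show ?thesis using s[of j] by (simp add: ennreal_mult'[symmetric] ennreal_leI)
    qed simp
  qed
  also have "\<dots> = ennreal (T powr (b - 1)) * (\<Sum>j. ennreal (s j))" by (rule ennreal_suminf_cmult)
  also have "\<dots> \<le> ennreal (T powr (b - 1)) * ennreal T" by (intro mult_left_mono le) simp
  also have "\<dots> = ennreal (T powr b)"
  proof (cases "T = 0")
    case False
    then show ?thesis using T by (subst ennreal_mult'[symmetric]) (auto simp: powr_diff)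
  qed (use b in simp)
  finally show ?thesis .
qed

text \<open>
  The integral of \<open>\<bar>f\<bar>\<^sup>r * (1 - t) powr (\<alpha> - 1)\<close> in the variable \<open>z = - ln t\<close>, with a homogeneous weight in place
  of \<open>(1 - e\<^sup>-\<^sup>z) powr (\<alpha> - 1) * e\<^sup>-\<^sup>z\<close>. The exponential factor is that of a sum with all exponents increased by \<open>\<alpha> + 1\<close>.
\<close>
definition muntz_energy :: "real \<Rightarrow> real \<Rightarrow> (real \<Rightarrow> complex) \<Rightarrow> ennreal" where
  "muntz_energy \<alpha> r F =
     (\<integral>\<^sup>+z\<in>{0<..}. ennreal (norm (F z) powr r * (exp (- ((\<alpha> + 1) * r * z)) * z powr (\<alpha> - 1))) \<partial>lborel)"

text \<open>
  The kernel estimate is applied to the exponents \<open>l k + (\<alpha> + 1)\<close>, that is to \<open>e\<^sup>-\<^sup>(\<^sup>\<alpha>\<^sup>+\<^sup>1\<^sup>)\<^sup>u\<close> times the sum, which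
  inserts the exponential weight. This is harmless on bounded intervals of \<open>u\<close>, hence on all dyadic
  cells, and the unbounded interval \<open>u \<ge> 1\<close> is controlled by a bounded one.
\<close>
lemma exp_sum_dyadic_majorant:
  assumes g: "geometric_growth c q l" and \<alpha>: "\<alpha> > 0" and r: "r \<ge> 1"
  shows "\<exists>D\<ge>0. \<forall>n a v. 0 \<le> v \<longrightarrow>
     muntz_energy \<alpha> r (exp_sum l n a) \<le> ennreal v \<longrightarrow>
     (\<exists>s. (\<forall>j. 0 \<le> s j) \<and>
       (\<forall>j u. 1 / 2 ^ Suc j \<le> u \<and> u \<le> 1 / 2 ^ j \<longrightarrow> norm (exp_sum l n a u) powr r \<le> s j) \<and>
       (\<Sum>j. ennreal ((1 / 2 ^ j) powr \<alpha> * s j)) \<le> ennreal (D * v) \<and>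
       (\<forall>u\<ge>1. norm (exp_sum l n a u) powr r \<le> D * v))"
proof -
  define b where "b = \<alpha> + 1"
  define a0 where "a0 = \<alpha> / 2"
  have b: "b \<ge> 0" and a0: "a0 > 0" "2 * a0 = \<alpha>" using \<alpha> by (auto simp: b_def a0_def)
  \<comment> \<open>Half of the available exponent \<open>\<alpha>\<close> is spent on integrability at infinity. The vanishing of the
    kernel at \<open>z = 0\<close> has to beat the weight \<open>x powr \<alpha>\<close>.\<close>
  obtain B :: nat where "4 * a0 \<le> real B" using real_arch_simple by blast
  then have B: "4 * a0 \<le> real (Suc B)" by simp
  let ?K = "scale_kernel a0 (Suc B)"
  obtain D1 where D1: "D1 \<ge> 0" and ker: "\<forall>x>0. \<forall>n a. ennreal (norm (exp_sum (\<lambda>k. l k + b) n a x) powr r)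
      \<le> ennreal D1 * (\<integral>\<^sup>+z\<in>{0<..}. ennreal (norm (exp_sum (\<lambda>k. l k + b) n a z) powr r * ?K x z) \<partial>lborel)"
    using norm_exp_sum_powr_le_scale_kernel[OF geometric_growth_add[OF g b] r a0(1), of B] by (elim exE conjE)
  obtain X where X: "X > 0" and near: "\<forall>n a U. (\<forall>y\<in>{X / 2..X}. norm (exp_sum l n a y) \<le> U) \<longrightarrow> (\<forall>y\<ge>X / 2. norm (exp_sum l n a y) \<le> U)"
    using norm_exp_sum_le_near_origin[OF g] by (elim exE conjE)
  define Y where "Y = max X 1"
  define m where "m = min (X / 2) 1"
  have Y: "Y \<ge> X" "Y \<ge> 1" and m: "0 < m" "m \<le> X / 2" "m \<le> 1" using X by (auto simp: Y_def m_def)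
  define C3 where "C3 = D1 * exp (b * r * Y) * m powr (- \<alpha>)"
  define C4 where "C4 = D1 * exp (b * r) * (2 powr a0 * 2 ^ Suc B)"
  define C5 where "C5 = C4 * (4 / (1 - (1 / 2) powr a0))"
  have half: "(1 / 2 :: real) powr a0 < 1" using powr_less_mono2[of a0 "1 / 2" 1] a0 by simp
  have C3: "C3 \<ge> 0" and C4: "C4 \<ge> 0" and C5: "C5 \<ge> 0" using D1 half by (auto simp: C3_def C4_def C5_def)
  show ?thesis
  proof (intro exI[of _ "max C3 C5"] conjI allI impI)
    show "0 \<le> max C3 C5" using C3 by simp
  next
    fix n and a :: "nat \<Rightarrow> complex" and v :: real
    let ?F = "exp_sum l n a"
    assume v: "0 \<le> v" and I_le: "muntz_energy \<alpha> r ?F \<le> ennreal v"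
    define G where "G z = norm (?F z) powr r * exp (- (b * r * z))" for z
    define S where "S x = (\<integral>\<^sup>+z\<in>{0<..}. ennreal (G z * ?K x z) \<partial>lborel)" for x
    define I where "I = (\<integral>\<^sup>+z\<in>{0<..}. ennreal (G z * z powr (\<alpha> - 1)) \<partial>lborel)"
    have [measurable]: "G \<in> borel_measurable borel" "?K x \<in> borel_measurable borel" for x
      unfolding G_def scale_kernel_def by measurable
    have G0: "G z \<ge> 0" for z by (simp add: G_def)
    have Iv: "I \<le> ennreal v" using I_le unfolding I_def G_def b_def muntz_energy_def by (simp only: mult.assoc)
    have "norm (exp_sum (\<lambda>k. l k + b) n a z) powr r = G z" for z
    proof -
      have "norm (exp_sum (\<lambda>k. l k + b) n a z) = exp (- (b * z)) * norm (?F z)"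
        by (simp add: exp_sum_add_exponent norm_mult)
      then show ?thesis by (simp add: G_def powr_mult exp_powr_real mult_ac)
    qed
    then have GS: "ennreal (G x) \<le> ennreal D1 * S x" if "x > 0" for x
      using ker[rule_format, OF that, of n a] by (simp only: S_def)
    have F_G: "norm (?F x) powr r = exp (b * r * x) * G x" for x
      by (simp add: G_def flip: exp_add)
    have S_le: "ennreal (x powr \<alpha>) * S x \<le> I" if x: "x > 0" for x
    proof -
      have "ennreal (x powr \<alpha>) * S x = (\<integral>\<^sup>+z. ennreal (x powr \<alpha>) * (ennreal (G z * ?K x z) * indicator {0<..} z) \<partial>lborel)"
        unfolding S_def by (rule nn_integral_cmult[symmetric]) measurable
      also have "\<dots> \<le> I"
        unfolding I_def
      proof (rule nn_integral_mono)
        fix z :: real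
        show "ennreal (x powr \<alpha>) * (ennreal (G z * ?K x z) * indicator {0<..} z) \<le> ennreal (G z * z powr (\<alpha> - 1)) * indicator {0<..} z"
        proof (cases "z > 0")
          case True
          have "G z * (x powr (2 * a0) * ?K x z) \<le> G z * z powr (2 * a0 - 1)"
            by (intro mult_left_mono scale_kernel_scaled_le_powr x True a0 B G0)
          then have "ennreal (x powr \<alpha> * (G z * ?K x z)) \<le> ennreal (G z * z powr (\<alpha> - 1))"
            unfolding a0(2) by (intro ennreal_leI) (simp add: mult_ac)
          then show ?thesis using True by (simp add: ennreal_mult'[symmetric])
        qed simp
      qed
      finally show ?thesis .
    qed
    have S_fin: "S x \<noteq> \<infinity>" if "x > 0" for x
    proof
      assume "S x = \<infinity>"
      then have "ennreal (x powr \<alpha>) * S x = \<infinity>" using that by (simp add: ennreal_mult_top)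
      then have "I = \<infinity>" using S_le[OF that] by (simp add: top.extremum_unique)
      then show False using Iv by (simp add: top.extremum_unique)
    qed
    have bound: "norm (?F x) powr r \<le> C3 * v" if x: "m \<le> x" "x \<le> Y" for x
    proof -
      have x0: "x > 0" using m x by simp
      have "ennreal (norm (?F x) powr r) = ennreal (exp (b * r * x)) * ennreal (G x)"
        unfolding F_G using G0 by (simp add: ennreal_mult')
      also have "\<dots> \<le> ennreal (exp (b * r * x)) * (ennreal D1 * S x)"
        by (intro mult_left_mono GS x0) simp
      also have "S x = ennreal (x powr (- \<alpha>)) * (ennreal (x powr \<alpha>) * S x)"
        using x0 by (subst ennreal_mult_mult) (auto simp flip: powr_add)
      also have "ennreal (exp (b * r * x)) * (ennreal D1 * (ennreal (x powr (- \<alpha>)) * (ennreal (x powr \<alpha>) * S x)))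
          \<le> ennreal (exp (b * r * x)) * (ennreal D1 * (ennreal (x powr (- \<alpha>)) * ennreal v))"
        by (intro mult_left_mono order.trans[OF S_le Iv] x0) auto
      also have "\<dots> = ennreal (exp (b * r * x) * (D1 * (x powr (- \<alpha>) * v)))"
        using D1 v by (simp add: ennreal_mult'[symmetric])
      finally have "norm (?F x) powr r \<le> exp (b * r * x) * (D1 * (x powr (- \<alpha>) * v))"
        using D1 v by (subst (asm) ennreal_le_iff) auto
      also have "\<dots> \<le> exp (b * r * Y) * (D1 * (m powr (- \<alpha>) * v))"
        using D1 v x m x0 \<alpha> b r
        by (intro mult_mono mult_left_mono mult_right_mono powr_mono2') (auto intro!: mult_left_mono)
      finally show ?thesis by (simp add: C3_def mult_ac)
    qed
    have root: "s \<le> w powr (1 / r)" if "0 \<le> s" "s powr r \<le> w" for s w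
    proof -
      have "(s powr r) powr (1 / r) \<le> w powr (1 / r)" using that r by (intro powr_mono2) auto
      then show ?thesis using that r by (simp add: powr_powr)
    qed
    have far: "norm (?F u) powr r \<le> C3 * v" if u: "u \<ge> 1" for u
    proof (cases "u \<le> Y")
      case True
      then show ?thesis using u m by (intro bound) auto
    next
      case False
      have "norm (?F y) \<le> (C3 * v) powr (1 / r)" if "y \<in> {X / 2..X}" for y
        using that m Y by (intro root bound) auto
      then have "norm (?F u) \<le> (C3 * v) powr (1 / r)"
        using near False X Y by auto
      then have "norm (?F u) powr r \<le> ((C3 * v) powr (1 / r)) powr r"
        using r by (intro powr_mono2) auto
      also have "\<dots> = C3 * v" using C3 v r by (simp add: powr_powr)
      finally show ?thesis .
    qed
    define s where "s j = C4 * enn2real (S (1 / 2 ^ j))" for j :: nat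
    have S_real: "S (1 / 2 ^ j) = ennreal (enn2real (S (1 / 2 ^ j)))" for j :: nat
      using S_fin[of "1 / 2 ^ j"] by (simp add: less_top)
    have near_le: "norm (?F u) powr r \<le> s j" if u: "1 / 2 ^ Suc j \<le> u" "u \<le> 1 / 2 ^ j" for j u
    proof -
      have u0: "u > 0" using u(1) by (rule less_le_trans[rotated]) simp
      have u1: "u \<le> 1" using u(2) by (rule order.trans) simp
      have "S u \<le> (\<integral>\<^sup>+z. ennreal (2 powr a0 * 2 ^ Suc B) * (ennreal (G z * ?K (1 / 2 ^ j) z) * indicator {0<..} z) \<partial>lborel)"
        unfolding S_def
      proof (rule nn_integral_mono)
        fix z :: real
        show "ennreal (G z * ?K u z) * indicator {0<..} z \<le> ennreal (2 powr a0 * 2 ^ Suc B) * (ennreal (G z * ?K (1 / 2 ^ j) z) * indicator {0<..} z)"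
        proof (cases "z > 0")
          case True
          have "G z * ?K u z \<le> G z * (2 powr a0 * 2 ^ Suc B * ?K (1 / 2 ^ j) z)"
            using u by (intro mult_left_mono scale_kernel_comparable True a0 G0) auto
          then have "ennreal (G z * ?K u z) \<le> ennreal (2 powr a0 * 2 ^ Suc B * (G z * ?K (1 / 2 ^ j) z))"
            by (intro ennreal_leI) (simp only: mult_ac)
          then show ?thesis using True by (simp add: ennreal_mult'[symmetric])
        qed simp
      qed
      also have "\<dots> = ennreal (2 powr a0 * 2 ^ Suc B) * S (1 / 2 ^ j)"
        unfolding S_def by (rule nn_integral_cmult) measurable
      finally have Su: "S u \<le> ennreal (2 powr a0 * 2 ^ Suc B) * ennreal (enn2real (S (1 / 2 ^ j)))"
        using S_real by simp
      have "ennreal (norm (?F u) powr r) = ennreal (exp (b * r * u)) * ennreal (G u)"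
        unfolding F_G using G0 by (simp add: ennreal_mult')
      also have "\<dots> \<le> ennreal (exp (b * r)) * (ennreal D1 * (ennreal (2 powr a0 * 2 ^ Suc B) * ennreal (enn2real (S (1 / 2 ^ j)))))"
      proof (intro mult_mono order.trans[OF GS[OF u0]] ennreal_leI Su)
        show "exp (b * r * u) \<le> exp (b * r)" using u1 b r by (simp add: mult_left_le)
      qed auto
      also have "\<dots> = ennreal (s j)"
        unfolding s_def C4_def using D1 by (simp add: ennreal_mult'[symmetric] mult_ac del: power_Suc)
      finally show ?thesis using C4 by (simp add: s_def)
    qed
    have sum_le: "(\<Sum>j. ennreal ((1 / 2 ^ j) powr \<alpha> * s j)) \<le> ennreal (C5 * v)"
    proof -
      have "(\<Sum>j. ennreal ((1 / 2 ^ j) powr \<alpha> * s j)) = (\<Sum>j. ennreal C4 * (ennreal ((1 / 2 ^ j) powr \<alpha>) * S (1 / 2 ^ j)))"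
      proof (intro suminf_cong)
        fix j
        show "ennreal ((1 / 2 ^ j) powr \<alpha> * s j) = ennreal C4 * (ennreal ((1 / 2 ^ j) powr \<alpha>) * S (1 / 2 ^ j))"
          by (subst S_real) (use C4 in \<open>simp add: s_def ennreal_mult'[symmetric] mult_ac\<close>)
      qed
      also have "\<dots> = ennreal C4 * (\<Sum>j. ennreal ((1 / 2 ^ j) powr \<alpha>) * S (1 / 2 ^ j))"
        by (rule ennreal_suminf_cmult)
      finally have 1: "(\<Sum>j. ennreal ((1 / 2 ^ j) powr \<alpha> * s j)) = ennreal C4 * (\<Sum>j. ennreal ((1 / 2 ^ j) powr \<alpha>) * S (1 / 2 ^ j))" .
      have "(\<Sum>j. ennreal ((1 / 2 ^ j) powr \<alpha>) * S (1 / 2 ^ j))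
         = (\<Sum>j. \<integral>\<^sup>+z. ennreal ((1 / 2 ^ j) powr \<alpha>) * (ennreal (G z * ?K (1 / 2 ^ j) z) * indicator {0<..} z) \<partial>lborel)"
        unfolding S_def by (intro suminf_cong nn_integral_cmult[symmetric]) measurable
      also have "\<dots> = (\<integral>\<^sup>+z. (\<Sum>j. ennreal ((1 / 2 ^ j) powr \<alpha>) * (ennreal (G z * ?K (1 / 2 ^ j) z) * indicator {0<..} z)) \<partial>lborel)"
        by (rule nn_integral_suminf[symmetric]) measurable
      also have "\<dots> \<le> (\<integral>\<^sup>+z. ennreal (4 / (1 - (1 / 2) powr a0)) * (ennreal (G z * z powr (\<alpha> - 1)) * indicator {0<..} z) \<partial>lborel)"
      proof (rule nn_integral_mono)
        fix z :: real
        show "(\<Sum>j. ennreal ((1 / 2 ^ j) powr \<alpha>) * (ennreal (G z * ?K (1 / 2 ^ j) z) * indicator {0<..} z))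
          \<le> ennreal (4 / (1 - (1 / 2) powr a0)) * (ennreal (G z * z powr (\<alpha> - 1)) * indicator {0<..} z)"
        proof (cases "z > 0")
          case True
          have "(\<Sum>j. ennreal ((1 / 2 ^ j) powr \<alpha>) * (ennreal (G z * ?K (1 / 2 ^ j) z) * indicator {0<..} z))
             = (\<Sum>j. ennreal (G z) * ennreal ((1 / 2 ^ j) powr (2 * a0) * ?K (1 / 2 ^ j) z))"
          proof (intro suminf_cong)
            fix j
            show "ennreal ((1 / 2 ^ j) powr \<alpha>) * (ennreal (G z * ?K (1 / 2 ^ j) z) * indicator {0<..} z)
               = ennreal (G z) * ennreal ((1 / 2 ^ j) powr (2 * a0) * ?K (1 / 2 ^ j) z)"
              unfolding a0(2) using True G0[of z] by (simp add: ennreal_mult'[symmetric] mult_ac)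
          qed
          also have "\<dots> = ennreal (G z) * (\<Sum>j. ennreal ((1 / 2 ^ j) powr (2 * a0) * ?K (1 / 2 ^ j) z))"
            by (rule ennreal_suminf_cmult)
          also have "\<dots> \<le> ennreal (G z) * ennreal (4 / (1 - (1 / 2) powr a0) * z powr (2 * a0 - 1))"
            by (intro mult_left_mono scale_kernel_dyadic_sum_le True a0 B) simp
          also have "\<dots> = ennreal (4 / (1 - (1 / 2) powr a0)) * ennreal (G z * z powr (\<alpha> - 1))"
            unfolding a0(2) using G0[of z] half by (subst (1 2) ennreal_mult'[symmetric]) (auto simp: mult_ac)
          finally show ?thesis using True by simp
        qed simp
      qed
      also have "\<dots> = ennreal (4 / (1 - (1 / 2) powr a0)) * I"
        unfolding I_def by (rule nn_integral_cmult) measurable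
      finally have 2: "(\<Sum>j. ennreal ((1 / 2 ^ j) powr \<alpha>) * S (1 / 2 ^ j)) \<le> ennreal (4 / (1 - (1 / 2) powr a0)) * I" .
      have "(\<Sum>j. ennreal ((1 / 2 ^ j) powr \<alpha> * s j)) \<le> ennreal C4 * (ennreal (4 / (1 - (1 / 2) powr a0)) * I)"
        unfolding 1 by (intro mult_left_mono 2) simp
      also have "\<dots> = ennreal C5 * I"
        unfolding C5_def using C4 half by (intro ennreal_mult_mult) auto
      also have "\<dots> \<le> ennreal C5 * ennreal v" by (intro mult_left_mono Iv) simp
      also have "\<dots> = ennreal (C5 * v)" using C5 by (simp add: ennreal_mult')
      finally show ?thesis .
    qed
    have mono3: "C3 * v \<le> max C3 C5 * v" and mono5: "C5 * v \<le> max C3 C5 * v"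
      using v by (auto intro: mult_right_mono)
    show "\<exists>s. (\<forall>j. 0 \<le> s j) \<and>
       (\<forall>j u. 1 / 2 ^ Suc j \<le> u \<and> u \<le> 1 / 2 ^ j \<longrightarrow> norm (?F u) powr r \<le> s j) \<and>
       (\<Sum>j. ennreal ((1 / 2 ^ j) powr \<alpha> * s j)) \<le> ennreal (max C3 C5 * v) \<and>
       (\<forall>u\<ge>1. norm (?F u) powr r \<le> max C3 C5 * v)"
    proof (intro exI[of _ s] conjI allI impI)
      show "0 \<le> s j" for j using C4 by (simp add: s_def)
      show "norm (?F u) powr r \<le> s j" if "1 / 2 ^ Suc j \<le> u \<and> u \<le> 1 / 2 ^ j" for j u
        using near_le that by blast
      show "(\<Sum>j. ennreal ((1 / 2 ^ j) powr \<alpha> * s j)) \<le> ennreal (max C3 C5 * v)"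
        using sum_le mono5 by (meson ennreal_leI order.trans)
      show "norm (?F u) powr r \<le> max C3 C5 * v" if "1 \<le> u" for u
        using far[OF that] mono3 by linarith
    qed
  qed
qed

section \<open>Carleson measures embed the Muntz space\<close>

lemma exists_dyadic_cell:
  fixes u :: real
  assumes "0 < u" "u < 1"
  shows "\<exists>j. 1 / 2 ^ Suc j \<le> u \<and> u \<le> 1 / 2 ^ j"
proof -
  have "\<exists>j. 1 / 2 ^ Suc j \<le> u"
  proof -
    obtain j where "(1 / 2) ^ j < u" using real_arch_pow_inv[of u "1 / 2"] assms by auto
    moreover have "1 / 2 ^ Suc j \<le> (1 / 2 :: real) ^ j" by (simp add: power_one_over frac_le)
    ultimately have "1 / 2 ^ Suc j \<le> u" by linarith
    then show ?thesis ..
  qed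
  then have *: "1 / 2 ^ Suc (LEAST j. 1 / 2 ^ Suc j \<le> u) \<le> u" 
    by (rule LeastI_ex[where P = "\<lambda>j. 1 / 2 ^ Suc j \<le> u"])
  define j where "j = (LEAST j. 1 / 2 ^ Suc j \<le> u)"
  have "u \<le> 1 / 2 ^ j"
  proof (cases j)
    case (Suc i)
    then have "\<not> 1 / 2 ^ Suc i \<le> u" unfolding j_def using not_less_Least[of i "\<lambda>j. 1 / 2 ^ Suc j \<le> u"] by simp
    then show ?thesis using Suc by simp
  qed (use assms in simp)
  then show ?thesis using * unfolding j_def by blast
qed

lemma borel_measure_unit_sets:
  assumes "borel_measure_unit \<mu>"
  shows "space \<mu> = {0..1}" "A \<in> sets borel \<Longrightarrow> A \<subseteq> {0..1} \<Longrightarrow> A \<in> sets \<mu>"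
proof -
  have s: "sets \<mu> = sets (restrict_space borel {0..1})" using assms by (simp add: borel_measure_unit_def)
  show "space \<mu> = {0..1}" using sets_eq_imp_space_eq[OF s] by simp
  show "A \<in> sets \<mu>" if "A \<in> sets borel" "A \<subseteq> {0..1}"
    unfolding s using that by (simp add: sets_restrict_space_iff)
qed

lemma carleson_class_emeasure_1:
  assumes \<mu>: "\<mu> \<in> carleson_class \<gamma>" and \<gamma>: "\<gamma> > 0"
  shows "emeasure \<mu> {1} = 0"
proof -
  have bmu: "borel_measure_unit \<mu>" using \<mu> by (simp add: carleson_class_def)
  obtain C where C: "C > 0" "\<And>e. e \<in> {0<..<1} \<Longrightarrow> emeasure \<mu> {1 - e..1} \<le> ennreal (C * e powr \<gamma>)"
    using \<mu> by (auto simp: carleson_class_def)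
  define k where "k = (1 / 2 :: real) powr \<gamma>"
  have k: "0 < k" "k < 1" using powr_less_mono2[of \<gamma> "1 / 2" 1] \<gamma> by (auto simp: k_def)
  have le: "emeasure \<mu> {1} \<le> ennreal (C * k ^ Suc j)" for j
  proof -
    have half: "1 / 2 ^ Suc j \<in> {0<..<1 :: real}"
      using one_less_power[of "2::real" "Suc j"] by simp
    have "emeasure \<mu> {1} \<le> emeasure \<mu> {1 - 1 / 2 ^ Suc j..1}"
      using half by (intro emeasure_mono borel_measure_unit_sets[OF bmu]) auto
    also have "\<dots> \<le> ennreal (C * (1 / 2 ^ Suc j) powr \<gamma>)" by (rule C(2)[OF half])
    also have "(1 / 2 ^ Suc j) powr \<gamma> = k ^ Suc j"
    proof -
      have "(1 / 2 ^ Suc j) powr \<gamma> = ((1 / 2 :: real) powr real (Suc j)) powr \<gamma>"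
        by (subst powr_realpow) (auto simp: power_one_over)
      also have "\<dots> = k powr real (Suc j)" by (simp add: k_def powr_powr mult.commute)
      finally show ?thesis using k by (simp add: powr_realpow del: power_Suc of_nat_Suc)
    qed
    finally show ?thesis .
  qed
  have "(\<lambda>j. C * k ^ j) \<longlonglongrightarrow> C * 0"
    using k by (intro tendsto_mult tendsto_const LIMSEQ_realpow_zero) auto
  then have "(\<lambda>j. ennreal (C * k ^ Suc j)) \<longlonglongrightarrow> ennreal (C * 0)"
    by (intro tendsto_ennrealI LIMSEQ_Suc)
  then have "emeasure \<mu> {1} \<le> ennreal (C * 0)"
    by (rule LIMSEQ_le_const) (use le in blast)
  then show ?thesis by simp
qed

text \<open>
  The unit interval is covered by the cells where \<open>- ln t\<close> lies between \<open>2\<^sup>-\<^sup>(\<^sup>j\<^sup>+\<^sup>1\<^sup>)\<close> and \<open>2\<^sup>-\<^sup>j\<close>, the remaining interval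
  of small \<open>t\<close> and the point \<open>1\<close>. The latter is a null set because \<open>\<alpha> * \<beta> > 0\<close>.
\<close>
lemma carleson_embedding:
  assumes g: "geometric_growth c q l" and \<alpha>: "\<alpha> > 0" and \<beta>: "\<beta> \<ge> 1" and r: "r \<ge> 1"
    and \<mu>: "\<mu> \<in> carleson_class (\<alpha> * \<beta>)"
  shows "\<exists>D\<ge>0. \<forall>n a f v. 0 \<le> v \<longrightarrow>
     (\<forall>t\<in>{0..1}. f t = (\<Sum>k<n. a k * complex_of_real (t powr l k))) \<longrightarrow>
     muntz_energy \<alpha> r (exp_sum l n a) \<le> ennreal v \<longrightarrow>
     (\<integral>\<^sup>+t. ennreal (norm (f t) powr (r * \<beta>)) \<partial>\<mu>) \<le> ennreal (D * v powr \<beta>)"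
proof -
  have bmu: "borel_measure_unit \<mu>" using \<mu> by (simp add: carleson_class_def)
  interpret finite_measure \<mu> using bmu by (simp add: borel_measure_unit_def)
  note space = borel_measure_unit_sets(1)[OF bmu] and sets = borel_measure_unit_sets(2)[OF bmu]
  obtain C0 where C0: "C0 > 0" "\<And>e. e \<in> {0<..<1} \<Longrightarrow> emeasure \<mu> {1 - e..1} \<le> ennreal (C0 * e powr (\<alpha> * \<beta>))"
    using \<mu> by (auto simp: carleson_class_def)
  define C where "C = max C0 (measure \<mu> (space \<mu>))"
  have C: "C \<ge> 0" "C0 \<le> C" "measure \<mu> (space \<mu>) \<le> C" using C0 by (auto simp: C_def)
  obtain D where D: "D \<ge> 0" and maj: "\<forall>n a v. 0 \<le> v \<longrightarrow>
     muntz_energy \<alpha> r (exp_sum l n a) \<le> ennreal v \<longrightarrow>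
     (\<exists>s. (\<forall>j. 0 \<le> s j) \<and>
       (\<forall>j u. 1 / 2 ^ Suc j \<le> u \<and> u \<le> 1 / 2 ^ j \<longrightarrow> norm (exp_sum l n a u) powr r \<le> s j) \<and>
       (\<Sum>j. ennreal ((1 / 2 ^ j) powr \<alpha> * s j)) \<le> ennreal (D * v) \<and>
       (\<forall>u\<ge>1. norm (exp_sum l n a u) powr r \<le> D * v))"
    using exp_sum_dyadic_majorant[OF g \<alpha> r] by (elim exE conjE)
  define E where "E j = {exp (- (1 / 2 ^ j))..exp (- (1 / 2 ^ Suc j)) :: real}" for j :: nat
  have E_sub: "E j \<subseteq> {1 - 1 / 2 ^ j..1}" for j
    using exp_ge_add_one_self[of "- (1 / 2 ^ j)"] by (auto simp: E_def intro: order.trans)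
  have X_le: "1 / 2 ^ j \<le> (1 :: real)" for j by simp
  have E_sub1: "E j \<subseteq> {0..1}" for j
  proof
    fix t assume "t \<in> E j"
    then have "1 - 1 / 2 ^ j \<le> t" "t \<le> 1" using E_sub[of j] by auto
    then have "0 \<le> t" using X_le[of j] by linarith
    then show "t \<in> {0..1}" using \<open>t \<le> 1\<close> by simp
  qed
  have E_sets: "E j \<in> sets \<mu>" for j using E_sub1 by (intro sets) (auto simp: E_def)
  have E_le: "emeasure \<mu> (E j) \<le> ennreal (C * (1 / 2 ^ j) powr (\<alpha> * \<beta>))" for j
  proof (cases j)
    case 0
    have "emeasure \<mu> (E j) \<le> emeasure \<mu> (space \<mu>)" by (rule emeasure_space)
    also have "\<dots> \<le> ennreal C" using C by (simp add: emeasure_eq_measure ennreal_leI)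
    finally show ?thesis using 0 by simp
  next
    case (Suc i)
    have h: "1 / 2 ^ j \<in> {0<..<1 :: real}" using Suc one_less_power[of "2::real" j] by simp
    have "emeasure \<mu> (E j) \<le> emeasure \<mu> {1 - 1 / 2 ^ j..1}"
      using E_sub X_le by (intro emeasure_mono sets) auto
    also have "\<dots> \<le> ennreal (C0 * (1 / 2 ^ j) powr (\<alpha> * \<beta>))" by (rule C0(2)[OF h])
    also have "\<dots> \<le> ennreal (C * (1 / 2 ^ j) powr (\<alpha> * \<beta>))"
      using C by (intro ennreal_leI mult_right_mono) auto
    finally show ?thesis .
  qed
  show ?thesis
  proof (intro exI[of _ "2 * C * D powr \<beta>"] conjI allI impI)
    show "0 \<le> 2 * C * D powr \<beta>" using C by simp
  next
    fix n and a :: "nat \<Rightarrow> complex" and f :: "real \<Rightarrow> complex" and v :: real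
    assume v: "0 \<le> v" and f: "\<forall>t\<in>{0..1}. f t = (\<Sum>k<n. a k * complex_of_real (t powr l k))"
      and I: "muntz_energy \<alpha> r (exp_sum l n a) \<le> ennreal v"
    obtain s where s: "\<And>j. 0 \<le> s j"
      and near: "\<And>j u. 1 / 2 ^ Suc j \<le> u \<Longrightarrow> u \<le> 1 / 2 ^ j \<Longrightarrow> norm (exp_sum l n a u) powr r \<le> s j"
      and sum: "(\<Sum>j. ennreal ((1 / 2 ^ j) powr \<alpha> * s j)) \<le> ennreal (D * v)"
      and far: "\<And>u. u \<ge> 1 \<Longrightarrow> norm (exp_sum l n a u) powr r \<le> D * v"
      using maj[rule_format, OF v I] by blast
    have f_exp_sum: "f t = exp_sum l n a (- ln t)" if "0 < t" "t \<le> 1" for t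
    proof -
      have "t powr l k = exp (- (l k * - ln t))" for k using that by (simp add: powr_def)
      then show ?thesis using f that unfolding exp_sum_def by auto
    qed
    have powr_le: "norm w powr (r * \<beta>) \<le> y powr \<beta>" if "norm w powr r \<le> y" for w :: complex and y
    proof -
      have "(norm w powr r) powr \<beta> \<le> y powr \<beta>" using that \<beta> by (intro powr_mono2) auto
      then show ?thesis by (simp add: powr_powr)
    qed
    have pt: "ennreal (norm (f t) powr (r * \<beta>)) \<le> ennreal ((D * v) powr \<beta>) + (\<Sum>j. ennreal (s j powr \<beta>) * indicator (E j) t)"
      if t: "t \<in> {0..1}" "t \<noteq> 1" for t
    proof (cases "t \<le> exp (- 1)")
      case True
      have "norm (f t) powr (r * \<beta>) \<le> (D * v) powr \<beta>"
      proof (cases "t = 0")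
        case True
        then have "f t = 0" using f by simp
        then show ?thesis by simp
      next
        case False
        then have t0: "t > 0" using t by simp
        then have "ln t \<le> - 1" using \<open>t \<le> exp (- 1)\<close> by (metis exp_gt_zero ln_exp ln_le_cancel_iff)
        then show ?thesis using f_exp_sum[OF t0] t by (intro powr_le) (auto intro!: far)
      qed
      then show ?thesis by (intro add_increasing2) (auto intro: ennreal_leI)
    next
      case False
      then have "exp (- 1) < t" by simp
      then have t0: "t > 0" by (rule less_trans[OF exp_gt_zero])
      have t1: "t < 1" using t by simp
      have "exp (- 1) < exp (ln t)" using \<open>exp (- 1) < t\<close> t0 by simp
      then have "- ln t < 1" unfolding exp_less_cancel_iff by simp
      then obtain j where j: "1 / 2 ^ Suc j \<le> - ln t" "- ln t \<le> 1 / 2 ^ j"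
        using exists_dyadic_cell[of "- ln t"] t0 t1 by auto
      have "exp (- (1 / 2 ^ j)) \<le> exp (ln t)" "exp (ln t) \<le> exp (- (1 / 2 ^ Suc j))"
        using j by (simp_all only: exp_le_cancel_iff)
      then have tE: "t \<in> E j" using t0 by (simp add: E_def)
      have "norm (f t) powr (r * \<beta>) \<le> s j powr \<beta>"
        using f_exp_sum[of t] t0 t1 j by (intro powr_le) (auto intro!: near)
      then have "ennreal (norm (f t) powr (r * \<beta>)) \<le> (\<Sum>i\<in>{j}. ennreal (s i powr \<beta>) * indicator (E i) t)"
        using tE by (simp add: ennreal_leI)
      also have "\<dots> \<le> (\<Sum>i. ennreal (s i powr \<beta>) * indicator (E i) t)"
        by (intro sum_le_suminf) auto
      finally show ?thesis by (intro add_increasing) auto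
    qed
    have "AE t in \<mu>. t \<noteq> 1"
      using carleson_class_emeasure_1[OF \<mu>] \<alpha> \<beta> by (intro AE_I[of _ _ "{1}"] sets) auto
    then have "AE t in \<mu>. ennreal (norm (f t) powr (r * \<beta>)) \<le> ennreal ((D * v) powr \<beta>) + (\<Sum>j. ennreal (s j powr \<beta>) * indicator (E j) t)"
      using AE_space by eventually_elim (rule pt, simp_all only: space not_False_eq_True)
    then have "(\<integral>\<^sup>+t. ennreal (norm (f t) powr (r * \<beta>)) \<partial>\<mu>)
       \<le> (\<integral>\<^sup>+t. ennreal ((D * v) powr \<beta>) + (\<Sum>j. ennreal (s j powr \<beta>) * indicator (E j) t) \<partial>\<mu>)"
      by (rule nn_integral_mono_AE)
    also have "\<dots> = ennreal ((D * v) powr \<beta>) * emeasure \<mu> (space \<mu>) + (\<Sum>j. ennreal (s j powr \<beta>) * emeasure \<mu> (E j))"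
      using E_sets by (subst nn_integral_add, simp, simp, subst nn_integral_suminf) (auto simp: nn_integral_cmult_indicator)
    also have "\<dots> \<le> ennreal ((D * v) powr \<beta>) * ennreal C + ennreal C * ennreal ((D * v) powr \<beta>)"
    proof (intro add_mono mult_left_mono)
      show "emeasure \<mu> (space \<mu>) \<le> ennreal C" using C by (simp add: emeasure_eq_measure ennreal_leI)
      have "(\<Sum>j. ennreal (s j powr \<beta>) * emeasure \<mu> (E j)) \<le> (\<Sum>j. ennreal C * ennreal (((1 / 2 ^ j) powr \<alpha> * s j) powr \<beta>))"
      proof (intro suminf_le summableI)
        fix j
        have "ennreal (s j powr \<beta>) * emeasure \<mu> (E j) \<le> ennreal (s j powr \<beta>) * ennreal (C * (1 / 2 ^ j) powr (\<alpha> * \<beta>))"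
          by (intro mult_left_mono E_le) simp
        also have "\<dots> = ennreal C * ennreal (((1 / 2 ^ j) powr \<alpha> * s j) powr \<beta>)"
          using C by (simp add: powr_mult powr_powr ennreal_mult'[symmetric] mult_ac)
        finally show "ennreal (s j powr \<beta>) * emeasure \<mu> (E j) \<le> ennreal C * ennreal (((1 / 2 ^ j) powr \<alpha> * s j) powr \<beta>)" .
      qed
      also have "\<dots> = ennreal C * (\<Sum>j. ennreal (((1 / 2 ^ j) powr \<alpha> * s j) powr \<beta>))"
        by (rule ennreal_suminf_cmult)
      also have "\<dots> \<le> ennreal C * ennreal ((D * v) powr \<beta>)"
        using s D v by (intro mult_left_mono suminf_powr_le sum \<beta>) auto
      finally show "(\<Sum>j. ennreal (s j powr \<beta>) * emeasure \<mu> (E j)) \<le> ennreal C * ennreal ((D * v) powr \<beta>)" .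
    qed simp
    also have "\<dots> = ennreal (2 * C * D powr \<beta> * v powr \<beta>)"
      using C by (simp add: powr_mult ennreal_mult'[symmetric] mult_ac flip: ennreal_plus)
    finally show "(\<integral>\<^sup>+t. ennreal (norm (f t) powr (r * \<beta>)) \<partial>\<mu>) \<le> ennreal (2 * C * D powr \<beta> * v powr \<beta>)" .
  qed
qed

lemma nn_integral_nu:
  assumes [measurable]: "h \<in> borel_measurable borel"
  shows "(\<integral>\<^sup>+x. h x \<partial>nu s) = (\<integral>\<^sup>+x\<in>{0..1}. ennreal ((1 - x) powr s) * h x \<partial>lborel)"
  unfolding nu_def
  by (subst nn_integral_density) (auto simp: nn_integral_restrict_space intro!: measurable_restrict_space1)

lemma nn_integral_nu_cong:
  assumes "\<And>t. t \<in> {0..1} \<Longrightarrow> h t = h' t"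
  shows "(\<integral>\<^sup>+x. h x \<partial>nu s) = (\<integral>\<^sup>+x. h' x \<partial>nu s)"
  by (intro nn_integral_cong) (use assms in \<open>auto simp: nu_def\<close>)

lemma carleson_imp_muntz_embeds:
  assumes g: "geometric_growth c q l" and \<alpha>: "\<alpha> > 0" and \<beta>: "\<beta> \<ge> 1" and p: "p \<ge> \<beta>"
    and \<mu>: "\<mu> \<in> carleson_class (\<alpha> * \<beta>)"
  shows "muntz_embeds l (p / \<beta>) (nu (\<alpha> - 1)) p \<mu>"
proof -
  define r where "r = p / \<beta>"
  have r: "r \<ge> 1" and pr: "p = r * \<beta>" and p0: "p > 0" using p \<beta> by (auto simp: r_def)
  have r0: "r > 0" using r by simp
  obtain D where D: "D \<ge> 0" and emb: "\<forall>n a f v. 0 \<le> v \<longrightarrow>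
     (\<forall>t\<in>{0..1}. f t = (\<Sum>k<n. a k * complex_of_real (t powr l k))) \<longrightarrow>
     muntz_energy \<alpha> r (exp_sum l n a) \<le> ennreal v \<longrightarrow>
     (\<integral>\<^sup>+t. ennreal (norm (f t) powr (r * \<beta>)) \<partial>\<mu>) \<le> ennreal (D * v powr \<beta>)"
    using carleson_embedding[OF g \<alpha> \<beta> r \<mu>] by (elim exE conjE)
  have l: "l k > 0" for k using geometric_growth_pos[OF g] .
  show ?thesis
    unfolding muntz_embeds_def r_def[symmetric]
  proof (intro exI[of _ "(D + 1) powr (1 / p)"] conjI ballI)
    show "0 < (D + 1) powr (1 / p)" using D by simp
  next
    fix f assume "f \<in> muntz_space l"
    then obtain K a where fK: "\<And>t. t \<in> {0..1} \<Longrightarrow> f t = (\<Sum>k\<le>K. a k * complex_of_real (t powr l k))"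
      by (auto simp: muntz_space_def)
    define n where "n = Suc K"
    define h where "h t = (\<Sum>k<n. a k * complex_of_real (t powr l k))" for t
    have fh: "f t = h t" if "t \<in> {0..1}" for t using fK[OF that] by (simp add: h_def n_def lessThan_Suc_atMost)
    have [measurable]: "h \<in> borel_measurable borel" unfolding h_def by measurable
    define Iv where "Iv = (\<integral>\<^sup>+x. ennreal (norm (f x) powr r) \<partial>nu (\<alpha> - 1))"
    define Im where "Im = (\<integral>\<^sup>+x. ennreal (norm (f x) powr p) \<partial>\<mu>)"
    show "Lp_norm p \<mu> f \<le> ennreal ((D + 1) powr (1 / p)) * Lp_norm r (nu (\<alpha> - 1)) f"
    proof (cases "Iv = \<infinity>")
      case True
      then have "Lp_norm r (nu (\<alpha> - 1)) f = \<infinity>" by (simp add: Lp_norm_def Iv_def)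
      then show ?thesis using D by (simp add: ennreal_mult_top)
    next
      case False
      then obtain v where v: "Iv = ennreal v" "v \<ge> 0" by (cases Iv) auto
      have h_exp: "h (exp (- z)) = exp_sum l n a z" for z
        unfolding h_def exp_sum_def by (simp add: powr_def)
      have "muntz_energy \<alpha> r (exp_sum l n a)
        \<le> (\<integral>\<^sup>+z\<in>{0..}. ennreal (norm (h (exp (- z))) powr r * (1 - exp (- z)) powr (\<alpha> - 1) * exp (- z)) \<partial>lborel)"
        unfolding muntz_energy_def
      proof (rule nn_integral_mono)
        fix z :: real
        show "ennreal (norm (exp_sum l n a z) powr r * (exp (- ((\<alpha> + 1) * r * z)) * z powr (\<alpha> - 1))) * indicator {0<..} z
          \<le> ennreal (norm (h (exp (- z))) powr r * (1 - exp (- z)) powr (\<alpha> - 1) * exp (- z)) * indicator {0..} z"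
        proof (cases "z > 0")
          case True
          have "norm (exp_sum l n a z) powr r * (exp (- ((\<alpha> + 1) * r * z)) * z powr (\<alpha> - 1))
              \<le> norm (exp_sum l n a z) powr r * ((1 - exp (- z)) powr (\<alpha> - 1) * exp (- z))"
            by (intro mult_left_mono powr_exp_weight_le True \<alpha> r) simp
          then show ?thesis using True by (simp add: h_exp ennreal_leI mult.assoc)
        qed simp
      qed
      also have "\<dots> \<le> (\<integral>\<^sup>+t\<in>{0..1}. ennreal (norm (h t) powr r * (1 - t) powr (\<alpha> - 1)) \<partial>lborel)"
        by (rule nn_integral_exp_substitution) measurable
      also have "\<dots> = (\<integral>\<^sup>+t\<in>{0..1}. ennreal ((1 - t) powr (\<alpha> - 1)) * ennreal (norm (h t) powr r) \<partial>lborel)"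
        by (intro nn_integral_cong) (simp add: ennreal_mult'[symmetric] mult.commute)
      also have "\<dots> = (\<integral>\<^sup>+x. ennreal (norm (h x) powr r) \<partial>nu (\<alpha> - 1))"
        by (rule nn_integral_nu[symmetric]) measurable
      also have "\<dots> = Iv" unfolding Iv_def by (rule nn_integral_nu_cong) (simp add: fh)
      finally have "muntz_energy \<alpha> r (exp_sum l n a) \<le> ennreal v"
        unfolding v(1) .
      then have Im_le: "Im \<le> ennreal (D * v powr \<beta>)"
        unfolding Im_def pr using fh by (intro emb[rule_format, OF v(2)]) (auto simp: h_def)
      then have fin: "Im \<noteq> \<infinity>" by (auto simp: top.extremum_unique)
      then obtain w where w: "Im = ennreal w" "w \<ge> 0" by (cases Im) auto
      have "w \<le> D * v powr \<beta>" using Im_le D w by simp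
      also have "\<dots> \<le> (D + 1) * v powr \<beta>" by (intro mult_right_mono) auto
      finally have "w powr (1 / p) \<le> ((D + 1) * v powr \<beta>) powr (1 / p)"
        using w p0 by (intro powr_mono2) auto
      also have "\<dots> = (D + 1) powr (1 / p) * v powr (1 / r)"
        using \<beta> by (simp add: powr_mult powr_powr pr)
      finally have "ennreal (w powr (1 / p)) \<le> ennreal ((D + 1) powr (1 / p)) * ennreal (v powr (1 / r))"
        by (simp add: ennreal_mult'[symmetric] ennreal_leI)
      moreover have "Lp_norm p \<mu> f = ennreal (w powr (1 / p))"
        using w by (simp add: Lp_norm_def Im_def)
      moreover have "Lp_norm r (nu (\<alpha> - 1)) f = ennreal (v powr (1 / r))"
        using v by (simp add: Lp_norm_def Iv_def)
      ultimately show ?thesis by simp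
    qed
  qed
qed

section \<open>Growth of quasi-lacunary exponents\<close>

lemma geometric_growthI:
  assumes mono: "mono l" and l0: "l 0 > 0" and q0: "q0 > 1" and P: "P > 0"
    and step: "\<And>i. q0 * l i \<le> l (i + P)"
  shows "\<exists>c q. geometric_growth c q l"
proof -
  define q where "q = root P q0"
  have q: "q > 1" using q0 P by (simp add: q_def)
  have qP: "q ^ P = q0" using q0 P by (simp add: q_def)
  have l: "l k > 0" for k using monoD[OF mono, of 0 k] l0 by simp
  have iter: "q0 ^ m * l k \<le> l (k + P * m)" for m k
  proof (induction m)
    case (Suc m)
    have "q0 ^ Suc m * l k = q0 * (q0 ^ m * l k)" by simp
    also have "\<dots> \<le> q0 * l (k + P * m)" using Suc q0 by (intro mult_left_mono) auto
    also have "\<dots> \<le> l (k + P * m + P)" by (rule step)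
    finally show ?case by (simp add: algebra_simps)
  qed simp
  have "1 / q0 * q ^ j * l k \<le> l (k + j)" for k j
  proof -
    have j: "j = P * (j div P) + j mod P" by simp
    have "q ^ j = q0 ^ (j div P) * q ^ (j mod P)"
      by (subst j, subst power_add, subst power_mult, simp only: qP)
    also have "\<dots> \<le> q0 ^ (j div P) * q ^ P"
      using q q0 P by (intro mult_left_mono power_increasing) (auto simp: less_imp_le)
    finally have "1 / q0 * q ^ j \<le> q0 ^ (j div P)" using q0 by (simp add: qP field_simps)
    then have "1 / q0 * q ^ j * l k \<le> q0 ^ (j div P) * l k" using l[of k] by (intro mult_right_mono) auto
    also have "\<dots> \<le> l (k + P * (j div P))" by (rule iter)
    also have "\<dots> \<le> l (k + j)" by (rule monoD[OF mono]) simp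
    finally show ?thesis .
  qed
  then have "geometric_growth (1 / q0) q l"
    unfolding geometric_growth_def using q0 q mono l0 by auto
  then show ?thesis by blast
qed

text \<open>
  The blocks are translated into two estimates for the exponents themselves:
  geometric growth, and in the subgeometric case bounded ratios of neighbours.
\<close>
locale muntz_blocks =
  fixes \<Lambda> :: "nat \<Rightarrow> real" and N q0 n
  assumes mono: "strict_mono \<Lambda>" and pos: "\<And>k. \<Lambda> k > 0"
    and blocks: "quasi_lacunary_blocks \<Lambda> N q0 n"
begin

lemma n_strict_mono: "strict_mono n" and n_0: "n 0 = -1" and q0_gt_1: "q0 > 1"
  using blocks by (auto simp: quasi_lacunary_blocks_def)

lemma n_ge: "n k \<ge> int k - 1"
proof (induction k)
  case (Suc k)
  have "n k < n (Suc k)" by (rule strict_monoD[OF n_strict_mono]) simp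
  then show ?case using Suc by simp
qed (simp add: n_0)

text \<open>
  The exponents are distinct, so the number of elements of a block is its number of indices.
\<close>
lemma n_Suc_le: "n (Suc k) \<le> n k + int N"
proof -
  have lt: "n k < n (Suc k)" by (rule strict_monoD[OF n_strict_mono]) simp
  define J where "J = {j. n k < int j \<and> int j \<le> n (Suc k)}"
  have "int ` J = {n k<..n (Suc k)}"
  proof (intro equalityI subsetI)
    fix i assume i: "i \<in> {n k<..n (Suc k)}"
    then have "0 \<le> i" using n_ge[of k] by simp
    then show "i \<in> int ` J" using i unfolding J_def by (intro image_eqI[of _ _ "nat i"]) auto
  qed (auto simp: J_def)
  then have "card J = nat (n (Suc k) - n k)"
    using card_image[of int J] by simp
  moreover have "muntz_block \<Lambda> n k = \<Lambda> ` J" unfolding muntz_block_def J_def by auto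
  moreover have "inj_on \<Lambda> J" using strict_mono_imp_inj_on[OF mono] inj_on_subset by blast
  ultimately have "card (muntz_block \<Lambda> n k) = nat (n (Suc k) - n k)"
    by (simp add: card_image)
  moreover have "card (muntz_block \<Lambda> n k) \<le> N" using blocks by (simp add: quasi_lacunary_blocks_def)
  ultimately show ?thesis using lt by simp
qed

lemma locate_block:
  assumes "n K < int i"
  shows "\<exists>k\<ge>K. n k < int i \<and> int i \<le> n (Suc k)"
proof -
  have ex: "int i \<le> n (Suc i)" using n_ge[of "Suc i"] by simp
  define k where "k = (LEAST k. int i \<le> n (Suc k))"
  have le: "int i \<le> n (Suc k)" unfolding k_def using ex by (rule LeastI)
  have "K \<le> k"
  proof (rule ccontr)
    assume "\<not> K \<le> k"
    then have "n (Suc k) \<le> n K" using n_strict_mono by (simp add: strict_mono_less_eq)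
    then show False using le assms by simp
  qed
  moreover have "n k < int i"
  proof (cases "k = K")
    case False
    then obtain k' where k': "k = Suc k'" using \<open>K \<le> k\<close> by (cases k) auto
    then have "\<not> int i \<le> n (Suc k')" unfolding k_def using not_less_Least[of k' "\<lambda>k. int i \<le> n (Suc k)"] by simp
    then show ?thesis using k' by simp
  qed (use assms in simp)
  ultimately show ?thesis using le by blast
qed

lemma ratio_lower:
  assumes "muntz_ratio \<Lambda> n k > q0"
  shows "q0 * \<Lambda> (nat (n k)) \<le> \<Lambda> (nat (n (Suc k)))"
  using assms pos[of "nat (n k)"] by (simp add: muntz_ratio_def field_simps)

text \<open>
  An index \<open>i\<close> of the \<open>k\<close>-th block is followed after at most \<open>2 * N\<close> steps by the last index of the
  next block, where the exponent has grown by the factor \<open>q0\<close>. Merely reaching the next block is not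
  enough, since its first exponent may be arbitrarily close to the last one of the block before.
\<close>
lemma exponent_growth: "\<exists>c q. geometric_growth c q \<Lambda>"
proof -
  have mono': "mono \<Lambda>" using mono by (rule strict_mono_mono)
  obtain K where K: "\<And>k. k \<ge> K \<Longrightarrow> muntz_ratio \<Lambda> n k > q0"
    using blocks by (auto simp: quasi_lacunary_blocks_def eventually_sequentially)
  define I where "I = Suc (nat (n K))"
  have late: "q0 * \<Lambda> i \<le> \<Lambda> (i + 2 * N)" if "i \<ge> I" for i
  proof -
    have "n K < int i" using that by (simp add: I_def)
    then obtain k where k: "k \<ge> K" "n k < int i" "int i \<le> n (Suc k)" using locate_block by blast
    have "q0 * \<Lambda> i \<le> q0 * \<Lambda> (nat (n (Suc k)))"
      using k q0_gt_1 by (intro mult_left_mono monoD[OF mono']) auto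
    also have "\<dots> \<le> \<Lambda> (nat (n (Suc (Suc k))))" using k by (intro ratio_lower K) simp
    also have "\<dots> \<le> \<Lambda> (i + 2 * N)"
      using n_Suc_le[of k] n_Suc_le[of "Suc k"] k by (intro monoD[OF mono']) auto
    finally show ?thesis .
  qed
  show ?thesis
  proof (rule geometric_growthI[OF mono' pos q0_gt_1])
    show "0 < I + 2 * N" by (simp add: I_def)
    fix i
    \<comment> \<open>The finitely many indices before \<open>I\<close> are absorbed by enlarging the number of steps by \<open>I\<close>.\<close>
    have "q0 * \<Lambda> i \<le> q0 * \<Lambda> (max i I)" using q0_gt_1 by (intro mult_left_mono monoD[OF mono']) auto
    also have "\<dots> \<le> \<Lambda> (max i I + 2 * N)" by (rule late) simp
    also have "\<dots> \<le> \<Lambda> (i + (I + 2 * N))" by (intro monoD[OF mono']) auto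
    finally show "q0 * \<Lambda> i \<le> \<Lambda> (i + (I + 2 * N))" .
  qed
qed

lemma exponent_ratio_bounded:
  assumes q': "q' > 1" and sub: "\<forall>\<^sub>F k in sequentially. muntz_ratio \<Lambda> n k \<le> q'"
  shows "\<exists>D>0. \<forall>k. \<Lambda> (Suc k) \<le> D * \<Lambda> k"
proof -
  have mono': "mono \<Lambda>" using mono by (rule strict_mono_mono)
  obtain K where K: "\<And>k. k \<ge> K \<Longrightarrow> muntz_ratio \<Lambda> n k \<le> q'"
    using sub by (auto simp: eventually_sequentially)
  have ratio: "\<Lambda> (nat (n (Suc k))) \<le> q' * \<Lambda> (nat (n k))" if "k \<ge> K" for k
    using K[OF that] pos[of "nat (n k)"] by (simp add: muntz_ratio_def field_simps)
  define I where "I = Suc (nat (n K))"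
  define D where "D = max (q' * q') (\<Lambda> I / \<Lambda> 0)"
  have D: "q' * q' \<le> D" "\<Lambda> I / \<Lambda> 0 \<le> D" by (auto simp: D_def)
  have D0: "D > 0" using D(1) q' by (meson less_le_trans mult_pos_pos order.strict_trans zero_less_one)
  have "\<Lambda> (Suc i) \<le> D * \<Lambda> i" for i
  proof (cases "i < I")
    case True
    have "\<Lambda> (Suc i) \<le> \<Lambda> I" using True by (intro monoD[OF mono']) simp
    also have "\<dots> = \<Lambda> I / \<Lambda> 0 * \<Lambda> 0" using pos[of 0] by simp
    also have "\<dots> \<le> D * \<Lambda> i" using D D0 pos[of 0] by (intro mult_mono monoD[OF mono']) (auto simp: less_imp_le)
    finally show ?thesis .
  next
    case False
    then have "n K < int i" by (simp add: I_def)
    then obtain k where k: "k \<ge> K" "n k < int i" "int i \<le> n (Suc k)" using locate_block by blast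
    have "n (Suc k) < n (Suc (Suc k))" by (rule strict_monoD[OF n_strict_mono]) simp
    then have "\<Lambda> (Suc i) \<le> \<Lambda> (nat (n (Suc (Suc k))))" using k by (intro monoD[OF mono']) simp
    also have "\<dots> \<le> q' * \<Lambda> (nat (n (Suc k)))" using k by (intro ratio) simp
    also have "\<dots> \<le> q' * (q' * \<Lambda> (nat (n k)))" using k q' by (intro mult_left_mono ratio) auto
    also have "\<dots> \<le> q' * (q' * \<Lambda> i)" using k q' by (intro mult_left_mono monoD[OF mono']) auto
    also have "\<dots> \<le> D * \<Lambda> i" using D pos[of i] by (simp add: mult_right_mono flip: mult.assoc)
    finally show ?thesis .
  qed
  then show ?thesis using D0 by blast
qed

end

section \<open>Testing the embedding on monomials\<close>

text \<open>
  Since \<open>(1 - s)\<^sup>l \<le> e\<^sup>-\<^sup>l\<^sup>s\<close>, the beta integral is at most a rescaled gamma integral.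
\<close>
lemma nn_integral_nu_monomial_le:
  assumes \<alpha>: "\<alpha> > 0" and l: "l > 0"
  shows "(\<integral>\<^sup>+t. ennreal (t powr l) \<partial>nu (\<alpha> - 1)) \<le> ennreal (Gamma \<alpha> * l powr (- \<alpha>))"
proof -
  let ?g = "\<lambda>u. u powr (\<alpha> - 1) / exp u"
  have "(\<integral>\<^sup>+u. ennreal (indicator {0..} u * ?g u) \<partial>lborel) = ennreal (Gamma \<alpha>)"
  proof (rule nn_integral_has_integral_lborel)
    have "((\<lambda>u. if u \<in> {0..} then ?g u else 0) has_integral Gamma \<alpha>) UNIV"
      unfolding has_integral_restrict_UNIV by (rule Gamma_integral_real[OF \<alpha>])
    moreover have "(\<lambda>u. if u \<in> {0..} then ?g u else 0) = (\<lambda>u. indicator {0..} u * ?g u)"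
      by (auto simp: fun_eq_iff)
    ultimately show "((\<lambda>u. indicator {0..} u * ?g u) has_integral Gamma \<alpha>) UNIV" by simp
  qed auto
  also have "(\<integral>\<^sup>+u. ennreal (indicator {0..} u * ?g u) \<partial>lborel)
     = ennreal l * (\<integral>\<^sup>+s. ennreal (indicator {0..} (l * s) * ?g (l * s)) \<partial>lborel)"
    using nn_integral_real_affine[of "\<lambda>u. ennreal (indicator {0..} u * ?g u)" l 0] l by simp
  also have "\<dots> = (\<integral>\<^sup>+s. ennreal l * ennreal (indicator {0..} (l * s) * ?g (l * s)) \<partial>lborel)"
    by (rule nn_integral_cmult[symmetric]) measurable
  also have "\<dots> = (\<integral>\<^sup>+s. ennreal (l powr \<alpha>) * (ennreal (s powr (\<alpha> - 1) * exp (- (l * s))) * indicator {0..} s) \<partial>lborel)"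
  proof (intro nn_integral_cong)
    fix s :: real
    show "ennreal l * ennreal (indicator {0..} (l * s) * ?g (l * s)) = ennreal (l powr \<alpha>) * (ennreal (s powr (\<alpha> - 1) * exp (- (l * s))) * indicator {0..} s)"
    proof (cases "s \<ge> 0")
      case True
      have "l * ?g (l * s) = l powr \<alpha> * (s powr (\<alpha> - 1) * exp (- (l * s)))"
      proof -
        have "l * ?g (l * s) = (l * l powr (\<alpha> - 1)) * (s powr (\<alpha> - 1) * exp (- (l * s)))"
          by (simp add: powr_mult exp_minus divide_inverse)
        moreover have "l * l powr (\<alpha> - 1) = l powr \<alpha>"
          using powr_mult_base[of l "\<alpha> - 1"] l by simp
        ultimately show ?thesis by (simp only:)
      qed
      then have "ennreal l * ennreal (?g (l * s)) = ennreal (l powr \<alpha>) * ennreal (s powr (\<alpha> - 1) * exp (- (l * s)))"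
        using l by (subst (1 2) ennreal_mult'[symmetric]) auto
      then show ?thesis using True l by simp
    qed (use l in \<open>simp add: zero_le_mult_iff\<close>)
  qed
  also have "\<dots> = ennreal (l powr \<alpha>) * (\<integral>\<^sup>+s\<in>{0..}. ennreal (s powr (\<alpha> - 1) * exp (- (l * s))) \<partial>lborel)"
    by (rule nn_integral_cmult) measurable
  finally have laplace: "ennreal (l powr \<alpha>) * (\<integral>\<^sup>+s\<in>{0..}. ennreal (s powr (\<alpha> - 1) * exp (- (l * s))) \<partial>lborel) = ennreal (Gamma \<alpha>)" .
  have "(\<integral>\<^sup>+t. ennreal (t powr l) \<partial>nu (\<alpha> - 1)) = (\<integral>\<^sup>+t\<in>{0..1}. ennreal ((1 - t) powr (\<alpha> - 1)) * ennreal (t powr l) \<partial>lborel)"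
    by (rule nn_integral_nu) measurable
  also have "\<dots> = (\<integral>\<^sup>+s. ennreal ((1 - (1 - s)) powr (\<alpha> - 1)) * ennreal ((1 - s) powr l) * indicator {0..1} (1 - s) \<partial>lborel)"
    using nn_integral_real_affine[of "\<lambda>t. ennreal ((1 - t) powr (\<alpha> - 1)) * ennreal (t powr l) * indicator {0..1} t" "- 1" 1]
    by simp
  also have "\<dots> \<le> (\<integral>\<^sup>+s\<in>{0..}. ennreal (s powr (\<alpha> - 1) * exp (- (l * s))) \<partial>lborel)"
  proof (rule nn_integral_mono)
    fix s :: real
    show "ennreal ((1 - (1 - s)) powr (\<alpha> - 1)) * ennreal ((1 - s) powr l) * indicator {0..1} (1 - s)
      \<le> ennreal (s powr (\<alpha> - 1) * exp (- (l * s))) * indicator {0..} s"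
    proof (cases "0 \<le> s \<and> s \<le> 1")
      case True
      have "(1 - s) powr l \<le> exp (- s) powr l"
        using True l exp_ge_add_one_self[of "- s"] by (intro powr_mono2) auto
      also have "\<dots> = exp (- (l * s))" by (simp add: exp_powr_real mult.commute)
      finally have "s powr (\<alpha> - 1) * (1 - s) powr l \<le> s powr (\<alpha> - 1) * exp (- (l * s))"
        by (rule mult_left_mono) simp
      then show ?thesis using True by (simp add: ennreal_mult'[symmetric] ennreal_leI)
    qed (auto simp: indicator_def)
  qed
  also have "\<dots> = ennreal (l powr (- \<alpha>)) * (ennreal (l powr \<alpha>) * (\<integral>\<^sup>+s\<in>{0..}. ennreal (s powr (\<alpha> - 1) * exp (- (l * s))) \<partial>lborel))"
    using l by (subst ennreal_mult_mult) (auto simp flip: powr_add)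
  also have "\<dots> = ennreal (Gamma \<alpha> * l powr (- \<alpha>))"
    unfolding laplace using Gamma_real_pos[OF \<alpha>] by (simp add: ennreal_mult'[symmetric] mult.commute)
  finally show ?thesis .
qed

lemma monomial_in_muntz_space: "(\<lambda>t. complex_of_real (t powr \<Lambda> k)) \<in> muntz_space \<Lambda>"
proof -
  have "complex_of_real (t powr \<Lambda> k) = (\<Sum>i\<le>k. (if i = k then 1 else 0) * complex_of_real (t powr \<Lambda> i))" for t
    by (simp add: if_distrib[of "\<lambda>c. c * _"] cong: if_cong)
  then show ?thesis
    unfolding muntz_space_def by (intro CollectI exI[of _ k] exI[of _ "\<lambda>i. if i = k then 1 else 0"] ballI)
qed

text \<open>
  The parameter \<open>e\<close> is compared with the last exponent that is at most \<open>1 / e\<close>; bounded ratios make this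
  exponent at least \<open>1 / (D * e)\<close>. Finiteness of \<open>\<mu>\<close> takes care of the values of \<open>e\<close> that are bounded away from \<open>0\<close>.
\<close>
lemma muntz_embeds_imp_carleson:
  assumes growth: "geometric_growth c q \<Lambda>" and \<alpha>: "\<alpha> > 0" and \<beta>: "\<beta> \<ge> 1"
    and ratio: "D > 0" "\<And>k. \<Lambda> (Suc k) \<le> D * \<Lambda> k"
    and bmu: "borel_measure_unit \<mu>" and emb: "muntz_embeds \<Lambda> 1 (nu (\<alpha> - 1)) \<beta> \<mu>"
  shows "\<mu> \<in> carleson_class (\<alpha> * \<beta>)"
proof -
  interpret finite_measure \<mu> using bmu by (simp add: borel_measure_unit_def)
  note space = borel_measure_unit_sets(1)[OF bmu] and sets = borel_measure_unit_sets(2)[OF bmu]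
  have pos: "\<Lambda> k > 0" for k using geometric_growth_pos[OF growth] .
  define g where "g = \<alpha> * \<beta>"
  have g: "g > 0" using \<alpha> \<beta> by (simp add: g_def)
  define M where "M = measure \<mu> (space \<mu>)"
  have M: "emeasure \<mu> A \<le> ennreal M" for A
    unfolding M_def using emeasure_space[of \<mu> A] by (simp add: emeasure_eq_measure)
  have M0: "M \<ge> 0" by (simp add: M_def)
  obtain C where C: "C > 0" "\<And>f. f \<in> muntz_space \<Lambda> \<Longrightarrow> Lp_norm \<beta> \<mu> f \<le> ennreal C * Lp_norm 1 (nu (\<alpha> - 1)) f"
    using emb by (auto simp: muntz_embeds_def)
  define E where "E = exp (2 * \<beta>) * (C * Gamma \<alpha>) powr \<beta>"
  have E0: "E \<ge> 0" by (simp add: E_def)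
  have test: "emeasure \<mu> {1 - e..1} \<le> ennreal (E * \<Lambda> k powr (- g))"
    if e: "0 < e" "e \<le> 1 / 2" "e * \<Lambda> k \<le> 1" for e k
  proof -
    define f where "f t = complex_of_real (t powr \<Lambda> k)" for t
    define I where "I = (\<integral>\<^sup>+t. ennreal (norm (f t) powr \<beta>) \<partial>\<mu>)"
    have J: "(\<integral>\<^sup>+t. ennreal (norm (f t) powr 1) \<partial>nu (\<alpha> - 1)) \<le> ennreal (Gamma \<alpha> * \<Lambda> k powr (- \<alpha>))"
      using nn_integral_nu_monomial_le[OF \<alpha> pos[of k]] by (simp add: f_def)
    then obtain j where j: "(\<integral>\<^sup>+t. ennreal (norm (f t) powr 1) \<partial>nu (\<alpha> - 1)) = ennreal j" "j \<ge> 0"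
      by (cases "\<integral>\<^sup>+t. ennreal (norm (f t) powr 1) \<partial>nu (\<alpha> - 1)") (auto simp: top.extremum_unique)
    have "Lp_norm 1 (nu (\<alpha> - 1)) f = ennreal j"
      unfolding Lp_norm_def Let_def j(1) using j(2) by simp
    then have "Lp_norm 1 (nu (\<alpha> - 1)) f \<le> ennreal (Gamma \<alpha> * \<Lambda> k powr (- \<alpha>))" using J j(1) by simp
    then have "ennreal C * Lp_norm 1 (nu (\<alpha> - 1)) f \<le> ennreal C * ennreal (Gamma \<alpha> * \<Lambda> k powr (- \<alpha>))"
      by (rule mult_left_mono) simp
    then have "ennreal C * Lp_norm 1 (nu (\<alpha> - 1)) f \<le> ennreal (C * Gamma \<alpha> * \<Lambda> k powr (- \<alpha>))"
      using C by (simp add: ennreal_mult'[symmetric] mult.assoc)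
    then have norm_le: "Lp_norm \<beta> \<mu> f \<le> ennreal (C * Gamma \<alpha> * \<Lambda> k powr (- \<alpha>))"
      using C(2)[of f] monomial_in_muntz_space[of \<Lambda> k] unfolding f_def by (blast intro: order.trans)
    have fin: "I \<noteq> \<infinity>"
    proof
      assume "I = \<infinity>"
      then have "Lp_norm \<beta> \<mu> f = \<infinity>" by (simp add: Lp_norm_def I_def)
      then show False using norm_le by (simp add: top.extremum_unique)
    qed
    then obtain i where i: "I = ennreal i" "i \<ge> 0" by (cases I) auto
    have Gpos: "Gamma \<alpha> > 0" using Gamma_real_pos[OF \<alpha>] .
    have "Lp_norm \<beta> \<mu> f = ennreal (i powr (1 / \<beta>))" using i by (simp add: Lp_norm_def I_def)
    then have "i powr (1 / \<beta>) \<le> C * Gamma \<alpha> * \<Lambda> k powr (- \<alpha>)"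
      using norm_le C Gpos by simp
    then have "(i powr (1 / \<beta>)) powr \<beta> \<le> (C * Gamma \<alpha> * \<Lambda> k powr (- \<alpha>)) powr \<beta>"
      using \<beta> by (intro powr_mono2) auto
    then have i_le: "i \<le> (C * Gamma \<alpha>) powr \<beta> * \<Lambda> k powr (- g)"
      using \<beta> i by (simp add: powr_powr powr_mult g_def)
    have low: "exp (- (2 * \<beta>)) \<le> norm (f t) powr \<beta>" if t: "t \<in> {1 - e..1}" for t
    proof -
      have t0: "t > 0" using t e by auto
      \<comment> \<open>On \<open>[1 - e, 1]\<close> the logarithm is at least \<open>- 2 * e\<close> because \<open>e \<le> 1 / 2\<close>.\<close>
      have "- (2 * e) \<le> - e - 2 * e\<^sup>2"
        using e by (simp add: power2_eq_square) 
      also have "\<dots> \<le> ln (1 - e)" using e by (intro ln_one_minus_pos_lower_bound) auto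
      also have "\<dots> \<le> ln t" using t e t0 by (subst ln_le_cancel_iff) auto
      finally have "\<Lambda> k * - (2 * e) \<le> \<Lambda> k * ln t" using pos[of k] by (intro mult_left_mono) auto
      moreover have "- 2 \<le> \<Lambda> k * - (2 * e)" using e(3) by (simp add: mult.commute)
      ultimately have "- 2 \<le> \<Lambda> k * ln t" by linarith
      then have "- (2 * \<beta>) \<le> \<beta> * (\<Lambda> k * ln t)" using \<beta> by (metis mult.commute mult_left_mono mult_minus_right order.trans zero_le_one)
      then show ?thesis using t0 by (simp add: f_def powr_powr powr_def mult_ac)
    qed
    have "{1 - e..1} \<in> sets \<mu>" using e by (intro sets) auto
    then have "ennreal (exp (- (2 * \<beta>))) * emeasure \<mu> {1 - e..1} = (\<integral>\<^sup>+t. ennreal (exp (- (2 * \<beta>))) * indicator {1 - e..1} t \<partial>\<mu>)"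
      by (simp add: nn_integral_cmult_indicator)
    also have "\<dots> \<le> I"
      unfolding I_def by (intro nn_integral_mono) (auto simp: indicator_def intro!: ennreal_leI low)
    finally have "ennreal (exp (- (2 * \<beta>))) * emeasure \<mu> {1 - e..1} \<le> ennreal i" unfolding i(1) .
    then have "ennreal (exp (2 * \<beta>)) * (ennreal (exp (- (2 * \<beta>))) * emeasure \<mu> {1 - e..1}) \<le> ennreal (exp (2 * \<beta>)) * ennreal i"
      by (rule mult_left_mono) simp
    then have "emeasure \<mu> {1 - e..1} \<le> ennreal (exp (2 * \<beta>) * i)"
      by (subst (asm) ennreal_mult_mult) (auto simp: ennreal_mult' simp flip: exp_add)
    also have "\<dots> \<le> ennreal (E * \<Lambda> k powr (- g))"
      unfolding E_def using i_le by (intro ennreal_leI) (simp add: mult.assoc)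
    finally show ?thesis .
  qed
  define A where "A = M * 2 powr g + M * \<Lambda> 0 powr g + E * D powr g + 1"
  have A_ge: "M * 2 powr g \<le> A" "M * \<Lambda> 0 powr g \<le> A" "E * D powr g \<le> A" "A > 0"
    using M0 E0 by (auto simp: A_def add_nonneg_pos)
  have "emeasure \<mu> {1 - e..1} \<le> ennreal (A * e powr g)" if e: "e \<in> {0<..<1}" for e
  proof -
    have e0: "e > 0" using e by simp
    have triv: "emeasure \<mu> {1 - e..1} \<le> ennreal (A * e powr g)" if "t \<ge> 0" "1 \<le> t * e" "M * t powr g \<le> A" for t
    proof -
      have "1 \<le> (t * e) powr g" using that g by (intro ge_one_powr_ge_zero) auto
      then have "M * 1 \<le> M * (t * e) powr g" using M0 by (intro mult_left_mono)
      also have "\<dots> = M * t powr g * e powr g" by (simp add: powr_mult)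
      also have "\<dots> \<le> A * e powr g" using that by (intro mult_right_mono) auto
      finally have "M \<le> A * e powr g" by simp
      then show ?thesis using M[of "{1 - e..1}"] by (rule order.trans[rotated, OF ennreal_leI])
    qed
    consider "e > 1 / 2" | "1 < \<Lambda> 0 * e" | "e \<le> 1 / 2" "\<Lambda> 0 * e \<le> 1" by linarith
    then show ?thesis
    proof cases
      case 1
      then show ?thesis using A_ge by (intro triv[of 2]) auto
    next
      case 2
      then show ?thesis using A_ge pos[of 0] by (intro triv[of "\<Lambda> 0"]) auto
    next
      case 3
      have "\<exists>k. 1 < \<Lambda> k * e"
      proof -
        have cq: "c > 0" "q > 1" "\<And>k j. c * q ^ j * \<Lambda> k \<le> \<Lambda> (k + j)" using growth by (auto simp: geometric_growth_def)
        obtain j where "1 / (c * \<Lambda> 0 * e) < q ^ j" using real_arch_pow[OF cq(2)] by blast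
        then have "1 < c * q ^ j * \<Lambda> 0 * e" using cq pos[of 0] e0 by (simp add: field_simps)
        also have "\<dots> \<le> \<Lambda> (0 + j) * e" using cq(3)[of j 0] e0 by (intro mult_right_mono) auto
        finally show ?thesis by auto
      qed
      then have L: "1 < \<Lambda> (LEAST k. 1 < \<Lambda> k * e) * e" by (rule LeastI_ex[where P = "\<lambda>k. 1 < \<Lambda> k * e"])
      then obtain k where k: "(LEAST k. 1 < \<Lambda> k * e) = Suc k" using 3 by (cases "LEAST k. 1 < \<Lambda> k * e") auto
      have k1: "1 < \<Lambda> (Suc k) * e" using L k by simp
      have "\<not> 1 < \<Lambda> k * e" using not_less_Least[of k "\<lambda>k. 1 < \<Lambda> k * e"] k by simp
      then have k2: "e * \<Lambda> k \<le> 1" by (simp add: mult.commute)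
      have "\<Lambda> (Suc k) * e \<le> D * \<Lambda> k * e" using e0 by (intro mult_right_mono ratio(2)) simp
      then have "1 < D * \<Lambda> k * e" using k1 by linarith
      then have "1 / \<Lambda> k \<le> D * e" using pos[of k] by (simp add: field_simps)
      then have "(1 / \<Lambda> k) powr g \<le> (D * e) powr g" using pos[of k] g by (intro powr_mono2) auto
      moreover have "\<Lambda> k powr (- g) = (1 / \<Lambda> k) powr g" by (simp only: powr_divide powr_minus_divide powr_one_eq_one)
      ultimately have Lk: "\<Lambda> k powr (- g) \<le> D powr g * e powr g" by (simp only: powr_mult)
      have "emeasure \<mu> {1 - e..1} \<le> ennreal (E * \<Lambda> k powr (- g))" using e 3 k2 by (intro test) auto
      also have "\<dots> \<le> ennreal (E * (D powr g * e powr g))" using E0 Lk by (intro ennreal_leI mult_left_mono)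
      also have "\<dots> \<le> ennreal (A * e powr g)"
        unfolding mult.assoc[symmetric] using A_ge by (intro ennreal_leI mult_right_mono) auto
      finally show ?thesis .
    qed
  qed
  then show ?thesis using bmu A_ge(4) unfolding carleson_class_def g_def[symmetric] by blast
qed

section \<open>The characterization\<close>

theorem corollary1p10:
  fixes \<Lambda> :: "nat \<Rightarrow> real" and \<alpha> \<beta> :: real and \<mu> :: "real measure"
  assumes "strict_mono \<Lambda>"
    and "\<And>k. \<Lambda> k > 0"
    and "summable (\<lambda>k. 1 / \<Lambda> k)"
    and "quasi_lacunary_subgeometric \<Lambda>"
    and "\<beta> \<ge> 1"
    and "\<alpha> > 0"
    and "borel_measure_unit \<mu>"
  shows "\<mu> \<in> carleson_class (\<alpha> * \<beta>) \<longleftrightarrow>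
         (\<forall>p\<ge>\<beta>. muntz_embeds \<Lambda> (p / \<beta>) (nu (\<alpha> - 1)) p \<mu>)"
proof -
  obtain N q0 n q' where blocks: "quasi_lacunary_blocks \<Lambda> N q0 n"
    and q': "q' > 1" "\<forall>\<^sub>F k in sequentially. muntz_ratio \<Lambda> n k \<le> q'"
    using assms(4) by (auto simp: quasi_lacunary_subgeometric_def)
  interpret muntz_blocks \<Lambda> N q0 n
    by unfold_locales (use assms blocks in auto)
  obtain c q where growth: "geometric_growth c q \<Lambda>" using exponent_growth by blast
  obtain D where D: "D > 0" "\<And>k. \<Lambda> (Suc k) \<le> D * \<Lambda> k"
    using exponent_ratio_bounded[OF q'] by blast
  show ?thesis
  proof
    assume "\<mu> \<in> carleson_class (\<alpha> * \<beta>)"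
    then show "\<forall>p\<ge>\<beta>. muntz_embeds \<Lambda> (p / \<beta>) (nu (\<alpha> - 1)) p \<mu>"
      using carleson_imp_muntz_embeds[OF growth] assms by blast
  next
    assume "\<forall>p\<ge>\<beta>. muntz_embeds \<Lambda> (p / \<beta>) (nu (\<alpha> - 1)) p \<mu>"
    then have "muntz_embeds \<Lambda> (\<beta> / \<beta>) (nu (\<alpha> - 1)) \<beta> \<mu>" by blast
    then show "\<mu> \<in> carleson_class (\<alpha> * \<beta>)"
      using muntz_embeds_imp_carleson[OF growth] assms D by simp
  qed
qed

end
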